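(* Let $r$ be a fixed integer. Then there exist algorithms whose input data consists of a number $n$ and an evaluation oracle for (a) a rank function $\varphi$ of a matroid $M$ on $n$ elements satisfying $\varphi(A)\le r$ for all $A\subseteq[n]$, or (b) an integral polymatroid rank function $\psi$ on $[n]$ satisfying $\psi(A)\le r$ for all $A\subseteq[n]$, which compute, in time polynomial in $n$, the Ehrhart polynomial (in particular, the volume) of the matroid polytope $\mathcal P(M)$, the independence matroid polytope $\mathcal P^{\mathrm{In}}(M)$, and the polymatroid $\mathcal P(\psi)$, respectively.
   Context: $[n]=\{1,\dots,n\}$. For a matroid $M$ on $[n]$ with set of bases $\mathcal B$ and rank function $\varphi(A)=\max\{|X|: X\subseteq A,\ X \text{ independent}\}$, and for $S\subseteq[n]$ let $e_S=\sum_{i\in S}e_i\in\mathbb R^n$ ($e_i$ the standard unit vectors). The matroid polytope is $\mathcal P(M)=\mathrm{conv}\{e_B: B\in\mathcal B\}$ and the independence matroid polytope is $\mathcal P^{\mathrm{In}}(M)=\mathrm{conv}\{e_I: I\subseteq B\in\mathcal B\}$. A function $\psi:2^{[n]}\to\mathbb R$ is a polymatroid rank function if it is submodular ($\psi(X\cap Y)+\psi(X\cup Y)\le\psi(X)+\psi(Y)$), non-decreasing ($X\subseteq Y\Rightarrow \psi(X)\le\psi(Y)$), and $\psi(\emptyset)=0$; it is integral if it takes integer values. The polymatroid is $\mathcal P(\psi)=\{x\in\mathbb R^n: \sum_{i\in A}x_i\le\psi(A)\ \forall A\subseteq[n],\ x\ge 0\}$. For an integral polytope $\mathcal P\subseteq\mathbb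 R^n$, the Ehrhart polynomial is $i(\mathcal P,k)=\#(k\mathcal P\cap\mathbb Z^n)$ for integers $k\ge1$ (with $i(\mathcal P,0)=1$); its leading coefficient is the normalized volume of $\mathcal P$ (relative to the lattice of the affine span). An evaluation oracle returns $\varphi(A)$ (resp. $\psi(A)$) for a queried $A\subseteq[n]$. *)

theory Defs
  imports
    "HOL-Analysis.Analysis"
    "HOL-Library.Function_Algebras"
    "HOL-Library.Log_Nat"
    "HOL-Computational_Algebra.Polynomial"
begin

section \<open>Real space of varying dimension\<close>

text \<open>
  The dimension n is part of the input of the algorithms, hence it cannot be a type.  Points of
  n-dimensional real space are functions \<^typ>\<open>nat \<Rightarrow> real\<close> that vanish outside \<^term>\<open>{1..n}\<close>;
  with pointwise operations the library notions of span, independence and convex hull apply.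
\<close>

instantiation "fun" :: (type, real_vector) real_vector
begin

definition scaleR_fun :: "real \<Rightarrow> ('a \<Rightarrow> 'b) \<Rightarrow> 'a \<Rightarrow> 'b"
  where "scaleR_fun c f = (\<lambda>x. c *\<^sub>R f x)"

instance
  by standard
    (simp_all add: scaleR_fun_def plus_fun_def fun_eq_iff scaleR_add_right scaleR_add_left)

end


section \<open>Matroids and polymatroids\<close>

definition matroid_bases :: "nat \<Rightarrow> nat set set \<Rightarrow> bool"
  where "matroid_bases n \<B> \<longleftrightarrow>
    \<B> \<noteq> {} \<and> (\<forall>B\<in>\<B>. B \<subseteq> {1..n}) \<and>
    (\<forall>B\<in>\<B>. \<forall>B'\<in>\<B>. \<forall>x\<in>B - B'. \<exists>y\<in>B' - B. insert y (B - {x}) \<in> \<B>)"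

definition indep_sets :: "nat set set \<Rightarrow> nat set set"
  where "indep_sets \<B> = {I. \<exists>B\<in>\<B>. I \<subseteq> B}"

definition matroid_rank :: "nat set set \<Rightarrow> nat set \<Rightarrow> nat"
  where "matroid_rank \<B> A = Max (card ` {X \<in> indep_sets \<B>. X \<subseteq> A})"

definition matroid_polytope :: "nat set set \<Rightarrow> (nat \<Rightarrow> real) set"
  where "matroid_polytope \<B> = convex hull (indicat_real ` \<B>)"

definition independence_polytope :: "nat set set \<Rightarrow> (nat \<Rightarrow> real) set"
  where "independence_polytope \<B> = convex hull (indicat_real ` indep_sets \<B>)"

definition polymatroid_rank :: "nat \<Rightarrow> (nat set \<Rightarrow> real) \<Rightarrow> bool"
  where "polymatroid_rank n \<psi> \<longleftrightarrow>
    (\<forall>X\<subseteq>{1..n}. \<forall>Y\<subseteq>{1..n}. \<psi> (X \<inter> Y) + \<psi> (X \<union> Y) \<le> \<psi> X + \<psi> Y) \<and>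
    (\<forall>X\<subseteq>{1..n}. \<forall>Y\<subseteq>{1..n}. X \<subseteq> Y \<longrightarrow> \<psi> X \<le> \<psi> Y) \<and>
    \<psi> {} = 0"

definition integral_rank :: "nat \<Rightarrow> (nat set \<Rightarrow> real) \<Rightarrow> bool"
  where "integral_rank n \<psi> \<longleftrightarrow> (\<forall>A\<subseteq>{1..n}. \<psi> A \<in> \<int>)"

definition polymatroid :: "nat \<Rightarrow> (nat set \<Rightarrow> real) \<Rightarrow> (nat \<Rightarrow> real) set"
  where "polymatroid n \<psi> =
    {x. (\<forall>i. i \<notin> {1..n} \<longrightarrow> x i = 0) \<and> (\<forall>i. 0 \<le> x i) \<and>
        (\<forall>A\<subseteq>{1..n}. (\<Sum>i\<in>A. x i) \<le> \<psi> A)}"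


section \<open>Ehrhart polynomial and normalized volume\<close>

definition integer_points :: "(nat \<Rightarrow> real) set"
  where "integer_points = {x. \<forall>i. x i \<in> \<int>}"

definition ehrhart_count :: "(nat \<Rightarrow> real) set \<Rightarrow> nat \<Rightarrow> nat"
  where "ehrhart_count P k =
    (if k = 0 then 1 else card ((\<lambda>x. real k *\<^sub>R x) ` P \<inter> integer_points))"

definition is_ehrhart_poly :: "(nat \<Rightarrow> real) set \<Rightarrow> real poly \<Rightarrow> bool"
  where "is_ehrhart_poly P p \<longleftrightarrow> (\<forall>k. poly p (real k) = real (ehrhart_count P k))"

definition direction_lattice :: "(nat \<Rightarrow> real) set \<Rightarrow> (nat \<Rightarrow> real) set"
  where "direction_lattice P = span {x - y | x y. x \<in> P \<and> y \<in> P} \<inter> integer_points"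

definition lattice_basis :: "nat \<Rightarrow> (nat \<Rightarrow> nat \<Rightarrow> real) \<Rightarrow> (nat \<Rightarrow> real) set \<Rightarrow> bool"
  where "lattice_basis d b L \<longleftrightarrow>
    inj_on b {..<d} \<and> independent (b ` {..<d}) \<and>
    L = {\<Sum>j<d. real_of_int (c j) *\<^sub>R b j | c. True}"

text \<open>
  Volume within the affine span, scaled so that a fundamental parallelepiped of the lattice of
  integer directions has volume 1: it is the Lebesgue measure of the polytope in coordinates with
  respect to a lattice basis.  The value does not depend on the basis or the base point.
\<close>

definition has_normalized_volume :: "(nat \<Rightarrow> real) set \<Rightarrow> real \<Rightarrow> bool"
  where "has_normalized_volume P v \<longleftrightarrow>
    (\<exists>d b. \<exists>a\<in>P. lattice_basis d b (direction_lattice P) \<and>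
      v = measure (Pi\<^sub>M {..<d} (\<lambda>_. lborel))
            {t \<in> {..<d} \<rightarrow>\<^sub>E UNIV. a + (\<Sum>j<d. t j *\<^sub>R b j) \<in> P})"


section \<open>Random access machines with an evaluation oracle\<close>

text \<open>
  Algorithms are programs of a structured random access machine over the integers.  The memory
  consists of named integer arrays; a scalar variable is cell 0 of its array.  Running time is
  measured by the logarithmic cost criterion: every access and every arithmetic operation costs
  the bit lengths of the addresses and operands involved, so that polynomial time is polynomial
  time on a Turing machine.
\<close>

type_synonym memory = "string \<Rightarrow> int \<Rightarrow> int"

datatype aexp =
    Const int
  | Get string aexp
  | IAdd aexp aexp
  | ISub aexp aexp
  | IMul aexp aexp
  | IDiv aexp aexp
  | IMod aexp aexp

datatype bexp =
    Less aexp aexp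
  | Neg bexp
  | Conj bexp bexp

datatype com =
    Skip
  | Put string aexp aexp
  | Query string string
  | Seq com com
  | Cond bexp com com
  | While bexp com

definition int_size :: "int \<Rightarrow> nat"
  where "int_size z = 1 + nat (bitlen \<bar>z\<bar>)"

primrec aval :: "aexp \<Rightarrow> memory \<Rightarrow> int"
  where
    "aval (Const z) s = z"
  | "aval (Get x a) s = s x (aval a s)"
  | "aval (IAdd a b) s = aval a s + aval b s"
  | "aval (ISub a b) s = aval a s - aval b s"
  | "aval (IMul a b) s = aval a s * aval b s"
  | "aval (IDiv a b) s = aval a s div aval b s"
  | "aval (IMod a b) s = aval a s mod aval b s"

primrec acost :: "aexp \<Rightarrow> memory \<Rightarrow> nat"
  where
    "acost (Const z) s = int_size z"
  | "acost (Get x a) s = acost a s + int_size (aval a s) + int_size (s x (aval a s))"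
  | "acost (IAdd a b) s = acost a s + acost b s + int_size (aval a s) + int_size (aval b s)"
  | "acost (ISub a b) s = acost a s + acost b s + int_size (aval a s) + int_size (aval b s)"
  | "acost (IMul a b) s = acost a s + acost b s + int_size (aval a s) + int_size (aval b s)"
  | "acost (IDiv a b) s = acost a s + acost b s + int_size (aval a s) + int_size (aval b s)"
  | "acost (IMod a b) s = acost a s + acost b s + int_size (aval a s) + int_size (aval b s)"

primrec bval :: "bexp \<Rightarrow> memory \<Rightarrow> bool"
  where
    "bval (Less a b) s \<longleftrightarrow> aval a s < aval b s"
  | "bval (Neg b) s \<longleftrightarrow> \<not> bval b s"
  | "bval (Conj b c) s \<longleftrightarrow> bval b s \<and> bval c s"

primrec bcost :: "bexp \<Rightarrow> memory \<Rightarrow> nat"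
  where
    "bcost (Less a b) s = acost a s + acost b s + int_size (aval a s) + int_size (aval b s)"
  | "bcost (Neg b) s = 1 + bcost b s"
  | "bcost (Conj b c) s = 1 + bcost b s + bcost c s"

definition put :: "memory \<Rightarrow> string \<Rightarrow> int \<Rightarrow> int \<Rightarrow> memory"
  where "put s x i v = s(x := (s x)(i := v))"

text \<open>
  A query passes a subset of \<^term>\<open>{1..n}\<close> to the oracle through the nonzero cells of an array.
  The caller pays for reading these n cells and for receiving the answer.
\<close>

definition query_set :: "nat \<Rightarrow> memory \<Rightarrow> string \<Rightarrow> nat set"
  where "query_set n s x = {i \<in> {1..n}. s x (int i) \<noteq> 0}"

definition query_cost :: "nat \<Rightarrow> (nat set \<Rightarrow> int) \<Rightarrow> memory \<Rightarrow> string \<Rightarrow> nat"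
  where "query_cost n f s x =
    1 + (\<Sum>i = 1..n. int_size (int i) + int_size (s x (int i))) + int_size (f (query_set n s x))"

inductive exec :: "nat \<Rightarrow> (nat set \<Rightarrow> int) \<Rightarrow> com \<Rightarrow> memory \<Rightarrow> nat \<Rightarrow> memory \<Rightarrow> bool"
  for n :: nat and f :: "nat set \<Rightarrow> int"
  where
    Skip: "exec n f Skip s 1 s"
  | Put: "exec n f (Put x a e) s
      (1 + acost a s + acost e s + int_size (aval a s) + int_size (aval e s))
      (put s x (aval a s) (aval e s))"
  | Query: "exec n f (Query y x) s (query_cost n f s x) (put s y 0 (f (query_set n s x)))"
  | Seq: "exec n f (Seq c d) s (t + t') s''"
    if "exec n f c s t s'" "exec n f d s' t' s''"
  | CondTrue: "exec n f (Cond b c d) s (1 + bcost b s + t) s'"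
    if "bval b s" "exec n f c s t s'"
  | CondFalse: "exec n f (Cond b c d) s (1 + bcost b s + t) s'"
    if "\<not> bval b s" "exec n f d s t s'"
  | WhileFalse: "exec n f (While b c) s (1 + bcost b s) s"
    if "\<not> bval b s"
  | WhileTrue: "exec n f (While b c) s (1 + bcost b s + t + t') s''"
    if "bval b s" "exec n f c s t s'" "exec n f (While b c) s' t' s''"

inductive_cases exec_SkipE: "exec n f Skip s t s'"
inductive_cases exec_PutE: "exec n f (Put x a e) s t s'"
inductive_cases exec_QueryE: "exec n f (Query y x) s t s'"
inductive_cases exec_SeqE: "exec n f (Seq c d) s t s'"
inductive_cases exec_CondE: "exec n f (Cond b c d) s t s'"
inductive_cases exec_WhileE: "exec n f (While b c) s t s'"

lemma exec_deterministic:
  assumes "exec n f c s t s'" "exec n f c s u s''"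
  shows "u = t \<and> s'' = s'"
  using assms
proof (induction arbitrary: u s'' rule: exec.induct)
  case Skip
  then show ?case by (auto elim: exec_SkipE)
next
  case Put
  then show ?case by (auto elim: exec_PutE)
next
  case Query
  then show ?case by (auto elim: exec_QueryE)
next
  case (Seq c s t s1 d t' s2)
  from Seq.prems obtain v w m where
    "exec n f c s v m" "exec n f d m w s''" "u = v + w"
    by (rule exec_SeqE)
  with Seq.IH(1)[of v m] Seq.IH(2)[of w s''] show ?case by simp
next
  case (CondTrue b s c t s1 d)
  from CondTrue.prems CondTrue.hyps obtain v where
    "exec n f c s v s''" "u = 1 + bcost b s + v"
    by (auto elim: exec_CondE)
  with CondTrue.IH[of v s''] show ?case by simp
next
  case (CondFalse b s d t s1 c)
  from CondFalse.prems CondFalse.hyps obtain v where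
    "exec n f d s v s''" "u = 1 + bcost b s + v"
    by (auto elim: exec_CondE)
  with CondFalse.IH[of v s''] show ?case by simp
next
  case (WhileFalse b s c)
  from WhileFalse.prems show ?case
    by (rule exec_WhileE) (use WhileFalse.hyps in simp_all)
next
  case (WhileTrue b s c t s1 t' s2)
  from WhileTrue.prems obtain v w m where
    "exec n f c s v m" "exec n f (While b c) m w s''" "u = 1 + bcost b s + v + w"
    by (rule exec_WhileE) (use WhileTrue.hyps(1) in simp_all)
  with WhileTrue.IH(1)[of v m] WhileTrue.IH(2)[of w s''] show ?case by simp
qed

definition initial_memory :: "nat \<Rightarrow> memory"
  where "initial_memory n = put (\<lambda>_ _. 0) ''n'' 0 (int n)"

definition output_poly :: "memory \<Rightarrow> real poly \<Rightarrow> bool"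
  where "output_poly s p \<longleftrightarrow>
    s ''deg'' 0 = int (degree p) \<and>
    (\<forall>i\<le>degree p. 0 < s ''den'' (int i) \<and>
      coeff p i = real_of_int (s ''num'' (int i)) / real_of_int (s ''den'' (int i)))"

definition computes_ehrhart_within ::
    "com \<Rightarrow> nat \<Rightarrow> (nat set \<Rightarrow> int) \<Rightarrow> (nat \<Rightarrow> real) set \<Rightarrow> nat \<Rightarrow> bool"
  where "computes_ehrhart_within c n f P T \<longleftrightarrow>
    (\<exists>t s p. exec n f c (initial_memory n) t s \<and> t \<le> T \<and> output_poly s p \<and>
      is_ehrhart_poly P p \<and> has_normalized_volume P (lead_coeff p))"

end

theory Submission
  imports Defs
begin

text \<open>
  All three polytopes are a polymatroid of an integer rank function f, or its face on which the total
  is f [n]; by uncrossing tight sets they are hulls of their integer points.  For a nonnegative integer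
  point x, the flats violated at dilation factor k, that is x F > k f F, have vanishing reduced Euler
  characteristic unless there are none: intersecting with a flat that minimizes k f - x contracts their
  poset to a cone.  Hence the number of integer points in the k-th dilate is a signed sum over chains of
  flats of numbers of compositions with prescribed lower bounds on partial sums.  This is a polynomial
  in k, and for bounded rank only polynomially many chains occur, so it can be evaluated for
  k = 0, ..., n and interpolated.  Counting the grid cubes inside and around the polytope identifies the
  leading coefficient with the volume.

  The algorithm is one closed formula of nested sums and products of bounded depth; the class of
  functions computable in polynomial time is closed under all operations that occur in it.
\<close>

section \<open>Bit lengths\<close>

text \<open>The obstacle is that one program must serve all n: lists, recursion at run time and
  polynomial arithmetic are avoided. Flats are used rather than arbitrary violated sets because a
  flat is the closure of at most r of its elements, which leaves at most (n + 2) ^ r codes, and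
  because f strictly increases along a chain of flats, which bounds the nesting depth by r; both
  rest on f being integral. A partial sum ranges up to k f [n] <= n r. Ehrhart's theorem is not
  presupposed: the chain formula, as a function of k and the total s, is a polynomial in the region
  s >= k f F, and the line s = k f [n] gives the count. The comparison with the volume then bounds
  the degree by n, which justifies n + 1 nodes. Interpolation must be a closed formula too: n! times
  the Lagrange polynomial has integer coefficients, is evaluated at one large integer, and its
  coefficients are read off as digits. The inequalities of the whole polymatroid do not fix the
  total; a slack coordinate 0 does, so that polymatroid and base face are counted by the same
  formula.\<close>

lemma int_size_le_iff: "int_size z \<le> Suc L \<longleftrightarrow> \<bar>z\<bar> < 2 ^ L"
proof -
  have "int_size z \<le> Suc L \<longleftrightarrow> bitlen \<bar>z\<bar> \<le> int L"
    by (simp add: int_size_def nat_le_iff)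
  then show ?thesis
    by (simp add: bitlen_le_iff_power)
qed

lemma int_size_pos: "0 < int_size z"
  by (simp add: int_size_def)

lemma int_sizeE:
  obtains L where "int_size z = Suc L" "\<bar>z\<bar> < 2 ^ L"
  using int_size_pos[of z] int_size_le_iff[of z] by (metis gr0_implies_Suc le_refl)

lemma int_size_mono: "\<bar>x\<bar> \<le> \<bar>y\<bar> \<Longrightarrow> int_size x \<le> int_size y"
  by (rule int_sizeE[of y]) (auto simp: int_size_le_iff)

lemma int_size_le_nat: "\<bar>z\<bar> \<le> int m \<Longrightarrow> int_size z \<le> Suc m"
  unfolding int_size_le_iff
  using of_nat_less_two_power[of m, where 'a = int] by linarith

lemma int_size_0: "int_size 0 = 1" and int_size_1: "int_size 1 = 2"
  by (simp_all add: int_size_def bitlen_alt_def)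

text \<open>Crude for a sum, but the bound has the same form for all operations, and this
  subadditivity is the only growth condition imposed on an operation in
  \<open>computable_arith\<close> and \<open>computable_fold\<close>.\<close>

lemma int_size_add: "int_size (x + y) \<le> int_size x + int_size y"
proof -
  obtain a b where ab: "int_size x = Suc a" "\<bar>x\<bar> < 2 ^ a" "int_size y = Suc b" "\<bar>y\<bar> < 2 ^ b"
    by (metis int_sizeE)
  have "(2::int) ^ a \<le> 2 ^ (a + b)" "(2::int) ^ b \<le> 2 ^ (a + b)"
    by (intro power_increasing; simp)+
  then have "\<bar>x + y\<bar> < 2 ^ Suc (a + b)"
    using ab abs_triangle_ineq[of x y] unfolding power_Suc by linarith
  with ab show ?thesis
    using int_size_le_iff[of "x + y" "Suc (a + b)"] by simp
qed

lemma int_size_minus: "int_size (- x) = int_size x"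
  by (simp add: int_size_def)

lemma int_size_diff: "int_size (x - y) \<le> int_size x + int_size y"
  using int_size_add[of x "- y"] by (simp add: int_size_minus)

lemma int_size_mult: "int_size (x * y) \<le> int_size x + int_size y"
proof -
  obtain a b where ab: "int_size x = Suc a" "\<bar>x\<bar> < 2 ^ a" "int_size y = Suc b" "\<bar>y\<bar> < 2 ^ b"
    by (metis int_sizeE)
  then have "\<bar>x * y\<bar> < 2 ^ (a + b)"
    by (simp add: abs_mult power_add mult_strict_mono)
  with ab show ?thesis
    using int_size_le_iff[of "x * y" "a + b"] by simp
qed

lemma abs_div_pos_le: "0 < y \<Longrightarrow> \<bar>x div y\<bar> \<le> \<bar>x\<bar>" for x y :: int
  using zdiv_mono2[of x 1 y] zdiv_mono2_neg[of x 1 y] div_nonpos_pos_le0[of x y]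
    pos_imp_zdiv_nonneg_iff[of y x] by (cases "x < 0") auto

lemma int_size_div: "int_size (x div y) \<le> int_size x + int_size y"
proof -
  consider "y = 0" | "0 < y" | "0 < - y" by linarith
  then have "\<bar>x div y\<bar> \<le> \<bar>x\<bar>"
    \<comment> \<open>Division by 0 yields 0, and a negative divisor becomes positive when both
      operands are negated.\<close>
    by cases (use abs_div_pos_le[of y x] abs_div_pos_le[of "- y" "- x"] in auto)
  then have "int_size (x div y) \<le> int_size x" by (rule int_size_mono)
  then show ?thesis by linarith
qed

lemma int_size_mod: "int_size (x mod y) \<le> int_size x + int_size y"
proof (cases "y = 0")
  case False
  then have "\<bar>x mod y\<bar> \<le> \<bar>y\<bar>"
    using abs_mod_less[of y x] by linarith
  then show ?thesis using int_size_mono[of "x mod y" y] by simp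
qed simp

section \<open>Functions computable in polynomial time\<close>

text \<open>Each height owns an array for oracle arguments: the test that fills it may itself query
  the oracle, and does so at a greater height.\<close>

definition query_array :: "nat \<Rightarrow> string"
  where "query_array h = CHR ''q'' # replicate h CHR ''x''"

lemma query_array_inject [simp]: "query_array h = query_array h' \<longleftrightarrow> h = h'"
  by (auto simp: query_array_def dest: arg_cong[of _ _ length])

lemma query_array_neq [simp]:
  "query_array h \<noteq> ''m''" "query_array h \<noteq> ''n''" "query_array h \<noteq> ''y''"
  "query_array h \<noteq> ''num''" "query_array h \<noteq> ''den''" "query_array h \<noteq> ''deg''"
  "''m'' \<noteq> query_array h" "''n'' \<noteq> query_array h" "''y'' \<noteq> query_array h"
  "''num'' \<noteq> query_array h" "''den'' \<noteq> query_array h" "''deg'' \<noteq> query_array h"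
  by (simp_all add: query_array_def)

text \<open>The memory is used as a stack of height h. The cell that receives oracle answers is not
  protected, since every answer is copied at once; the output arrays are, since further values are
  computed after the first one has been written.\<close>

definition preserves :: "nat \<Rightarrow> memory \<Rightarrow> memory \<Rightarrow> bool"
  where "preserves h s s' \<longleftrightarrow>
    (\<forall>j<h. s' ''m'' (int j) = s ''m'' (int j) \<and> s' (query_array j) = s (query_array j)) \<and>
    s' ''n'' = s ''n'' \<and> s' ''num'' = s ''num'' \<and> s' ''den'' = s ''den'' \<and> s' ''deg'' = s ''deg''"

text \<open>The environment holds loop counters and the index of a coefficient, which are bounded by
  a polynomial b in n. Together with the constant bound r on the answers this allows running times
  to be bounded in terms of n alone.\<close>

definition admissible :: "int \<Rightarrow> nat poly \<Rightarrow> nat \<Rightarrow> (nat set \<Rightarrow> int) \<Rightarrow> (nat \<Rightarrow> int) \<Rightarrow> bool"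
  where "admissible r b n f e \<longleftrightarrow>
    (\<forall>A\<subseteq>{1..n}. \<bar>f A\<bar> \<le> r) \<and> (\<forall>i. \<bar>e i\<bar> \<le> int (poly b n))"

type_synonym oracle_fun = "nat \<Rightarrow> (nat set \<Rightarrow> int) \<Rightarrow> (nat \<Rightarrow> int) \<Rightarrow> int"

text \<open>
  A function of the size, the oracle and an environment of auxiliary integers is computable if, for
  every placement of the environment in the cells of \<open>m\<close> below h, some program stores the value
  in cell h without touching the cells below h.
\<close>

definition computable :: "int \<Rightarrow> oracle_fun \<Rightarrow> bool"
  where "computable r F \<longleftrightarrow> (\<forall>\<sigma> h b. (\<forall>i. \<sigma> i < h) \<longrightarrow> (\<exists>c q. \<forall>n f s.
    s ''n'' 0 = int n \<longrightarrow> admissible r b n f (\<lambda>i. s ''m'' (int (\<sigma> i))) \<longrightarrow>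
      int_size (F n f (\<lambda>i. s ''m'' (int (\<sigma> i)))) \<le> poly q n \<and>
      (\<exists>t s'. exec n f c s t s' \<and> t \<le> poly q n \<and>
         s' ''m'' (int h) = F n f (\<lambda>i. s ''m'' (int (\<sigma> i))) \<and> preserves h s s')))"

text \<open>Needed for loop limits: a computable function has values of polynomial bit length, but
  the values themselves may be exponential, for instance those of products.\<close>

definition poly_bounded :: "int \<Rightarrow> oracle_fun \<Rightarrow> bool"
  where "poly_bounded r F \<longleftrightarrow> (\<forall>b. \<exists>q. \<forall>n f e. admissible r b n f e \<longrightarrow> \<bar>F n f e\<bar> \<le> int (poly q n))"

definition computes_within where
  "computes_within n f c s h q v \<longleftrightarrow> int_size v \<le> q \<and>
      (\<exists>t s'. exec n f c s t s' \<and> t \<le> q \<and> s' ''m'' (int h) = v \<and> preserves h s s')"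

lemma computableI:
  assumes "\<And>\<sigma> h b. (\<And>i. \<sigma> i < h) \<Longrightarrow> \<exists>c q. \<forall>n f s.
    s ''n'' 0 = int n \<longrightarrow> admissible r b n f (\<lambda>i. s ''m'' (int (\<sigma> i))) \<longrightarrow>
      computes_within n f c s h (poly q n) (F n f (\<lambda>i. s ''m'' (int (\<sigma> i))))"
  shows "computable r F"
  using assms unfolding computable_def computes_within_def by blast

lemma computableE:
  assumes "computable r F" "\<And>i. \<sigma> i < h"
  obtains c q where "\<And>n f s.
    s ''n'' 0 = int n \<Longrightarrow> admissible r b n f (\<lambda>i. s ''m'' (int (\<sigma> i))) \<Longrightarrow>
      computes_within n f c s h (poly q n) (F n f (\<lambda>i. s ''m'' (int (\<sigma> i))))"
proof -
  have "\<exists>c q. \<forall>n f s. s ''n'' 0 = int n \<longrightarrow> admissible r b n f (\<lambda>i. s ''m'' (int (\<sigma> i))) \<longrightarrow>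
      computes_within n f c s h (poly q n) (F n f (\<lambda>i. s ''m'' (int (\<sigma> i))))"
    using assms unfolding computable_def computes_within_def by blast
  then show thesis using that by blast
qed

lemma preserves_trans:
  "preserves h s s' \<Longrightarrow> preserves h' s' s'' \<Longrightarrow> h \<le> h' \<Longrightarrow> preserves h s s''"
  by (auto simp: preserves_def)

lemma preserves_mono: "preserves h' s s' \<Longrightarrow> h \<le> h' \<Longrightarrow> preserves h s s'"
  by (auto simp: preserves_def)

lemma preserves_put_m: "h \<le> j \<Longrightarrow> preserves h s (put s ''m'' (int j) v)"
  by (auto simp: preserves_def put_def)

lemma preserves_put_y: "preserves h s (put s ''y'' i v)"
  by (auto simp: preserves_def put_def)

lemma preserves_put_query: "h \<le> j \<Longrightarrow> preserves h s (put s (query_array j) i v)"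
  by (auto simp: preserves_def put_def)

lemma preservesD:
  assumes "preserves h s s'"
  shows "j < h \<Longrightarrow> s' ''m'' (int j) = s ''m'' (int j)" "s' ''n'' = s ''n''"
    "j < h \<Longrightarrow> s' (query_array j) = s (query_array j)"
  using assms by (auto simp: preserves_def)

abbreviation cell :: "nat \<Rightarrow> aexp" where "cell h \<equiv> Get ''m'' (Const (int h))"

lemma put_same [simp]: "put s x i v x i = v" and put_other [simp]: "j \<noteq> i \<Longrightarrow> put s x i v x j = s x j"
  and put_array [simp]: "y \<noteq> x \<Longrightarrow> put s x i v y = s y"
  by (simp_all add: put_def)

lemma exec_Put':
  assumes "1 + acost a s + acost e s + int_size (aval a s) + int_size (aval e s) = t"
    "put s x (aval a s) (aval e s) = s'"
  shows "exec n f (Put x a e) s t s'"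
  using exec.Put assms by metis

lemma computes_withinI:
  "int_size v \<le> q \<Longrightarrow> exec n f c s t s' \<Longrightarrow> t \<le> q \<Longrightarrow> s' ''m'' (int h) = v \<Longrightarrow> preserves h s s' \<Longrightarrow>
    computes_within n f c s h q v"
  unfolding computes_within_def by blast

section \<open>Atomic functions and arithmetic operations\<close>

lemma computable_const: "computable r (\<lambda>n f e. z)"
proof (rule computableI)
  fix \<sigma> :: "nat \<Rightarrow> nat" and h b
  let ?q = "[:1 + 2 * int_size (int h) + 2 * int_size z:]"
  show "\<exists>c q. \<forall>n f s. s ''n'' 0 = int n \<longrightarrow> admissible r b n f (\<lambda>i. s ''m'' (int (\<sigma> i))) \<longrightarrow>
      computes_within n f c s h (poly q n) z"
    by (rule exI[of _ "Put ''m'' (Const (int h)) (Const z)"], rule exI[of _ ?q])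
      (auto intro!: computes_withinI exec_Put' preserves_put_m)
qed

lemma computable_size: "computable r (\<lambda>n f e. int n)"
proof (rule computableI)
  fix \<sigma> :: "nat \<Rightarrow> nat" and h b
  let ?q = "[:8 + 2 * int_size (int h):] + smult 4 [:0, 1:]"
  show "\<exists>c q. \<forall>n f s. s ''n'' 0 = int n \<longrightarrow> admissible r b n f (\<lambda>i. s ''m'' (int (\<sigma> i))) \<longrightarrow>
      computes_within n f c s h (poly q n) (int n)"
  proof (rule exI[of _ "Put ''m'' (Const (int h)) (Get ''n'' (Const 0))"], rule exI[of _ ?q], intro allI impI)
    fix n f and s :: memory assume s: "s ''n'' 0 = int n"
    have "int_size (int n) \<le> Suc n" by (rule int_size_le_nat) simp
    then show "computes_within n f (Put ''m'' (Const (int h)) (Get ''n'' (Const 0))) s h (poly ?q n) (int n)"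
      using s by (intro computes_withinI[OF _ exec_Put'[OF refl refl]]) (auto simp: int_size_0 intro!: preserves_put_m)
  qed
qed

lemma computable_var: "computable r (\<lambda>n f e. e i)"
proof (rule computableI)
  fix \<sigma> :: "nat \<Rightarrow> nat" and h b
  let ?q = "[:8 + 2 * int_size (int h) + 2 * int_size (int (\<sigma> i)):] + smult 4 b"
  let ?c = "Put ''m'' (Const (int h)) (cell (\<sigma> i))"
  show "\<exists>c q. \<forall>n f s. s ''n'' 0 = int n \<longrightarrow> admissible r b n f (\<lambda>i. s ''m'' (int (\<sigma> i))) \<longrightarrow>
      computes_within n f c s h (poly q n) (s ''m'' (int (\<sigma> i)))"
  proof (rule exI[of _ ?c], rule exI[of _ ?q], intro allI impI)
    fix n f and s :: memory assume "admissible r b n f (\<lambda>i. s ''m'' (int (\<sigma> i)))"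
    then have "int_size (s ''m'' (int (\<sigma> i))) \<le> Suc (poly b n)"
      by (intro int_size_le_nat) (auto simp: admissible_def)
    then show "computes_within n f ?c s h (poly ?q n) (s ''m'' (int (\<sigma> i)))"
      by (intro computes_withinI[OF _ exec_Put'[OF refl refl]]) (auto intro!: preserves_put_m)
  qed
qed

text \<open>A renaming of variables is absorbed by the placement, which is why
  \<open>computable\<close> quantifies over all placements. With \<open>Suc\<close> as the renaming
  an expression moves under one more binder: variable 0 is the innermost loop counter.\<close>

lemma computable_weaken:
  assumes "computable r F"
  shows "computable r (\<lambda>n f e. F n f (\<lambda>i. e (\<tau> i)))"
proof (rule computableI)
  fix \<sigma> :: "nat \<Rightarrow> nat" and h and b :: "nat poly" assume \<sigma>: "\<And>i. \<sigma> i < h"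
  obtain c q where "\<And>n f s. s ''n'' 0 = int n \<Longrightarrow> admissible r b n f (\<lambda>i. s ''m'' (int (\<sigma> (\<tau> i)))) \<Longrightarrow>
      computes_within n f c s h (poly q n) (F n f (\<lambda>i. s ''m'' (int (\<sigma> (\<tau> i)))))"
    using computableE[OF assms, of "\<sigma> \<circ> \<tau>" h b] \<sigma> by auto
  then show "\<exists>c q. \<forall>n f s. s ''n'' 0 = int n \<longrightarrow> admissible r b n f (\<lambda>i. s ''m'' (int (\<sigma> i))) \<longrightarrow>
      computes_within n f c s h (poly q n) (F n f (\<lambda>i. s ''m'' (int (\<sigma> (\<tau> i)))))"
    by (intro exI[of _ c] exI[of _ q]) (auto simp: admissible_def)
qed

text \<open>The command \<open>c h\<close> is run with the operands in cells h and h + 1.\<close>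

lemma computable_binary:
  assumes F: "computable r F" and G: "computable r G"
    and c: "\<And>h. \<exists>K. \<forall>n f (s :: memory). \<exists>t s'. exec n f (c h) s t s' \<and>
       t \<le> K * (1 + int_size (s ''m'' (int h)) + int_size (s ''m'' (int (Suc h)))) \<and>
       s' ''m'' (int h) = g (s ''m'' (int h)) (s ''m'' (int (Suc h))) \<and> preserves h s s'"
    and g: "\<And>x y. int_size (g x y) \<le> int_size x + int_size y"
  shows "computable r (\<lambda>n f e. g (F n f e) (G n f e))"
proof (rule computableI)
  fix \<sigma> :: "nat \<Rightarrow> nat" and h and b :: "nat poly" assume \<sigma>: "\<And>i. \<sigma> i < h"
  then have \<sigma>': "\<And>i. \<sigma> i < Suc h" using less_SucI by blast
  obtain c1 q1 where 1: "\<And>n f s. s ''n'' 0 = int n \<Longrightarrow> admissible r b n f (\<lambda>i. s ''m'' (int (\<sigma> i))) \<Longrightarrow>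
      computes_within n f c1 s h (poly q1 n) (F n f (\<lambda>i. s ''m'' (int (\<sigma> i))))"
    using computableE[OF F, of \<sigma> h b] \<sigma> by auto
  obtain c2 q2 where 2: "\<And>n f s. s ''n'' 0 = int n \<Longrightarrow> admissible r b n f (\<lambda>i. s ''m'' (int (\<sigma> i))) \<Longrightarrow>
      computes_within n f c2 s (Suc h) (poly q2 n) (G n f (\<lambda>i. s ''m'' (int (\<sigma> i))))"
    using computableE[OF G, of \<sigma> "Suc h" b] \<sigma>' by auto
  obtain K where K: "\<And>n f s. \<exists>t s'. exec n f (c h) s t s' \<and>
       t \<le> K * (1 + int_size (s ''m'' (int h)) + int_size (s ''m'' (int (Suc h)))) \<and>
       s' ''m'' (int h) = g (s ''m'' (int h)) (s ''m'' (int (Suc h))) \<and> preserves h s s'"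
    using c by metis
  let ?c = "Seq c1 (Seq c2 (c h))"
  let ?q = "smult (Suc K) (1 + q1 + q2)"
  show "\<exists>c q. \<forall>n f s. s ''n'' 0 = int n \<longrightarrow> admissible r b n f (\<lambda>i. s ''m'' (int (\<sigma> i))) \<longrightarrow>
      computes_within n f c s h (poly q n)
       (g (F n f (\<lambda>i. s ''m'' (int (\<sigma> i)))) (G n f (\<lambda>i. s ''m'' (int (\<sigma> i)))))"
  proof (rule exI[of _ ?c], rule exI[of _ ?q], intro allI impI)
    fix n f and s :: memory
    assume n: "s ''n'' 0 = int n" and a: "admissible r b n f (\<lambda>i. s ''m'' (int (\<sigma> i)))"
    let ?F = "F n f (\<lambda>i. s ''m'' (int (\<sigma> i)))" and ?G = "G n f (\<lambda>i. s ''m'' (int (\<sigma> i)))"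
    obtain t1 s1 where s1: "exec n f c1 s t1 s1" "t1 \<le> poly q1 n" "s1 ''m'' (int h) = ?F" "preserves h s s1"
      and F: "int_size ?F \<le> poly q1 n"
      using 1[of s n f] n a unfolding computes_within_def by blast
    have e: "s1 ''m'' (int (\<sigma> i)) = s ''m'' (int (\<sigma> i))" for i
      using \<sigma> preservesD(1)[OF s1(4)] by blast
    have n1: "s1 ''n'' 0 = int n" using s1(4) n by (simp add: preservesD)
    obtain t2 s2 where s2: "exec n f c2 s1 t2 s2" "t2 \<le> poly q2 n" "s2 ''m'' (int (Suc h)) = ?G" "preserves (Suc h) s1 s2"
      and G: "int_size ?G \<le> poly q2 n"
      using 2[of s1 n f] n1 a unfolding computes_within_def e by blast
    have s2h: "s2 ''m'' (int h) = ?F" using preservesD(1)[OF s2(4), of h] s1(3) by simp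
    obtain t3 s3 where s3: "exec n f (c h) s2 t3 s3" "t3 \<le> K * (1 + int_size ?F + int_size ?G)"
      "s3 ''m'' (int h) = g ?F ?G" "preserves h s2 s3"
      using K[of n f s2] s2h s2(3) by auto
    show "computes_within n f ?c s h (poly ?q n) (g ?F ?G)"
    proof (rule computes_withinI)
      show "int_size (g ?F ?G) \<le> poly ?q n" using g[of ?F ?G] F G by simp
      show "exec n f ?c s (t1 + (t2 + t3)) s3" using s1(1) s2(1) s3(1) by (blast intro: exec.Seq)
      have "t3 \<le> K * (1 + poly q1 n + poly q2 n)"
        using s3(2) F G by (meson add_mono le_refl le_trans mult_le_mono2)
      then show "t1 + (t2 + t3) \<le> poly ?q n" using s1(2) s2(2) by simp
      show "preserves h s s3" using s1(4) s2(4) s3(4) by (meson preserves_trans le_SucI order_refl preserves_mono)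
    qed (use s3 in auto)
  qed
qed

lemma computable_arith:
  assumes op: "\<And>a b s. aval (op a b) s = g (aval a s) (aval b s)"
      "\<And>a b s. acost (op a b) s = acost a s + acost b s + int_size (aval a s) + int_size (aval b s)"
    and g: "\<And>x y. int_size (g x y) \<le> int_size x + int_size y"
    and FG: "computable r F" "computable r G"
  shows "computable r (\<lambda>n f e. g (F n f e) (G n f e))"
proof (rule computable_binary[where c = "\<lambda>h. Put ''m'' (Const (int h)) (op (cell h) (cell (Suc h)))" and g = g, OF FG _ g])
  fix h
  let ?I = "int_size (int h)" and ?J = "int_size (int (Suc h))"
  define K where "K = 3 + 4 * ?I + 4 * ?J"
  show "\<exists>K. \<forall>n f s. \<exists>t s'. exec n f (Put ''m'' (Const (int h)) (op (cell h) (cell (Suc h)))) s t s' \<and>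
       t \<le> K * (1 + int_size (s ''m'' (int h)) + int_size (s ''m'' (int (Suc h)))) \<and>
       s' ''m'' (int h) = g (s ''m'' (int h)) (s ''m'' (int (Suc h))) \<and> preserves h s s'"
  proof (rule exI[of _ K], intro allI)
    fix n f and s :: memory
    let ?x = "s ''m'' (int h)" and ?y = "s ''m'' (int (Suc h))"
    let ?t = "1 + acost (Const (int h)) s + acost (op (cell h) (cell (Suc h))) s + ?I + int_size (g ?x ?y)"
    have "?t \<le> K + 3 * (int_size ?x + int_size ?y)"
      using g[of ?x ?y] by (simp add: op K_def)
    also have "\<dots> \<le> K * (1 + int_size ?x + int_size ?y)"
      by (simp add: K_def algebra_simps)
    finally have "?t \<le> K * (1 + int_size ?x + int_size ?y)" .
    moreover have "exec n f (Put ''m'' (Const (int h)) (op (cell h) (cell (Suc h)))) s ?t (put s ''m'' (int h) (g ?x ?y))"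
      by (rule exec_Put') (simp_all add: op)
    ultimately show "\<exists>t s'. exec n f (Put ''m'' (Const (int h)) (op (cell h) (cell (Suc h)))) s t s' \<and>
       t \<le> K * (1 + int_size (s ''m'' (int h)) + int_size (s ''m'' (int (Suc h)))) \<and>
       s' ''m'' (int h) = g (s ''m'' (int h)) (s ''m'' (int (Suc h))) \<and> preserves h s s'"
      by (intro exI[of _ ?t] exI[of _ "put s ''m'' (int h) (g ?x ?y)"]) (simp add: preserves_put_m)
  qed
qed

lemma computable_add: "computable r F \<Longrightarrow> computable r G \<Longrightarrow> computable r (\<lambda>n f e. F n f e + G n f e)"
  by (rule computable_arith[of IAdd]) (simp_all add: int_size_add)

lemma computable_diff: "computable r F \<Longrightarrow> computable r G \<Longrightarrow> computable r (\<lambda>n f e. F n f e - G n f e)"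
  by (rule computable_arith[of ISub]) (simp_all add: int_size_diff)

lemma computable_mult: "computable r F \<Longrightarrow> computable r G \<Longrightarrow> computable r (\<lambda>n f e. F n f e * G n f e)"
  by (rule computable_arith[of IMul]) (simp_all add: int_size_mult)

lemma computable_div: "computable r F \<Longrightarrow> computable r G \<Longrightarrow> computable r (\<lambda>n f e. F n f e div G n f e)"
  by (rule computable_arith[of IDiv]) (simp_all add: int_size_div)

lemma computable_mod: "computable r F \<Longrightarrow> computable r G \<Longrightarrow> computable r (\<lambda>n f e. F n f e mod G n f e)"
  by (rule computable_arith[of IMod]) (simp_all add: int_size_mod)

lemma computable_less:
  assumes FG: "computable r F" "computable r G"
  shows "computable r (\<lambda>n f e. of_bool (F n f e < G n f e))"
proof (rule computable_binary[OF FG, where g = "\<lambda>x y. of_bool (x < y)" and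
      c = "\<lambda>h. Cond (Less (cell h) (cell (Suc h))) (Put ''m'' (Const (int h)) (Const 1)) (Put ''m'' (Const (int h)) (Const 0))"])
  fix x y :: int show "int_size (of_bool (x < y)) \<le> int_size x + int_size y"
    using int_size_pos[of x] int_size_pos[of y] by (cases "x < y") (simp_all add: int_size_0 int_size_1)
next
  fix h
  let ?b = "Less (cell h) (cell (Suc h))"
  let ?c = "Cond ?b (Put ''m'' (Const (int h)) (Const 1)) (Put ''m'' (Const (int h)) (Const 0))"
  let ?I = "int_size (int h)" and ?J = "int_size (int (Suc h))"
  define K where "K = 9 + 4 * ?I + 4 * ?J"
  show "\<exists>K. \<forall>n f s. \<exists>t s'. exec n f ?c s t s' \<and>
       t \<le> K * (1 + int_size (s ''m'' (int h)) + int_size (s ''m'' (int (Suc h)))) \<and>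
       s' ''m'' (int h) = of_bool (s ''m'' (int h) < s ''m'' (int (Suc h))) \<and> preserves h s s'"
  proof (rule exI[of _ K], intro allI)
    fix n f and s :: memory
    let ?x = "s ''m'' (int h)" and ?y = "s ''m'' (int (Suc h))"
    define v :: int where "v = of_bool (?x < ?y)"
    let ?t = "1 + bcost ?b s + (1 + 2 * ?I + 2 * int_size v)"
    have v: "int_size v \<le> 2" by (simp add: v_def int_size_0 int_size_1)
    have P: "exec n f (Put ''m'' (Const (int h)) (Const v)) s (1 + 2 * ?I + 2 * int_size v) (put s ''m'' (int h) v)"
      by (rule exec_Put') auto
    have ex: "exec n f ?c s ?t (put s ''m'' (int h) v)"
    proof (cases "?x < ?y")
      case True
      then have "v = 1" "bval ?b s" by (simp_all add: v_def)
      then show ?thesis using exec.CondTrue[OF \<open>bval ?b s\<close> P[unfolded \<open>v = 1\<close>]] by (simp only:)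
    next
      case False
      then have "v = 0" "\<not> bval ?b s" by (simp_all add: v_def)
      then show ?thesis using exec.CondFalse[OF \<open>\<not> bval ?b s\<close> P[unfolded \<open>v = 0\<close>]] by (simp only:)
    qed
    have "?t \<le> K + 2 * (int_size ?x + int_size ?y)"
      using v by (simp add: K_def)
    also have "\<dots> \<le> K * (1 + int_size ?x + int_size ?y)"
      by (simp add: K_def algebra_simps)
    finally show "\<exists>t s'. exec n f ?c s t s' \<and>
       t \<le> K * (1 + int_size (s ''m'' (int h)) + int_size (s ''m'' (int (Suc h)))) \<and>
       s' ''m'' (int h) = of_bool (s ''m'' (int h) < s ''m'' (int (Suc h))) \<and> preserves h s s'"
      using ex by (intro exI[of _ ?t] exI[of _ "put s ''m'' (int h) v"]) (simp add: preserves_put_m v_def)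
  qed
qed

section \<open>Loops, bounded sums and bounded products\<close>

lemma exec_counting_loop:
  assumes step: "\<And>i s. I i s \<Longrightarrow> i < N \<Longrightarrow> bval b s \<and> bcost b s \<le> T \<and> (\<exists>t s'. exec n f c s t s' \<and> t \<le> T \<and> I (Suc i) s')"
    and final: "\<And>s. I N s \<Longrightarrow> \<not> bval b s \<and> bcost b s \<le> T"
    and init: "I 0 s"
  shows "\<exists>t s'. exec n f (While b c) s t s' \<and> t \<le> (N + 1) * (2 * T + 1) \<and> I N s'"
proof -
  have "I i s \<Longrightarrow> i \<le> N \<Longrightarrow> \<exists>t s'. exec n f (While b c) s t s' \<and> t \<le> (N - i + 1) * (2 * T + 1) \<and> I N s'" for i s
  proof (induction "N - i" arbitrary: i s)
    case 0
    then have "exec n f (While b c) s (1 + bcost b s) s" using final exec.WhileFalse by simp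
    with 0 final[of s] show ?case by (intro exI[of _ "1 + bcost b s"] exI[of _ s]) auto
  next
    case (Suc m)
    then have i: "i < N" by simp
    from step[OF Suc.prems(1) i] obtain t s1 where s1: "bval b s" "bcost b s \<le> T" "exec n f c s t s1" "t \<le> T" "I (Suc i) s1"
      by auto
    from Suc.hyps(1)[OF _ s1(5)] Suc.hyps(2) i obtain t' s2 where s2: "exec n f (While b c) s1 t' s2"
      "t' \<le> (N - Suc i + 1) * (2 * T + 1)" "I N s2" by (metis Suc_leI diff_Suc_1 diff_Suc_Suc Suc_diff_Suc)
    have "N - i + 1 = Suc (N - Suc i + 1)" using i by simp
    \<comment> \<open>A round costs 1 for the loop itself and at most T each for test and body; the
      factor N + 1 also covers the final failing test.\<close>
    then have "1 + bcost b s + t + t' \<le> (N - i + 1) * (2 * T + 1)"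
      using s1 s2 by simp
    then show ?case using exec.WhileTrue[OF s1(1) s1(3) s2(1)] s2(3) by blast
  qed
  from this[of 0 s] init show ?thesis by simp
qed

text \<open>Cell h holds the limit, h + 1 the accumulator, h + 2 the counter, and the body runs at
  height h + 3. By subadditivity each round lengthens the accumulator by at most the length of the
  body value; as the limit is polynomially bounded, the length stays polynomial even where the value
  becomes exponential.\<close>

lemma computable_fold:
  assumes N: "computable r N" "poly_bounded r N"
    and B: "computable r (\<lambda>n f e. B n f (\<lambda>i. e (Suc i)) (e 0))"
    and op: "\<And>a b s. aval (op a b) s = g (aval a s) (aval b s)"
      "\<And>a b s. acost (op a b) s = acost a s + acost b s + int_size (aval a s) + int_size (aval b s)"
    and g: "\<And>x y. int_size (g x y) \<le> int_size x + int_size y"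
    and A: "\<And>n f e. A n f e 0 = z" "\<And>n f e i. A n f e (Suc i) = g (A n f e i) (B n f e (int i))"
  shows "computable r (\<lambda>n f e. A n f e (nat (N n f e)))"
proof (rule computableI)
  fix \<sigma> :: "nat \<Rightarrow> nat" and h and b :: "nat poly" assume \<sigma>: "\<And>i. \<sigma> i < h"
  define h1 where "h1 = h + 1"
  define h2 where "h2 = h + 2"
  define h3 where "h3 = h + 3"
  have hs [simp]: "h < h1" "h < h2" "h < h3" "h1 < h2" "h1 < h3" "h2 < h3" "h \<le> h1" "h \<le> h2" "h \<le> h3" "h1 \<noteq> h" "h2 \<noteq> h" "h3 \<noteq> h" "h \<noteq> h1" "h \<noteq> h2" "h \<noteq> h3" "h1 \<noteq> h2" "h1 \<noteq> h3" "h2 \<noteq> h1" "h2 \<noteq> h3" "h3 \<noteq> h1" "h3 \<noteq> h2"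
    by (simp_all add: h1_def h2_def h3_def)
  obtain c1 q1 where 1: "\<And>n f s. s ''n'' 0 = int n \<Longrightarrow> admissible r b n f (\<lambda>i. s ''m'' (int (\<sigma> i))) \<Longrightarrow>
      computes_within n f c1 s h (poly q1 n) (N n f (\<lambda>i. s ''m'' (int (\<sigma> i))))"
    using computableE[OF N(1), of \<sigma> h b] \<sigma> by auto
  obtain qN where qN: "\<And>n f e. admissible r b n f e \<Longrightarrow> \<bar>N n f e\<bar> \<le> int (poly qN n)"
    using N(2) unfolding poly_bounded_def by blast
  define \<sigma>' where "\<sigma>' = case_nat h2 \<sigma>"
  have \<sigma>': "\<And>i. \<sigma>' i < h3" using less_trans[OF \<sigma> hs(3)] by (simp add: \<sigma>'_def split: nat.split)
  \<comment> \<open>The counter joins the environment as variable 0, so the bound on the environment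
    has to cover the loop limit.\<close>
  define b' where "b' = b + qN"
  obtain c2 q2 where 2: "\<And>n f s. s ''n'' 0 = int n \<Longrightarrow> admissible r b' n f (\<lambda>i. s ''m'' (int (\<sigma>' i))) \<Longrightarrow>
      computes_within n f c2 s h3 (poly q2 n) (B n f (\<lambda>i. s ''m'' (int (\<sigma>' (Suc i)))) (s ''m'' (int (\<sigma>' 0))))"
    using computableE[OF B, of \<sigma>' h3 b'] \<sigma>' by auto
  let ?test = "Less (cell h2) (cell h)"
  let ?acc = "Put ''m'' (Const (int h1)) (op (cell h1) (cell h3))"
  let ?inc = "Put ''m'' (Const (int h2)) (IAdd (Const 1) (cell h2))"
  let ?body = "Seq c2 (Seq ?acc ?inc)"
  let ?i1 = "Put ''m'' (Const (int h1)) (Const z)"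
  let ?i2 = "Put ''m'' (Const (int h2)) (Const 0)"
  let ?out = "Put ''m'' (Const (int h)) (cell h1)"
  let ?c = "Seq c1 (Seq ?i1 (Seq ?i2 (Seq (While ?test ?body) ?out)))"
  let ?H = "int_size (int h) + int_size (int h1) + int_size (int h2) + int_size (int h3) + int_size z + 20"
  define qA where "qA = [:int_size z:] + qN * q2"
  define T where "T = [:20 * ?H:] + smult 10 (q2 + qA + qN)"
  let ?q = "[:10 * ?H:] + smult 10 qA + q1 + (qN + 1) * (smult 2 T + 1)"
  show "\<exists>c q. \<forall>n f s. s ''n'' 0 = int n \<longrightarrow> admissible r b n f (\<lambda>i. s ''m'' (int (\<sigma> i))) \<longrightarrow>
      computes_within n f c s h (poly q n)
       (A n f (\<lambda>i. s ''m'' (int (\<sigma> i))) (nat (N n f (\<lambda>i. s ''m'' (int (\<sigma> i))))))"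
  proof (rule exI[of _ ?c], rule exI[of _ ?q], intro allI impI)
    fix n f and s :: memory
    assume n: "s ''n'' 0 = int n" and a: "admissible r b n f (\<lambda>i. s ''m'' (int (\<sigma> i)))"
    define e where "e = (\<lambda>i. s ''m'' (int (\<sigma> i)))"
    define M where "M = nat (N n f e)"
    have M: "M \<le> poly qN n" using qN[OF a] by (simp add: M_def e_def nat_le_iff abs_le_iff)
    obtain t1 s1 where s1: "exec n f c1 s t1 s1" "t1 \<le> poly q1 n" "s1 ''m'' (int h) = N n f e" "preserves h s s1"
      using 1[of s n f] n a unfolding computes_within_def e_def by blast
    define s2 where "s2 = put s1 ''m'' (int h1) z"
    define s3 where "s3 = put s2 ''m'' (int h2) 0"
    define I where "I i s' \<longleftrightarrow> preserves h s s' \<and> s' ''m'' (int h) = N n f e \<and>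
      s' ''m'' (int h1) = A n f e i \<and> s' ''m'' (int h2) = int i" for i s'
    have I0: "I 0 s3"
    proof -
      have "preserves h s2 s3" "preserves h s1 s2" unfolding s2_def s3_def
        by (intro preserves_put_m; simp)+
      then have "preserves h s s3" using s1(4) by (meson order_refl preserves_trans)
      then show ?thesis using s1(3) by (simp add: I_def s2_def s3_def A)
    qed
    have body: "int_size (B n f e (int i)) \<le> poly q2 n \<and>
        (\<exists>t s''. exec n f c2 s' t s'' \<and> t \<le> poly q2 n \<and> s'' ''m'' (int h3) = B n f e (int i) \<and>
        preserves h3 s' s'')" if I: "I i s'" and i: "i < M" for i s'
    proof -
      have pr: "preserves h s s'" using I by (simp add: I_def)
      have \<sigma>0: "s' ''m'' (int (\<sigma>' 0)) = int i" using I by (simp add: I_def \<sigma>'_def)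
      have \<sigma>S: "s' ''m'' (int (\<sigma>' (Suc j))) = e j" for j
        using preservesD(1)[OF pr \<sigma>] by (simp add: \<sigma>'_def e_def)
      have "admissible r b' n f (\<lambda>j. s' ''m'' (int (\<sigma>' j)))"
        unfolding admissible_def
      proof (rule conjI[OF _ allI])
        show "\<forall>A\<subseteq>{1..n}. \<bar>f A\<bar> \<le> r" using a by (simp add: admissible_def)
        fix j show "\<bar>s' ''m'' (int (\<sigma>' j))\<bar> \<le> int (poly b' n)"
        proof (cases j)
          case 0 then show ?thesis using \<sigma>0 i M by (simp add: b'_def)
        next
          case (Suc k)
          have "\<bar>e k\<bar> \<le> int (poly b n)" using a by (simp add: admissible_def e_def)
          then show ?thesis using \<sigma>S[of k] Suc by (simp add: b'_def)
        qed
      qed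
      moreover have "s' ''n'' 0 = int n" using preservesD(2)[OF pr] n by simp
      ultimately show ?thesis using 2[of s' n f] unfolding computes_within_def \<sigma>0 \<sigma>S by blast
    qed
    have As: "int_size (A n f e i) \<le> int_size z + i * poly q2 n" if "i \<le> M" "\<And>i. i < M \<Longrightarrow> \<exists>s'. I i s'" for i
      using that
    proof (induction i)
      case (Suc i)
      then obtain s' where "I i s'" by (meson Suc_le_lessD)
      then have "int_size (B n f e (int i)) \<le> poly q2 n" using body Suc.prems(1) by simp
      then show ?case using Suc g[of "A n f e i" "B n f e (int i)"] by (simp add: A)
    qed (simp add: A)
    \<comment> \<open>\<open>body\<close> bounds the size of a body value only through a state
      satisfying the invariant, so for every i such a state is exhibited by writing the cells
      directly.\<close>
    have Iex: "\<exists>s'. I i s'" for i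
    proof
      show "I i (put (put s3 ''m'' (int h1) (A n f e i)) ''m'' (int h2) (int i))"
        (is "I i (put ?s4 _ _ _)")
      proof -
        have "preserves h s3 ?s4" "preserves h ?s4 (put ?s4 ''m'' (int h2) (int i))"
          by (intro preserves_put_m; simp)+
        then have "preserves h s (put ?s4 ''m'' (int h2) (int i))"
          using I0 by (meson I_def order_refl preserves_trans)
        then show ?thesis using I0 by (simp add: I_def)
      qed
    qed
    have qA: "int_size (A n f e i) \<le> poly qA n" if "i \<le> M" for i
    proof -
      have "i * poly q2 n \<le> poly qN n * poly q2 n" using that M by (intro mult_le_mono1) simp
      moreover have "poly qA n = int_size z + poly qN n * poly q2 n" by (simp add: qA_def)
      ultimately show ?thesis using As[OF that Iex] by linarith
    qed
    have Ni: "int_size (int i) \<le> Suc (poly qN n)" if "i \<le> M" for i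
      using that M by (intro int_size_le_nat) simp
    have NN: "int_size (N n f e) \<le> Suc (poly qN n)"
      by (rule int_size_le_nat) (use qN[OF a] in \<open>simp add: e_def\<close>)
    have tc: "bcost ?test s' \<le> poly T n" if "I i s'" "i \<le> M" for i s'
      using that NN Ni[of i] by (simp add: I_def T_def)
    have "\<exists>t s'. exec n f (While ?test ?body) s3 t s' \<and> t \<le> (M + 1) * (2 * poly T n + 1) \<and> I M s'"
    proof (rule exec_counting_loop[where I = I, OF _ _ I0])
      fix s' assume I: "I M s'"
      then show "\<not> bval ?test s' \<and> bcost ?test s' \<le> poly T n"
        using tc[OF I] by (simp add: I_def M_def)
    next
      fix i s' assume I: "I i s'" and i: "i < M"
      obtain t s'' where s'': "exec n f c2 s' t s''" "t \<le> poly q2 n" "s'' ''m'' (int h3) = B n f e (int i)"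
        "preserves h3 s' s''" and Bs: "int_size (B n f e (int i)) \<le> poly q2 n"
        using body[OF I i] by blast
      have k: "s'' ''m'' (int h) = N n f e" "s'' ''m'' (int h1) = A n f e i" "s'' ''m'' (int h2) = int i"
        using I preservesD(1)[OF s''(4), of h] preservesD(1)[OF s''(4), of h1] preservesD(1)[OF s''(4), of h2]
        by (simp_all add: I_def)
      define u where "u = put s'' ''m'' (int h1) (A n f e (Suc i))"
      define v where "v = put u ''m'' (int h2) (int (Suc i))"
      have "1 + acost (Const (int h1)) s'' + acost (op (cell h1) (cell h3)) s'' + int_size (int h1) + int_size (A n f e (Suc i))
         \<le> 1 + 2 * int_size (int h1) + 4 * int_size (int h1) + 4 * int_size (int h3) + 3 * int_size (A n f e i) + 3 * int_size (B n f e (int i))"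
        using g[of "A n f e i" "B n f e (int i)"] by (simp add: op A k s''(3))
      then obtain t1 where e1: "exec n f ?acc s'' t1 u" "t1 \<le> 6 * ?H + 3 * poly qA n + 3 * poly q2 n"
        using qA[of i] Bs i exec_Put'[OF refl, of s'' "''m''" "Const (int h1)" "op (cell h1) (cell h3)" u n f]
        by (simp add: op A k s''(3) u_def)
      have u: "u ''m'' (int h2) = int i" using k by (simp add: u_def)
      have "int_size (1 + int i) \<le> Suc (poly qN n)" using Ni[of "Suc i"] i by simp
      then obtain t2 where e2: "exec n f ?inc u t2 v" "t2 \<le> 6 * ?H + 4 * poly qN n"
        using Ni[of i] i exec_Put'[OF refl, of u "''m''" "Const (int h2)" "IAdd (Const 1) (cell h2)" v n f]
        by (simp add: u v_def int_size_1)
      have "exec n f ?body s' (t + (t1 + t2)) v" using s''(1) e1(1) e2(1) by (blast intro: exec.Seq)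
      moreover have "t + (t1 + t2) \<le> poly T n" using s''(2) e1(2) e2(2) by (simp add: T_def)
      moreover have "I (Suc i) v"
      proof -
        have "preserves h s'' u" "preserves h u v" unfolding u_def v_def by (intro preserves_put_m; simp)+
        then have "preserves h s v" using I s''(4) unfolding I_def
          by (meson hs(9) order_refl preserves_mono preserves_trans)
        then show ?thesis using k by (simp add: I_def u_def v_def)
      qed
      moreover have "bval ?test s'" using I i by (simp add: I_def M_def)
      ultimately show "bval ?test s' \<and> bcost ?test s' \<le> poly T n \<and> (\<exists>t s''. exec n f ?body s' t s'' \<and> t \<le> poly T n \<and> I (Suc i) s'')"
        using tc[OF I] i by fastforce
    qed
    then obtain t4 s4 where s4: "exec n f (While ?test ?body) s3 t4 s4" "t4 \<le> (M + 1) * (2 * poly T n + 1)" "I M s4"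
      by blast
    define s5 where "s5 = put s4 ''m'' (int h) (A n f e M)"
    have e1: "exec n f ?i1 s1 (1 + 2 * int_size (int h1) + 2 * int_size z) s2"
      by (rule exec_Put') (simp_all add: s2_def)
    have e2: "exec n f ?i2 s2 (3 + 2 * int_size (int h2)) s3"
      by (rule exec_Put') (simp_all add: s3_def int_size_0)
    have s4h: "s4 ''m'' (int h1) = A n f e M" using s4(3) by (simp add: I_def)
    have e5: "exec n f ?out s4 (1 + 2 * int_size (int h) + 2 * int_size (int h1) + 2 * int_size (A n f e M)) s5"
      by (rule exec_Put') (simp_all add: s5_def s4h)
    have "(M + 1) * (2 * poly T n + 1) \<le> (poly qN n + 1) * (2 * poly T n + 1)"
      using M by (intro mult_le_mono1) simp
    moreover define X where "X = (poly qN n + 1) * (2 * poly T n + 1)"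
    ultimately have t4: "t4 \<le> X" using s4(2) by (metis le_trans)
    have p: "poly ?q n = 10 * ?H + 10 * poly qA n + poly q1 n + X"
      by (simp add: X_def)
    show "computes_within n f ?c s h (poly ?q n)
       (A n f (\<lambda>i. s ''m'' (int (\<sigma> i))) (nat (N n f (\<lambda>i. s ''m'' (int (\<sigma> i))))))"
      unfolding e_def[symmetric] M_def[symmetric]
    proof (rule computes_withinI)
      show "int_size (A n f e M) \<le> poly ?q n" using qA[OF order_refl] unfolding p by simp
      show "exec n f ?c s (t1 + ((1 + 2 * int_size (int h1) + 2 * int_size z) + ((3 + 2 * int_size (int h2)) +
        (t4 + (1 + 2 * int_size (int h) + 2 * int_size (int h1) + 2 * int_size (A n f e M)))))) s5"
        using s1(1) e1 e2 s4(1) e5 by (blast intro: exec.Seq)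
      show "(t1 + ((1 + 2 * int_size (int h1) + 2 * int_size z) + ((3 + 2 * int_size (int h2)) +
        (t4 + (1 + 2 * int_size (int h) + 2 * int_size (int h1) + 2 * int_size (A n f e M)))))) \<le> poly ?q n"
        using s1(2) t4 qA[OF order_refl] unfolding p by simp
      show "s5 ''m'' (int h) = A n f e M" by (simp add: s5_def)
      have "preserves h s4 s5" unfolding s5_def by (intro preserves_put_m; simp)
      then show "preserves h s s5" using s4(3) unfolding I_def by (meson order_refl preserves_trans)
    qed
  qed
qed

lemma sum_int_lessThan: "(\<Sum>x\<in>{0..<N}. g x) = (\<Sum>i<nat N. g (int i))"
  by (rule sum.reindex_bij_witness[of _ int nat]) auto

lemma prod_int_lessThan: "(\<Prod>x\<in>{0..<N}. g x) = (\<Prod>i<nat N. g (int i))"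
  by (rule prod.reindex_bij_witness[of _ int nat]) auto

lemma computable_sum:
  assumes "computable r N" "poly_bounded r N" "computable r (\<lambda>n f e. B n f (\<lambda>i. e (Suc i)) (e 0))"
  shows "computable r (\<lambda>n f e. \<Sum>x\<in>{0..<N n f e}. B n f e x)"
  unfolding sum_int_lessThan
  by (rule computable_fold[OF assms, where op = IAdd and g = "(+)" and z = 0]) (simp_all add: int_size_add)

lemma computable_prod:
  assumes "computable r N" "poly_bounded r N" "computable r (\<lambda>n f e. B n f (\<lambda>i. e (Suc i)) (e 0))"
  shows "computable r (\<lambda>n f e. \<Prod>x\<in>{0..<N n f e}. B n f e x)"
  unfolding prod_int_lessThan
  by (rule computable_fold[OF assms, where op = IMul and g = "(*)" and z = 1]) (simp_all add: int_size_mult mult.commute)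

text \<open>A loop with its counter in cell h + 1 evaluates the test at height h + 2 and stores the
  value in the array of height h. The array need not be cleared: the query reads exactly the cells 1
  to n, all of which are overwritten.\<close>

lemma computable_oracle:
  assumes B: "computable r (\<lambda>n f e. B n f (\<lambda>i. e (Suc i)) (e 0))"
  shows "computable r (\<lambda>n f e. f {i \<in> {1..n}. B n f e (int i) \<noteq> 0})"
proof (rule computableI)
  fix \<sigma> :: "nat \<Rightarrow> nat" and h and b :: "nat poly" assume \<sigma>: "\<And>i. \<sigma> i < h"
  define h1 where "h1 = h + 1"
  define h2 where "h2 = h + 2"
  have hs [simp]: "h < h1" "h < h2" "h1 < h2" "h \<le> h1" "h \<le> h2" "h1 \<noteq> h" "h2 \<noteq> h" "h \<noteq> h1" "h \<noteq> h2" "h1 \<noteq> h2" "h2 \<noteq> h1"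
    by (simp_all add: h1_def h2_def)
  define \<sigma>' where "\<sigma>' = case_nat h1 \<sigma>"
  have \<sigma>': "\<And>i. \<sigma>' i < h2" using less_trans[OF \<sigma> hs(2)] by (simp add: \<sigma>'_def split: nat.split)
  define b' where "b' = b + [:0, 1:]"
  obtain c2 q2 where 2: "\<And>n f s. s ''n'' 0 = int n \<Longrightarrow> admissible r b' n f (\<lambda>i. s ''m'' (int (\<sigma>' i))) \<Longrightarrow>
      computes_within n f c2 s h2 (poly q2 n) (B n f (\<lambda>i. s ''m'' (int (\<sigma>' (Suc i)))) (s ''m'' (int (\<sigma>' 0))))"
    using computableE[OF B, of \<sigma>' h2 b'] \<sigma>' by auto
  let ?Q = "query_array h"
  let ?test = "Less (cell h1) (IAdd (Const 1) (Get ''n'' (Const 0)))"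
  let ?sto = "Put ?Q (cell h1) (cell h2)"
  let ?inc = "Put ''m'' (Const (int h1)) (IAdd (Const 1) (cell h1))"
  let ?body = "Seq c2 (Seq ?sto ?inc)"
  let ?i1 = "Put ''m'' (Const (int h1)) (Const 1)"
  let ?qry = "Query ''y'' ?Q"
  let ?out = "Put ''m'' (Const (int h)) (Get ''y'' (Const 0))"
  let ?c = "Seq ?i1 (Seq (While ?test ?body) (Seq ?qry ?out))"
  let ?H = "int_size (int h) + int_size (int h1) + int_size (int h2) + nat \<bar>r\<bar> + 20"
  define T where "T = [:20 * ?H:] + smult 10 (q2 + [:0, 1:])"
  define R where "R = [:0, 1:] * ([:2, 1:] + q2)"
  let ?q = "[:10 * ?H:] + R + [:1, 1:] * (smult 2 T + 1)"
  show "\<exists>c q. \<forall>n f s. s ''n'' 0 = int n \<longrightarrow> admissible r b n f (\<lambda>i. s ''m'' (int (\<sigma> i))) \<longrightarrow>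
      computes_within n f c s h (poly q n) (f {i \<in> {1..n}. B n f (\<lambda>i. s ''m'' (int (\<sigma> i))) (int i) \<noteq> 0})"
  proof (rule exI[of _ ?c], rule exI[of _ ?q], intro allI impI)
    fix n f and s :: memory
    assume n: "s ''n'' 0 = int n" and a: "admissible r b n f (\<lambda>i. s ''m'' (int (\<sigma> i)))"
    define e where "e = (\<lambda>i. s ''m'' (int (\<sigma> i)))"
    define S where "S = {i \<in> {1..n}. B n f e (int i) \<noteq> 0}"
    have fS: "int_size (f S) \<le> Suc (nat \<bar>r\<bar>)"
    proof (rule int_size_le_nat)
      have "S \<subseteq> {1..n}" by (auto simp: S_def)
      then have "\<bar>f S\<bar> \<le> r" using a unfolding admissible_def by blast
      then show "\<bar>f S\<bar> \<le> int (nat \<bar>r\<bar>)" by linarith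
    qed
    define s3 where "s3 = put s ''m'' (int h1) 1"
    \<comment> \<open>The sizes of the stored values are recorded because the query is charged for
      reading them. The counter is one ahead of i, since the elements are numbered from 1.\<close>
    define I where "I i s' \<longleftrightarrow> preserves h s s' \<and> s' ''m'' (int h1) = int (Suc i) \<and>
      (\<forall>j\<in>{1..i}. s' ?Q (int j) = B n f e (int j) \<and> int_size (B n f e (int j)) \<le> poly q2 n)" for i s'
    have I0: "I 0 s3" by (auto simp: I_def s3_def intro!: preserves_put_m)
    have In: "s' ''n'' 0 = int n" if "I i s'" for i s'
      using that preservesD(2)[of h s s'] n by (simp add: I_def)
    have Ni: "int_size (int i) \<le> n + 2" if "i \<le> Suc n" for i
      using that int_size_le_nat[of "int i" "Suc n"] by simp
    have tc: "bcost ?test s' \<le> poly T n" if "I i s'" "i \<le> n" for i s'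
      using that Ni[of "Suc i"] Ni[of n] Ni[of "Suc n"] In[OF that(1)] by (simp add: I_def T_def int_size_0 int_size_1 algebra_simps)
    have "\<exists>t s'. exec n f (While ?test ?body) s3 t s' \<and> t \<le> (n + 1) * (2 * poly T n + 1) \<and> I n s'"
    proof (rule exec_counting_loop[where I = I, OF _ _ I0])
      fix s' assume I: "I n s'"
      then show "\<not> bval ?test s' \<and> bcost ?test s' \<le> poly T n"
        using tc[OF I] In[OF I] by (simp add: I_def)
    next
      fix i s' assume I: "I i s'" and i: "i < n"
      have pr: "preserves h s s'" using I by (simp add: I_def)
      have \<sigma>0: "s' ''m'' (int (\<sigma>' 0)) = int (Suc i)" using I by (simp add: I_def \<sigma>'_def)
      have \<sigma>S: "s' ''m'' (int (\<sigma>' (Suc j))) = e j" for j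
        using preservesD(1)[OF pr \<sigma>] by (simp add: \<sigma>'_def e_def)
      have "admissible r b' n f (\<lambda>j. s' ''m'' (int (\<sigma>' j)))"
        unfolding admissible_def
      proof (rule conjI[OF _ allI])
        show "\<forall>A\<subseteq>{1..n}. \<bar>f A\<bar> \<le> r" using a by (simp add: admissible_def)
        fix j show "\<bar>s' ''m'' (int (\<sigma>' j))\<bar> \<le> int (poly b' n)"
        proof (cases j)
          case 0 then show ?thesis using \<sigma>0 i by (simp add: b'_def)
        next
          case (Suc k)
          have "\<bar>e k\<bar> \<le> int (poly b n)" using a by (simp add: admissible_def e_def)
          then show ?thesis using \<sigma>S[of k] Suc by (simp add: b'_def)
        qed
      qed
      then have "int_size (B n f e (int (Suc i))) \<le> poly q2 n \<and>
        (\<exists>t s''. exec n f c2 s' t s'' \<and> t \<le> poly q2 n \<and> s'' ''m'' (int h2) = B n f e (int (Suc i)) \<and>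
        preserves h2 s' s'')" using 2[of s' n f, OF In[OF I]] unfolding computes_within_def \<sigma>0 \<sigma>S by blast
      then obtain t s'' where s'': "exec n f c2 s' t s''" "t \<le> poly q2 n" "s'' ''m'' (int h2) = B n f e (int (Suc i))"
        "preserves h2 s' s''" and Bs: "int_size (B n f e (int (Suc i))) \<le> poly q2 n"
        by blast
      have k: "s'' ''m'' (int h1) = int (Suc i)" "s'' ?Q = s' ?Q"
        using I preservesD(1)[OF s''(4), of h1] preservesD(3)[OF s''(4), of h] by (simp_all add: I_def)
      define u where "u = put s'' ?Q (int (Suc i)) (B n f e (int (Suc i)))"
      define v where "v = put u ''m'' (int h1) (int (Suc (Suc i)))"
      have sz: "int_size (1 + int i) \<le> n + 2" "int_size (2 + int i) \<le> n + 2" using Ni[of "Suc i"] Ni[of "Suc (Suc i)"] i by simp_all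
      obtain t1 where e1: "exec n f ?sto s'' t1 u" "t1 \<le> 6 * ?H + 2 * poly q2 n + 2 * n"
        using Bs sz exec_Put'[OF refl, of s'' ?Q "cell h1" "cell h2" u n f]
        by (simp add: k s''(3) u_def)
      have u: "u ''m'' (int h1) = 1 + int i" using k by (simp_all add: u_def)
      obtain t2 where e2: "exec n f ?inc u t2 v" "t2 \<le> 6 * ?H + 4 * n"
        using sz exec_Put'[OF refl, of u "''m''" "Const (int h1)" "IAdd (Const 1) (cell h1)" v n f]
        by (simp add: u v_def int_size_1 algebra_simps)
      have "exec n f ?body s' (t + (t1 + t2)) v" using s''(1) e1(1) e2(1) by (blast intro: exec.Seq)
      moreover have "t + (t1 + t2) \<le> poly T n" using s''(2) e1(2) e2(2) by (simp add: T_def)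
      moreover have "I (Suc i) v"
      proof -
        have "preserves h s'' u" "preserves h u v" unfolding u_def v_def
          by (intro preserves_put_m preserves_put_query; simp)+
        then have "preserves h s v" using pr s''(4)
          by (meson hs(5) order_refl preserves_mono preserves_trans)
        moreover have "v ?Q (int j) = B n f e (int j) \<and> int_size (B n f e (int j)) \<le> poly q2 n" if j: "j \<in> {1..Suc i}" for j
        proof (cases "j = Suc i")
          case True then show ?thesis using Bs by (simp add: v_def u_def)
        next
          case False
          then have "v ?Q (int j) = s' ?Q (int j)" using k(2) by (simp add: v_def u_def)
          then show ?thesis using I j False by (auto simp: I_def)
        qed
        ultimately show ?thesis by (simp add: I_def v_def)
      qed
      moreover have "bval ?test s'" using I i In[OF I] by (simp add: I_def)
      ultimately show "bval ?test s' \<and> bcost ?test s' \<le> poly T n \<and> (\<exists>t s''. exec n f ?body s' t s'' \<and> t \<le> poly T n \<and> I (Suc i) s'')"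
        using tc[OF I] i by fastforce
    qed
    then obtain t4 s4 where s4: "exec n f (While ?test ?body) s3 t4 s4" "t4 \<le> (n + 1) * (2 * poly T n + 1)" "I n s4"
      by blast
    have Q4: "s4 ?Q (int j) = B n f e (int j)" "int_size (B n f e (int j)) \<le> poly q2 n" if "j \<in> {1..n}" for j
      using s4(3) that by (auto simp: I_def)
    have qs: "query_set n s4 ?Q = S" unfolding query_set_def S_def using Q4(1) by auto
    define s5 where "s5 = put s4 ''y'' 0 (f S)"
    define s6 where "s6 = put s5 ''m'' (int h) (f S)"
    have e1: "exec n f ?i1 s (5 + 2 * int_size (int h1)) s3"
      by (rule exec_Put') (simp_all add: s3_def int_size_1)
    have e5: "exec n f ?qry s4 (query_cost n f s4 ?Q) s5"
      using exec.Query[of n f "''y''" ?Q s4] by (simp add: qs s5_def)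
    have "(\<Sum>i = 1..n. int_size (int i) + int_size (s4 ?Q (int i))) \<le> (\<Sum>i = 1..n. (n + 2) + poly q2 n)"
    proof (rule sum_mono)
      fix i assume "i \<in> {1..n}"
      then show "int_size (int i) + int_size (s4 ?Q (int i)) \<le> (n + 2) + poly q2 n"
        using Q4[of i] Ni[of i] by simp
    qed
    then have qc: "query_cost n f s4 ?Q \<le> 2 + poly R n + nat \<bar>r\<bar>"
      using fS by (simp add: query_cost_def qs R_def algebra_simps)
    have e6: "exec n f ?out s5 (3 + 2 * int_size (int h) + 2 * int_size (f S)) s6"
      by (rule exec_Put') (simp_all add: s5_def s6_def int_size_0)
    define X where "X = (n + 1) * (2 * poly T n + 1)"
    define \<rho> where "\<rho> = nat \<bar>r\<bar>"
    have p: "poly ?q n = 10 * (int_size (int h) + int_size (int h1) + int_size (int h2) + \<rho> + 20) + poly R n + X"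
      by (simp add: X_def \<rho>_def)
    note fS = fS[folded \<rho>_def] and qc = qc[folded \<rho>_def] and t4 = s4(2)[folded X_def]
    show "computes_within n f ?c s h (poly ?q n) (f {i \<in> {1..n}. B n f (\<lambda>i. s ''m'' (int (\<sigma> i))) (int i) \<noteq> 0})"
      unfolding e_def[symmetric] S_def[symmetric]
    proof (rule computes_withinI)
      show "int_size (f S) \<le> poly ?q n" using fS unfolding p by simp
      show "exec n f ?c s ((5 + 2 * int_size (int h1)) + (t4 + (query_cost n f s4 ?Q + (3 + 2 * int_size (int h) + 2 * int_size (f S))))) s6"
        using e1 s4(1) e5 e6 by (blast intro: exec.Seq)
      show "(5 + 2 * int_size (int h1)) + (t4 + (query_cost n f s4 ?Q + (3 + 2 * int_size (int h) + 2 * int_size (f S)))) \<le> poly ?q n"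
        using t4 qc fS unfolding p by simp
      show "s6 ''m'' (int h) = f S" by (simp add: s6_def)
      have "preserves h s4 s5" "preserves h s5 s6" unfolding s5_def s6_def
        by (intro preserves_put_m preserves_put_y; simp)+
      then show "preserves h s s6" using s4(3) unfolding I_def by (meson order_refl preserves_trans)
    qed
  qed
qed

section \<open>Functions with polynomially bounded values\<close>

lemma poly_boundedI:
  assumes "\<And>b. \<exists>q. \<forall>n f e. admissible r b n f e \<longrightarrow> \<bar>F n f e\<bar> \<le> int (poly q n)"
  shows "poly_bounded r F"
  using assms by (simp add: poly_bounded_def)

lemma poly_bounded_const: "poly_bounded r (\<lambda>n f e. z)"
  by (rule poly_boundedI, rule exI[of _ "[:nat \<bar>z\<bar>:]"]) simp

lemma poly_bounded_size: "poly_bounded r (\<lambda>n f e. int n)"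
  by (rule poly_boundedI, rule exI[of _ "[:0, 1:]"]) simp

lemma poly_bounded_var: "poly_bounded r (\<lambda>n f e. e i)"
  by (rule poly_boundedI, rule exI) (auto simp: admissible_def)

lemma poly_bounded_oracle:
  assumes "\<And>n f e. A n f e \<subseteq> {1..n}"
  shows "poly_bounded r (\<lambda>n f e. f (A n f e))"
proof (rule poly_boundedI)
  fix b
  have "\<bar>f (A n f e)\<bar> \<le> int (poly [:nat \<bar>r\<bar>:] n)" if "admissible r b n f e" for n f e
  proof -
    have "\<bar>f (A n f e)\<bar> \<le> r" using that assms[of n f e] unfolding admissible_def by blast
    then show ?thesis by simp linarith
  qed
  then show "\<exists>q. \<forall>n f e. admissible r b n f e \<longrightarrow> \<bar>f (A n f e)\<bar> \<le> int (poly q n)" by blast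
qed

lemma poly_bounded_binary:
  assumes F: "poly_bounded r F" and G: "poly_bounded r G"
    and q: "\<And>p q. \<exists>q'. \<forall>n x y. \<bar>x\<bar> \<le> int (poly p n) \<longrightarrow> \<bar>y\<bar> \<le> int (poly q n) \<longrightarrow> \<bar>g x y\<bar> \<le> int (poly q' n)"
  shows "poly_bounded r (\<lambda>n f e. g (F n f e) (G n f e))"
proof (rule poly_boundedI)
  fix b
  obtain qF qG where 1: "\<And>n f e. admissible r b n f e \<Longrightarrow> \<bar>F n f e\<bar> \<le> int (poly qF n)"
    and 2: "\<And>n f e. admissible r b n f e \<Longrightarrow> \<bar>G n f e\<bar> \<le> int (poly qG n)"
    using F G unfolding poly_bounded_def by blast
  obtain q' where "\<And>n x y. \<bar>x\<bar> \<le> int (poly qF n) \<Longrightarrow> \<bar>y\<bar> \<le> int (poly qG n) \<Longrightarrow> \<bar>g x y\<bar> \<le> int (poly q' n)"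
    using q[of qF qG] by blast
  with 1 2 show "\<exists>q. \<forall>n f e. admissible r b n f e \<longrightarrow> \<bar>g (F n f e) (G n f e)\<bar> \<le> int (poly q n)"
    by blast
qed

lemma poly_bounded_add: "poly_bounded r F \<Longrightarrow> poly_bounded r G \<Longrightarrow> poly_bounded r (\<lambda>n f e. F n f e + G n f e)"
  by (erule (1) poly_bounded_binary, rule_tac x = "p + q" in exI) auto

lemma poly_bounded_diff: "poly_bounded r F \<Longrightarrow> poly_bounded r G \<Longrightarrow> poly_bounded r (\<lambda>n f e. F n f e - G n f e)"
  by (erule (1) poly_bounded_binary, rule_tac x = "p + q" in exI) auto

lemma poly_bounded_mult: "poly_bounded r F \<Longrightarrow> poly_bounded r G \<Longrightarrow> poly_bounded r (\<lambda>n f e. F n f e * G n f e)"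
  by (erule (1) poly_bounded_binary, rule_tac x = "p * q" in exI) (auto simp: abs_mult intro!: mult_mono)

lemma poly_bounded_weaken: "poly_bounded r F \<Longrightarrow> poly_bounded r (\<lambda>n f e. F n f (\<lambda>i. e (\<tau> i)))"
  unfolding poly_bounded_def
proof (intro allI)
  fix b assume "\<forall>b. \<exists>q. \<forall>n f e. admissible r b n f e \<longrightarrow> \<bar>F n f e\<bar> \<le> int (poly q n)"
  then obtain q where q: "\<And>n f e. admissible r b n f e \<Longrightarrow> \<bar>F n f e\<bar> \<le> int (poly q n)" by blast
  show "\<exists>q. \<forall>n f e. admissible r b n f e \<longrightarrow> \<bar>F n f (\<lambda>i. e (\<tau> i))\<bar> \<le> int (poly q n)"
    by (rule exI[of _ q]) (auto intro!: q simp: admissible_def)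
qed

lemma poly_bounded_power: "poly_bounded r F \<Longrightarrow> poly_bounded r (\<lambda>n f e. F n f e ^ k)"
  by (induction k) (simp_all add: poly_bounded_const poly_bounded_mult)

lemma computable_power: "computable r F \<Longrightarrow> computable r (\<lambda>n f e. F n f e ^ k)"
  by (induction k) (simp_all add: computable_const computable_mult)

section \<open>Decision procedures as functions with values 0 and 1\<close>

abbreviation decidable :: "int \<Rightarrow> (nat \<Rightarrow> (nat set \<Rightarrow> int) \<Rightarrow> (nat \<Rightarrow> int) \<Rightarrow> bool) \<Rightarrow> bool"
  where "decidable r P \<equiv> computable r (\<lambda>n f e. of_bool (P n f e))"

lemma decidable_not: "decidable r P \<Longrightarrow> decidable r (\<lambda>n f e. \<not> P n f e)"
  using computable_diff[OF computable_const[of r 1], of "\<lambda>n f e. of_bool (P n f e)"] by (simp add: of_bool_not_iff)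

lemma decidable_conj: "decidable r P \<Longrightarrow> decidable r Q \<Longrightarrow> decidable r (\<lambda>n f e. P n f e \<and> Q n f e)"
  using computable_mult[of r "\<lambda>n f e. of_bool (P n f e)" "\<lambda>n f e. of_bool (Q n f e)"] by (simp add: of_bool_conj)

lemma decidable_disj: "decidable r P \<Longrightarrow> decidable r Q \<Longrightarrow> decidable r (\<lambda>n f e. P n f e \<or> Q n f e)"
  using decidable_not[OF decidable_conj[OF decidable_not decidable_not], of r P Q] by simp

lemma decidable_imp: "decidable r P \<Longrightarrow> decidable r Q \<Longrightarrow> decidable r (\<lambda>n f e. P n f e \<longrightarrow> Q n f e)"
  using decidable_disj[OF decidable_not, of r P Q] by (simp only: imp_conv_disj)

lemma decidable_le: "computable r F \<Longrightarrow> computable r G \<Longrightarrow> decidable r (\<lambda>n f e. F n f e \<le> G n f e)"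
  using decidable_not[OF computable_less, of r G F] by (simp add: not_less)

lemma decidable_eq: "computable r F \<Longrightarrow> computable r G \<Longrightarrow> decidable r (\<lambda>n f e. F n f e = G n f e)"
  using decidable_conj[OF decidable_le decidable_le, of r F G G F] by (simp only: order_eq_iff[symmetric])

lemma computable_if:
  assumes "decidable r P" "computable r F" "computable r G"
  shows "computable r (\<lambda>n f e. if P n f e then F n f e else G n f e)"
proof -
  have "(\<lambda>n f e. if P n f e then F n f e else G n f e) =
    (\<lambda>n f e. of_bool (P n f e) * F n f e + of_bool (\<not> P n f e) * G n f e)"
    by (auto simp: fun_eq_iff)
  then show ?thesis
    by (simp only:) (intro computable_add computable_mult decidable_not assms)
qed

text \<open>A bounded universal quantifier is the product of the truth values of its
  instances.\<close>

lemma decidable_ball: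
  assumes "computable r N" "poly_bounded r N" "decidable r (\<lambda>n f e. P n f (\<lambda>i. e (Suc i)) (e 0))"
  shows "decidable r (\<lambda>n f e. \<forall>x\<in>{0..<N n f e}. P n f e x)"
proof -
  have "of_bool (\<forall>x\<in>{0..<N}. Q x) = (\<Prod>x\<in>{0..<N}. of_bool (Q x) :: int)" for N :: int and Q
    by (auto simp: prod_zero_iff)
  then show ?thesis
    by (simp only:) (rule computable_prod[OF assms])
qed

lemma decidable_bex:
  assumes "computable r N" "poly_bounded r N" "decidable r (\<lambda>n f e. P n f (\<lambda>i. e (Suc i)) (e 0))"
  shows "decidable r (\<lambda>n f e. \<exists>x\<in>{0..<N n f e}. P n f e x)"
  using decidable_not[OF decidable_ball[OF assms(1,2) decidable_not[OF assms(3)]]] by simp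

lemma computable_oracle_set:
  assumes "decidable r (\<lambda>n f e. P n f (\<lambda>i. e (Suc i)) (e 0))"
  shows "computable r (\<lambda>n f e. f {i \<in> {1..n}. P n f e (int i)})"
  using computable_oracle[OF assms] by simp

text \<open>The index of the coefficient occupies cell 0 and is the only variable, so all values are
  computed at height 1. All coefficients share one denominator, which is recomputed in every
  round.\<close>

lemma exec_output_program:
  assumes num: "computable r (\<lambda>n f e. num n f (e 0))" and den: "computable r (\<lambda>n f e. den n f)"
    and deg: "computable r (\<lambda>n f e. deg n f)"
  shows "\<exists>c q. \<forall>n f. (\<forall>A\<subseteq>{1..n}. \<bar>f A\<bar> \<le> r) \<longrightarrow> (\<exists>t s. exec n f c (initial_memory n) t s \<and> t \<le> poly q n \<and>
    s ''deg'' 0 = deg n f \<and> (\<forall>i\<le>n. s ''num'' (int i) = num n f (int i) \<and> s ''den'' (int i) = den n f))"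
proof -
  \<comment> \<open>The counter ends at n + 1, and this value is still in cell 0 while the degree is
    computed.\<close>
  define b :: "nat poly" where "b = [:1, 1:]"
  obtain c1 q1 where 1: "\<And>n f s. s ''n'' 0 = int n \<Longrightarrow> admissible r b n f (\<lambda>_. s ''m'' (int 0)) \<Longrightarrow>
      computes_within n f c1 s 1 (poly q1 n) (num n f (s ''m'' (int 0)))"
    using computableE[OF num, of "\<lambda>_. 0" 1 b] by auto
  obtain c2 q2 where 2: "\<And>n f s. s ''n'' 0 = int n \<Longrightarrow> admissible r b n f (\<lambda>_. s ''m'' (int 0)) \<Longrightarrow>
      computes_within n f c2 s 1 (poly q2 n) (den n f)"
    using computableE[OF den, of "\<lambda>_. 0" 1 b] by auto
  obtain c3 q3 where 3: "\<And>n f s. s ''n'' 0 = int n \<Longrightarrow> admissible r b n f (\<lambda>_. s ''m'' (int 0)) \<Longrightarrow>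
      computes_within n f c3 s 1 (poly q3 n) (deg n f)"
    using computableE[OF deg, of "\<lambda>_. 0" 1 b] by auto
  let ?test = "Less (cell 0) (IAdd (Const 1) (Get ''n'' (Const 0)))"
  let ?num = "Put ''num'' (cell 0) (cell 1)"
  let ?den = "Put ''den'' (cell 0) (cell 1)"
  let ?inc = "Put ''m'' (Const (int 0)) (IAdd (Const 1) (cell 0))"
  let ?body = "Seq c1 (Seq ?num (Seq c2 (Seq ?den ?inc)))"
  let ?deg = "Put ''deg'' (Const 0) (cell 1)"
  let ?c = "Seq (While ?test ?body) (Seq c3 ?deg)"
  define T where "T = [:100:] + smult 20 [:0, 1:] + smult 10 (q1 + q2)"
  let ?q = "[:100:] + smult 10 q3 + [:2, 1:] * (smult 2 T + 1)"
  show ?thesis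
  proof (rule exI[of _ ?c], rule exI[of _ ?q], intro allI impI)
    fix n :: nat and f assume f: "\<forall>A\<subseteq>{1..n}. \<bar>f A\<bar> \<le> r"
    define I where "I i s \<longleftrightarrow> s ''n'' 0 = int n \<and> s ''m'' (int 0) = int i \<and>
      (\<forall>j<i. s ''num'' (int j) = num n f (int j) \<and> s ''den'' (int j) = den n f)" for i and s :: memory
    have I0: "I 0 (initial_memory n)" by (simp add: I_def initial_memory_def put_def)
    have adm: "admissible r b n f (\<lambda>_. s ''m'' (int 0))" if "s ''m'' (int 0) = int i" "i \<le> n + 1" for i and s :: memory
      using f that by (simp add: admissible_def b_def)
    have Ni: "int_size (int i) \<le> n + 2" if "i \<le> Suc n" for i
      using that int_size_le_nat[of "int i" "Suc n"] by simp
    have tc: "bcost ?test s \<le> poly T n" if "I i s" "i \<le> n + 1" for i s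
      using that Ni[of i] Ni[of n] Ni[of "Suc n"] by (simp add: I_def T_def int_size_0 int_size_1)
    have "\<exists>t s'. exec n f (While ?test ?body) (initial_memory n) t s' \<and> t \<le> (n + 1 + 1) * (2 * poly T n + 1) \<and> I (n + 1) s'"
    proof (rule exec_counting_loop[where I = I, OF _ _ I0])
      fix s assume I: "I (n + 1) s"
      then show "\<not> bval ?test s \<and> bcost ?test s \<le> poly T n"
        using tc[OF I] by (simp add: I_def)
    next
      fix i s assume I: "I i s" and i: "i < n + 1"
      have s: "s ''n'' 0 = int n" "s ''m'' (int 0) = int i" using I by (simp_all add: I_def)
      obtain t1 s1 where s1: "exec n f c1 s t1 s1" "t1 \<le> poly q1 n" "s1 ''m'' (int 1) = num n f (int i)" "preserves 1 s s1"
        "int_size (num n f (int i)) \<le> poly q1 n"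
        using 1[OF s(1) adm[of s i]] s(2) i unfolding computes_within_def s by auto
      have k1: "s1 ''m'' (int 0) = int i" "s1 ''n'' 0 = int n" using preservesD(1)[OF s1(4), of 0] preservesD(2)[OF s1(4)] s by simp_all
      define s2 where "s2 = put s1 ''num'' (int i) (num n f (int i))"
      have k2: "s2 ''m'' (int 0) = int i" "s2 ''n'' 0 = int n" using k1 by (simp_all add: s2_def)
      have sz: "int_size (int i) \<le> n + 2" "int_size (1 + int i) \<le> n + 2" using Ni[of i] Ni[of "Suc i"] i by simp_all
      obtain t2 where t2: "exec n f ?num s1 t2 s2" "t2 \<le> 20 + 2 * n + 2 * poly q1 n"
        using sz s1(5) exec_Put'[OF refl, of s1 "''num''" "cell 0" "cell 1" s2 n f] s1(3) k1
        by (simp add: s2_def int_size_0 int_size_1)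
      obtain t3 s3 where s3: "exec n f c2 s2 t3 s3" "t3 \<le> poly q2 n" "s3 ''m'' (int 1) = den n f" "preserves 1 s2 s3"
        "int_size (den n f) \<le> poly q2 n"
        using 2[OF k2(2) adm[of s2 i]] k2(1) i unfolding computes_within_def by auto
      have k3: "s3 ''m'' (int 0) = int i" "s3 ''n'' 0 = int n" using preservesD(1)[OF s3(4), of 0] preservesD(2)[OF s3(4)] k2 by simp_all
      define s4 where "s4 = put s3 ''den'' (int i) (den n f)"
      have k4: "s4 ''m'' (int 0) = int i" "s4 ''n'' 0 = int n" using k3 by (simp_all add: s4_def)
      obtain t4 where t4: "exec n f ?den s3 t4 s4" "t4 \<le> 20 + 2 * n + 2 * poly q2 n"
        using sz s3(5) exec_Put'[OF refl, of s3 "''den''" "cell 0" "cell 1" s4 n f] s3(3) k3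
        by (simp add: s4_def int_size_0 int_size_1)
      define s5 where "s5 = put s4 ''m'' (int 0) (int (Suc i))"
      obtain t5 where t5: "exec n f ?inc s4 t5 s5" "t5 \<le> 30 + 4 * n"
        using sz exec_Put'[OF refl, of s4 "''m''" "Const (int 0)" "IAdd (Const 1) (cell 0)" s5 n f] k4
        by (simp add: s5_def int_size_0 int_size_1)
      have "exec n f ?body s (t1 + (t2 + (t3 + (t4 + t5)))) s5"
        using s1(1) t2(1) s3(1) t4(1) t5(1) by (blast intro: exec.Seq)
      moreover have "t1 + (t2 + (t3 + (t4 + t5))) \<le> poly T n"
        using s1(2) t2(2) s3(2) t4(2) t5(2) by (simp add: T_def)
      moreover have "I (Suc i) s5"
      proof -
        have "s1 ''num'' = s ''num''" "s1 ''den'' = s ''den''" "s3 ''num'' = s2 ''num''" "s3 ''den'' = s2 ''den''"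
          using s1(4) s3(4) by (simp_all add: preserves_def)
        then have "s5 ''num'' (int j) = (if j = i then num n f (int i) else s ''num'' (int j))"
          "s5 ''den'' (int j) = (if j = i then den n f else s ''den'' (int j))" for j
          by (simp_all add: s5_def s4_def s2_def)
        then show ?thesis using I k4 by (simp add: I_def s5_def less_Suc_eq)
      qed
      moreover have "bval ?test s" using I i by (simp add: I_def)
      ultimately show "bval ?test s \<and> bcost ?test s \<le> poly T n \<and> (\<exists>t s''. exec n f ?body s t s'' \<and> t \<le> poly T n \<and> I (Suc i) s'')"
        using tc[OF I] i by fastforce
    qed
    then obtain t4 s4 where s4: "exec n f (While ?test ?body) (initial_memory n) t4 s4" "t4 \<le> (n + 1 + 1) * (2 * poly T n + 1)" "I (n + 1) s4"
      by blast
    define X where "X = (n + 1 + 1) * (2 * poly T n + 1)"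
    have k4: "s4 ''n'' 0 = int n" "s4 ''m'' (int 0) = int (n + 1)" using s4(3) by (simp_all add: I_def)
    obtain t5 s5 where s5: "exec n f c3 s4 t5 s5" "t5 \<le> poly q3 n" "s5 ''m'' (int 1) = deg n f" "preserves 1 s4 s5"
        "int_size (deg n f) \<le> poly q3 n"
      using 3[OF k4(1) adm[of s4 "n + 1"]] k4(2) unfolding computes_within_def by auto
    define s6 where "s6 = put s5 ''deg'' 0 (deg n f)"
    obtain t6 where t6: "exec n f ?deg s5 t6 s6" "t6 \<le> 30 + 2 * poly q3 n"
      using exec_Put'[OF refl, of s5 "''deg''" "Const 0" "cell 1" s6 n f] s5(3,5)
      by (simp add: s6_def int_size_0 int_size_1)
    have p: "poly ?q n = 100 + 10 * poly q3 n + X" by (simp add: X_def)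
    have "exec n f ?c (initial_memory n) (t4 + (t5 + t6)) s6"
      using s4(1) s5(1) t6(1) by (blast intro: exec.Seq)
    moreover have "t4 + (t5 + t6) \<le> poly ?q n"
      using s4(2)[folded X_def] s5(2) t6(2) unfolding p by simp
    moreover have "s6 ''deg'' 0 = deg n f" by (simp add: s6_def)
    moreover have "\<forall>i\<le>n. s6 ''num'' (int i) = num n f (int i) \<and> s6 ''den'' (int i) = den n f"
    proof -
      have "s6 ''num'' = s4 ''num''" "s6 ''den'' = s4 ''den''" using s5(4) by (simp_all add: s6_def preserves_def)
      then show ?thesis using s4(3) by (simp add: I_def)
    qed
    ultimately show "\<exists>t s. exec n f ?c (initial_memory n) t s \<and> t \<le> poly ?q n \<and>
      s ''deg'' 0 = deg n f \<and> (\<forall>i\<le>n. s ''num'' (int i) = num n f (int i) \<and> s ''den'' (int i) = den n f)"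
      by blast
  qed
qed

section \<open>Integrality of polymatroids\<close>

lemma finite_bounded_integer_points:
  "finite {x \<in> integer_points. (\<forall>i. i \<notin> {1..n} \<longrightarrow> x i = 0) \<and> (\<forall>i. \<bar>x i\<bar> \<le> R)}"
proof (rule finite_subset)
  let ?h = "\<lambda>y i. if i \<in> {1..n} then real_of_int (y i) else 0"
  show "{x \<in> integer_points. (\<forall>i. i \<notin> {1..n} \<longrightarrow> x i = 0) \<and> (\<forall>i. \<bar>x i\<bar> \<le> R)} \<subseteq>
    ?h ` (\<Pi>\<^sub>E i\<in>{1..n}. {\<lfloor>- R\<rfloor>..\<lceil>R\<rceil>})"
  proof
    fix x assume x: "x \<in> {x \<in> integer_points. (\<forall>i. i \<notin> {1..n} \<longrightarrow> x i = 0) \<and> (\<forall>i. \<bar>x i\<bar> \<le> R)}"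
    define y where "y = (\<lambda>i\<in>{1..n}. \<lfloor>x i\<rfloor>)"
    have fl: "of_int \<lfloor>x i\<rfloor> = x i" for i using x by (simp add: integer_points_def)
    have "y \<in> (\<Pi>\<^sub>E i\<in>{1..n}. {\<lfloor>- R\<rfloor>..\<lceil>R\<rceil>})"
    proof (rule PiE_I)
      fix i assume i: "i \<in> {1..n}"
      have "\<bar>x i\<bar> \<le> R" using x by blast
      then have "- R \<le> x i" "x i \<le> R" by linarith+
      then have "\<lfloor>- R\<rfloor> \<le> \<lfloor>x i\<rfloor>" and "\<lfloor>x i\<rfloor> \<le> \<lceil>R\<rceil>"
        using floor_mono[of "- R" "x i"] by linarith+
      then show "y i \<in> {\<lfloor>- R\<rfloor>..\<lceil>R\<rceil>}" using i by (simp add: y_def)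
    qed (auto simp: y_def)
    moreover have "x = ?h y" using x by (auto simp: y_def fl)
    ultimately show "x \<in> ?h ` (\<Pi>\<^sub>E i\<in>{1..n}. {\<lfloor>- R\<rfloor>..\<lceil>R\<rceil>})" by blast
  qed
next
  show "finite ((\<lambda>y i. if i \<in> {1..n} then real_of_int (y i) else 0) ` (\<Pi>\<^sub>E i\<in>{1..n}. {\<lfloor>- R\<rfloor>..\<lceil>R\<rceil>}))"
    by (intro finite_imageI finite_PiE) simp_all
qed

locale integer_polymatroid =
  fixes n :: nat and f :: "nat set \<Rightarrow> int"
  assumes submodular: "X \<subseteq> {1..n} \<Longrightarrow> Y \<subseteq> {1..n} \<Longrightarrow> f (X \<inter> Y) + f (X \<union> Y) \<le> f X + f Y"
    and mono: "X \<subseteq> Y \<Longrightarrow> Y \<subseteq> {1..n} \<Longrightarrow> f X \<le> f Y"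
    and empty: "f {} = 0"
begin

lemma nonneg: "A \<subseteq> {1..n} \<Longrightarrow> 0 \<le> f A"
  using mono[of "{}" A] empty by simp

text \<open>The flag selects between the whole polymatroid and the base polytope, so that
  integrality, counting and volume need one development only.\<close>

definition face :: "bool \<Rightarrow> (nat \<Rightarrow> real) set"
  where "face b = {x \<in> polymatroid n (\<lambda>A. of_int (f A)). b \<longrightarrow> sum x {1..n} = of_int (f {1..n})}"

lemma faceI:
  "(\<And>i. i \<notin> {1..n} \<Longrightarrow> x i = 0) \<Longrightarrow> (\<And>i. 0 \<le> x i) \<Longrightarrow>
    (\<And>A. A \<subseteq> {1..n} \<Longrightarrow> sum x A \<le> of_int (f A)) \<Longrightarrow>
    (b \<Longrightarrow> sum x {1..n} = of_int (f {1..n})) \<Longrightarrow> x \<in> face b"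
  by (simp add: face_def polymatroid_def)

lemma faceD:
  assumes "x \<in> face b"
  shows "i \<notin> {1..n} \<Longrightarrow> x i = 0" "0 \<le> x i" "A \<subseteq> {1..n} \<Longrightarrow> sum x A \<le> of_int (f A)"
    "b \<Longrightarrow> sum x {1..n} = of_int (f {1..n})"
  using assms by (auto simp: face_def polymatroid_def)

lemma face_le: "x \<in> face b \<Longrightarrow> i \<in> {1..n} \<Longrightarrow> x i \<le> of_int (f {1..n})"
  using faceD(3)[of x b "{i}"] mono[of "{i}" "{1..n}"] by fastforce

lemma convex_face: "convex (face b)"
proof (rule convexI)
  fix x y and u v :: real assume x: "x \<in> face b" and y: "y \<in> face b" and uv: "0 \<le> u" "0 \<le> v" "u + v = 1"
  have s: "sum (u *\<^sub>R x + v *\<^sub>R y) A = u * sum x A + v * sum y A" for A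
    by (simp add: scaleR_fun_def plus_fun_def sum.distrib sum_distrib_left)
  show "u *\<^sub>R x + v *\<^sub>R y \<in> face b"
  proof (rule faceI)
    fix A assume A: "A \<subseteq> {1..n}"
    have "u * sum x A + v * sum y A \<le> u * of_int (f A) + v * of_int (f A)"
      using uv faceD(3)[OF x A] faceD(3)[OF y A] by (intro add_mono mult_left_mono)
    then show "sum (u *\<^sub>R x + v *\<^sub>R y) A \<le> of_int (f A)"
      using uv unfolding s by (simp flip: distrib_right)
  next
    assume b
    then show "sum (u *\<^sub>R x + v *\<^sub>R y) {1..n} = of_int (f {1..n})"
      using uv faceD(4)[OF x] faceD(4)[OF y] unfolding s by (simp flip: distrib_right)
  qed (use uv faceD(1,2)[OF x] faceD(1,2)[OF y] in \<open>auto simp: scaleR_fun_def\<close>)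
qed

fun slack :: "nat set + nat \<Rightarrow> (nat \<Rightarrow> real) \<Rightarrow> real" where
  "slack (Inl A) x = of_int (f A) - sum x A"
| "slack (Inr i) x = x i"

text \<open>The speed at which the slack of a constraint shrinks along v; a tight constraint remains
  tight along v when it vanishes.\<close>

fun rate :: "nat set + nat \<Rightarrow> (nat \<Rightarrow> real) \<Rightarrow> real" where
  "rate (Inl A) v = sum v A"
| "rate (Inr i) v = - v i"

definition constraints :: "(nat set + nat) set"
  where "constraints = Pow {1..n} <+> {1..n}"

definition loose :: "(nat \<Rightarrow> real) \<Rightarrow> (nat set + nat) set"
  where "loose x = {c \<in> constraints. slack c x \<noteq> 0}"

lemma finite_constraints: "finite constraints"
  by (simp add: constraints_def)

lemma slack_nonneg: "x \<in> face b \<Longrightarrow> c \<in> constraints \<Longrightarrow> 0 \<le> slack c x"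
  using faceD[of x b] by (auto simp: constraints_def)

lemma slack_move: "slack c (x + l *\<^sub>R v) = slack c x - l * rate c v"
  by (cases c) (simp_all add: scaleR_fun_def sum.distrib sum_distrib_left)

text \<open>The step length is the least ratio of slack to rate among the constraints being
  approached. The constraint attaining it becomes tight, and no tight one is lost because all tight
  ones have rate 0.\<close>

lemma move_until_tight:
  assumes x: "x \<in> face b" and v: "\<And>i. i \<notin> {1..n} \<Longrightarrow> v i = 0" "v i0 \<noteq> 0"
    and tight: "\<And>c. c \<in> constraints \<Longrightarrow> slack c x = 0 \<Longrightarrow> rate c v = 0"
  obtains l where "0 < l" "x + l *\<^sub>R v \<in> face b" "card (loose (x + l *\<^sub>R v)) < card (loose x)"
proof -
  define C where "C = {c \<in> constraints. 0 < rate c v}"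
  have i0: "i0 \<in> {1..n}" using v by auto
  \<comment> \<open>Some constraint is approached: a growing coordinate is stopped by the rank
    inequality of its singleton, a shrinking one by nonnegativity.\<close>
  have "(if 0 < v i0 then Inl {i0} else Inr i0) \<in> C"
    using i0 v(2) by (auto simp: C_def constraints_def)
  then have C: "finite C" "C \<noteq> {}" using finite_constraints by (auto simp: C_def)
  define l where "l = Min ((\<lambda>c. slack c x / rate c v) ` C)"
  have pos: "0 < slack c x / rate c v" if "c \<in> C" for c
    using that tight[of c] slack_nonneg[OF x, of c] by (force simp: C_def)
  have l: "0 < l" using C pos by (simp add: l_def)
  have lle: "l * rate c v \<le> slack c x" if "c \<in> constraints" for c
  proof (cases "0 < rate c v")
    case True
    then have "l \<le> slack c x / rate c v" using C that by (auto simp: l_def C_def)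
    then show ?thesis using True by (simp add: field_simps)
  next
    case False
    then have "l * rate c v \<le> 0" using l by (simp add: mult_nonneg_nonpos)
    then show ?thesis using slack_nonneg[OF x that] by linarith
  qed
  define y where "y = x + l *\<^sub>R v"
  have y0: "y i = 0" if "i \<notin> {1..n}" for i using that v faceD(1)[OF x] by (simp add: y_def scaleR_fun_def)
  have sl: "slack c y \<ge> 0" if "c \<in> constraints" for c using lle[OF that] by (simp add: y_def slack_move)
  have "y \<in> face b"
  proof (rule faceI)
    fix i show "0 \<le> y i"
      using sl[of "Inr i"] y0[of i] by (cases "i \<in> {1..n}") (auto simp: constraints_def InrI)
  next
    fix A assume "A \<subseteq> {1..n}" then show "sum y A \<le> of_int (f A)"
      using sl[of "Inl A"] by (auto simp: constraints_def)
  next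
    assume b
    then have s: "slack (Inl {1..n}) x = 0" using faceD(4)[OF x] by simp
    then have "rate (Inl {1..n}) v = 0" by (intro tight) (auto simp: constraints_def)
    then have "slack (Inl {1..n}) y = 0" using s by (simp only: y_def slack_move)
    then show "sum y {1..n} = of_int (f {1..n})" by simp
  qed (rule y0)
  moreover have "loose y \<subset> loose x"
  proof -
    have "l \<in> (\<lambda>c. slack c x / rate c v) ` C" unfolding l_def using C by (intro Min_in) auto
    then obtain c where c: "c \<in> C" "l = slack c x / rate c v" by blast
    then have "slack c y = 0" by (simp add: y_def slack_move C_def)
    moreover have "slack c x \<noteq> 0" using pos[OF c(1)] by auto
    moreover have "loose y \<subseteq> loose x" using tight by (auto simp: loose_def y_def slack_move)
    ultimately show ?thesis using c by (auto simp: loose_def C_def)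
  qed
  then have "card (loose y) < card (loose x)"
    by (rule psubset_card_mono[rotated]) (simp add: loose_def finite_constraints)
  ultimately show thesis using that l by (simp add: y_def)
qed

text \<open>Uncrossing: the sum of x is modular while f is submodular, so equality for A and B
  leaves no room in the inequalities for intersection and union.\<close>

lemma tight_Int:
  assumes x: "x \<in> face b" and A: "A \<subseteq> {1..n}" "sum x A = of_int (f A)" and B: "B \<subseteq> {1..n}" "sum x B = of_int (f B)"
  shows "sum x (A \<inter> B) = of_int (f (A \<inter> B))"
proof -
  have fin: "finite A" "finite B" using A B finite_subset by blast+
  have "sum x (A \<union> B) + sum x (A \<inter> B) = sum x A + sum x B"
    using sum.union_inter[OF fin, of x] by simp
  moreover have "sum x (A \<union> B) \<le> of_int (f (A \<union> B))" "sum x (A \<inter> B) \<le> of_int (f (A \<inter> B))"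
    using faceD(3)[OF x] A B by (simp_all add: le_infI1)
  moreover have "of_int (f (A \<inter> B)) + of_int (f (A \<union> B)) \<le> (of_int (f A) + of_int (f B) :: real)"
    using submodular[OF A(1) B(1)] by (metis of_int_add of_int_le_iff)
  ultimately show ?thesis using A B by linarith
qed

text \<open>
  In a minimal tight set with a fractional coordinate there are two of them, and every tight set
  contains both or neither; so mass can be exchanged between them in both directions.
\<close>

lemma fractional_direction:
  assumes x: "x \<in> face b" and i: "x i \<notin> \<int>"
  obtains v i0 where "\<And>j. j \<notin> {1..n} \<Longrightarrow> v j = 0" "v i0 \<noteq> 0"
    "\<And>c. c \<in> constraints \<Longrightarrow> slack c x = 0 \<Longrightarrow> rate c v = 0"
proof -
  define \<T> where "\<T> = {A. A \<subseteq> {1..n} \<and> sum x A = of_int (f A) \<and> (\<exists>j\<in>A. x j \<notin> \<int>)}"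
  have fr: "j \<in> {1..n}" "x j \<noteq> 0" if "x j \<notin> \<int>" for j
    using that faceD(1)[OF x, of j] by (metis Ints_0)+
  show thesis
  proof (cases "\<T> = {}")
    case True
    \<comment> \<open>No tight set contains a fractional coordinate, so a single one can be moved
      freely.\<close>
    let ?v = "\<lambda>j. if j = i then 1 else 0 :: real"
    show thesis
    proof (rule that[of ?v i])
      fix c assume c: "c \<in> constraints" "slack c x = 0"
      show "rate c ?v = 0"
      proof (cases c)
        case (Inl A)
        then have A: "A \<subseteq> {1..n}" "sum x A = of_int (f A)" using c by (auto simp: constraints_def)
        then have "i \<notin> A" using True i by (auto simp: \<T>_def)
        then show ?thesis using Inl finite_subset[OF A(1)] by (simp add: sum.delta)
      next
        case (Inr j) then show ?thesis using c i by auto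
      qed
    qed (use fr(1)[OF i] in auto)
  next
    case False
    have "finite \<T>" by (rule finite_subset[of _ "Pow {1..n}"]) (auto simp: \<T>_def)
    then obtain D where D: "D \<in> \<T>" and Dmin: "\<And>A. A \<in> \<T> \<Longrightarrow> A \<subseteq> D \<Longrightarrow> A = D"
      using finite_has_minimal[OF _ False] by metis
    then obtain a where a: "a \<in> D" "x a \<notin> \<int>" and D': "D \<subseteq> {1..n}" "sum x D = of_int (f D)" by (auto simp: \<T>_def)
    have finD: "finite D" using D' finite_subset by blast
    \<comment> \<open>The sum over a tight set is an integer, which a single fractional summand
      would prevent.\<close>
    have "\<exists>c\<in>D - {a}. x c \<notin> \<int>"
    proof (rule ccontr)
      assume "\<not> ?thesis"
      then have "sum x (D - {a}) \<in> \<int>" by (intro Ints_sum) auto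
      moreover have "x a = of_int (f D) - sum x (D - {a})" using D' a finD by (simp add: sum.remove)
      ultimately show False using a by simp
    qed
    then obtain c where c: "c \<in> D" "c \<noteq> a" "x c \<notin> \<int>" by blast
    have both: "a \<in> A \<longleftrightarrow> c \<in> A" if A: "A \<subseteq> {1..n}" "sum x A = of_int (f A)" for A
    proof -
      have "A \<inter> D = D" if "a \<in> A \<or> c \<in> A"
      proof (rule Dmin)
        have "sum x (A \<inter> D) = of_int (f (A \<inter> D))" by (rule tight_Int[OF x A D'])
        then show "A \<inter> D \<in> \<T>" using A a c that by (auto simp: \<T>_def)
      qed simp
      then show ?thesis using a c by blast
    qed
    let ?v = "\<lambda>j. if j = a then 1 else if j = c then -1 else 0 :: real"
    show thesis
    proof (rule that[of ?v a])
      fix k assume k: "k \<in> constraints" "slack k x = 0"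
      show "rate k ?v = 0"
      proof (cases k)
        case (Inl A)
        then have A: "A \<subseteq> {1..n}" "sum x A = of_int (f A)" using k by (auto simp: constraints_def)
        have fin: "finite A" using A finite_subset by blast
        have "?v = (\<lambda>j. (if j = a then 1 else 0) + (if j = c then -1 else 0))" using c by auto
        then have "sum ?v A = (if a \<in> A then 1 else 0) + (if c \<in> A then -1 else 0)"
          using fin by (simp only: sum.distrib sum.delta)
        then show ?thesis using Inl both[OF A] by auto
      next
        case (Inr j) then show ?thesis using k a c by auto
      qed
    qed (use fr a c in auto)
  qed
qed

text \<open>A fractional point can be moved along some direction and along its opposite until a
  further constraint becomes tight; it lies between the two end points, which have fewer loose
  constraints. Induction on their number ends at integer points.\<close>

theorem face_eq_convex_hull: "face b = convex hull (face b \<inter> integer_points)"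
proof
  show "convex hull (face b \<inter> integer_points) \<subseteq> face b"
    by (rule hull_minimal) (auto simp: convex_face)
  have "x \<in> convex hull (face b \<inter> integer_points)" if "x \<in> face b" for x
    using that
  proof (induction "card (loose x)" arbitrary: x rule: less_induct)
    case less
    show ?case
    proof (cases "\<forall>i. x i \<in> \<int>")
      case True
      then show ?thesis using less.prems by (auto simp: integer_points_def intro!: hull_inc)
    next
      case False
      then obtain i where "x i \<notin> \<int>" by blast
      then obtain v i0 where v: "\<And>j. j \<notin> {1..n} \<Longrightarrow> v j = 0" "v i0 \<noteq> 0"
        "\<And>c. c \<in> constraints \<Longrightarrow> slack c x = 0 \<Longrightarrow> rate c v = 0"
        using fractional_direction[OF less.prems] by blast
      obtain l where l: "0 < l" "x + l *\<^sub>R v \<in> face b" "card (loose (x + l *\<^sub>R v)) < card (loose x)"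
        using move_until_tight[OF less.prems v] .
      have "rate c (- v) = - rate c v" for c by (cases c) (simp_all add: sum_negf)
      then obtain m where m: "0 < m" "x + m *\<^sub>R (- v) \<in> face b" "card (loose (x + m *\<^sub>R (- v))) < card (loose x)"
        using move_until_tight[OF less.prems, of "- v" i0] v by auto
      let ?H = "convex hull (face b \<inter> integer_points)"
      have "x + l *\<^sub>R v \<in> ?H" "x + m *\<^sub>R (- v) \<in> ?H" using less.hyps l m by blast+
      \<comment> \<open>The weights are chosen inversely to the two step lengths, so that the
        displacements l v and - m v cancel.\<close>
      then have "(m / (l + m)) *\<^sub>R (x + l *\<^sub>R v) + (l / (l + m)) *\<^sub>R (x + m *\<^sub>R (- v)) \<in> ?H"
        using l(1) m(1) by (intro convexD[OF convex_convex_hull]) (auto simp flip: add_divide_distrib)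
      also have "(m / (l + m)) *\<^sub>R (x + l *\<^sub>R v) + (l / (l + m)) *\<^sub>R (x + m *\<^sub>R (- v)) = x"
      proof -
        have "l + m \<noteq> 0" using l(1) m(1) by linarith
        then have "(m / (l + m)) * (y + l * z) + (l / (l + m)) * (y - m * z) = y" for y z :: real
          by (simp add: divide_simps) (simp add: algebra_simps)
        then show ?thesis by (simp add: fun_eq_iff scaleR_fun_def)
      qed
      finally show ?thesis .
    qed
  qed
  then show "face b \<subseteq> convex hull (face b \<inter> integer_points)" by blast
qed

lemma finite_face_integer_points: "finite (face b \<inter> integer_points)"
proof (rule finite_subset[OF _ finite_bounded_integer_points[of n "of_int (f {1..n})"]])
  have "\<bar>x i\<bar> \<le> of_int (f {1..n})" if x: "x \<in> face b" for x i
    using face_le[OF x, of i] faceD(1,2)[OF x, of i] nonneg[of "{1..n}"] by (cases "i \<in> {1..n}") auto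
  then show "face b \<inter> integer_points \<subseteq>
    {x \<in> integer_points. (\<forall>i. i \<notin> {1..n} \<longrightarrow> x i = 0) \<and> (\<forall>i. \<bar>x i\<bar> \<le> of_int (f {1..n}))}"
    using faceD(1) by blast
qed

end

section \<open>Rank functions of matroids\<close>

locale matroid =
  fixes n :: nat and \<B> :: "nat set set"
  assumes bases: "matroid_bases n \<B>"
begin

lemma base_subset: "B \<in> \<B> \<Longrightarrow> B \<subseteq> {1..n}"
  using bases by (auto simp: matroid_bases_def)

lemma finite_base: "B \<in> \<B> \<Longrightarrow> finite B"
  using base_subset finite_subset by blast

lemma base_exchange:
  assumes "B \<in> \<B>" "B' \<in> \<B>" "x \<in> B - B'"
  obtains y where "y \<in> B' - B" "insert y (B - {x}) \<in> \<B>"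
  using bases assms unfolding matroid_bases_def by blast

text \<open>Exchanging an element of B - B' brings B closer to B' and keeps its size; once B lies in
  B', an exchange in the other direction shows equality.\<close>

lemma card_bases:
  assumes "B \<in> \<B>" "B' \<in> \<B>"
  shows "card B = card B'"
  using assms(1)
proof (induction "card (B - B')" arbitrary: B rule: less_induct)
  case less
  show ?case
  proof (cases "B \<subseteq> B'")
    case True
    have "B' - B = {}"
    proof (rule ccontr)
      assume "B' - B \<noteq> {}"
      then obtain x where "x \<in> B' - B" by blast
      then obtain y where "y \<in> B - B'" using base_exchange[OF assms(2) less.prems] by blast
      then show False using True by blast
    qed
    then show ?thesis using True by (simp add: subset_antisym)
  next
    case False
    then obtain x where x: "x \<in> B - B'" by blast
    then obtain y where y: "y \<in> B' - B" "insert y (B - {x}) \<in> \<B>"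
      using base_exchange[OF less.prems assms(2)] by blast
    have fin: "finite B" using finite_base less.prems .
    have "insert y (B - {x}) - B' = (B - B') - {x}" using y by blast
    then have "card (insert y (B - {x}) - B') < card (B - B')"
      using x fin by (simp only:) (intro card_Diff1_less; simp)
    then have "card (insert y (B - {x})) = card B'" using less.hyps y(2) by blast
    moreover have "card (insert y (B - {x})) = card B" using x y fin card_Suc_Diff1[OF fin, of x] by simp
    ultimately show ?thesis by simp
  qed
qed

lemma indep_subset: "I \<in> indep_sets \<B> \<Longrightarrow> I \<subseteq> {1..n}"
  using base_subset by (auto simp: indep_sets_def)

lemma finite_indep: "I \<in> indep_sets \<B> \<Longrightarrow> finite I"
  using indep_subset finite_subset by blast

lemma indep_mono: "I \<in> indep_sets \<B> \<Longrightarrow> J \<subseteq> I \<Longrightarrow> J \<in> indep_sets \<B>"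
  by (auto simp: indep_sets_def)

lemma indep_empty: "{} \<in> indep_sets \<B>"
  using bases by (auto simp: indep_sets_def matroid_bases_def)

text \<open>Suppose no element can be added. Choose bases B1 above I and B2 above J with B2 - (J
  \<union> B1) as small as possible. Exchanges then force B2 into J \<union> B1 and B1 into I
  \<union> B2, and since B1 and B2 have equally many private elements, J - I has at most as many
  elements as I - J.\<close>

lemma augmentation:
  assumes I: "I \<in> indep_sets \<B>" and J: "J \<in> indep_sets \<B>" and card: "card I < card J"
  obtains y where "y \<in> J - I" "insert y I \<in> indep_sets \<B>"
proof (rule ccontr)
  assume "\<not> thesis"
  with that have no: "insert y I \<notin> indep_sets \<B>" if "y \<in> J - I" for y using that by blast
  obtain B1 where B1: "B1 \<in> \<B>" "I \<subseteq> B1" using I by (auto simp: indep_sets_def)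
  define \<C> where "\<C> = {B \<in> \<B>. J \<subseteq> B}"
  have "\<C> \<noteq> {}" using J by (auto simp: indep_sets_def \<C>_def)
  then obtain B2 where B2: "B2 \<in> \<C>" and least: "\<And>B. B \<in> \<C> \<Longrightarrow> card (B2 - (J \<union> B1)) \<le> card (B - (J \<union> B1))"
    using ex_has_least_nat[of "\<lambda>B. B \<in> \<C>" _ "\<lambda>B. card (B - (J \<union> B1))"] by blast
  have B2': "B2 \<in> \<B>" "J \<subseteq> B2" using B2 by (auto simp: \<C>_def)
  \<comment> \<open>An element of J in B1 already belongs to I: otherwise it could be added to I
    inside the base B1.\<close>
  have JB1: "J - B1 = J - I"
  proof -
    have "y \<in> B1 \<Longrightarrow> y \<in> I" if "y \<in> J" for y
      using no[of y] that B1 by (auto simp: indep_sets_def)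
    then show ?thesis using B1 by blast
  qed
  have 1: "B2 - (J \<union> B1) = {}"
  proof (rule ccontr)
    assume "B2 - (J \<union> B1) \<noteq> {}"
    then obtain x where x: "x \<in> B2" "x \<notin> J" "x \<notin> B1" by blast
    then obtain y where y: "y \<in> B1 - B2" "insert y (B2 - {x}) \<in> \<B>"
      using base_exchange[OF B2'(1) B1(1)] by blast
    have "insert y (B2 - {x}) \<in> \<C>" using y B2' x by (auto simp: \<C>_def)
    moreover have "insert y (B2 - {x}) - (J \<union> B1) = (B2 - (J \<union> B1)) - {x}" using y by blast
    moreover have "card ((B2 - (J \<union> B1)) - {x}) < card (B2 - (J \<union> B1))"
      using x finite_base[OF B2'(1)] by (intro card_Diff1_less) auto
    ultimately show False using least[of "insert y (B2 - {x})"] by simp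
  qed
  have 2: "B1 - (I \<union> B2) = {}"
  proof (rule ccontr)
    assume "B1 - (I \<union> B2) \<noteq> {}"
    then obtain x where x: "x \<in> B1" "x \<notin> I" "x \<notin> B2" by blast
    then obtain y where y: "y \<in> B2 - B1" "insert y (B1 - {x}) \<in> \<B>"
      using base_exchange[OF B1(1) B2'(1)] by blast
    have "y \<in> J - I" using y 1 JB1 by blast
    moreover have "insert y I \<in> indep_sets \<B>" using y x B1 by (auto simp: indep_sets_def intro!: bexI[OF _ y(2)])
    ultimately show False using no by blast
  qed
  have fin: "finite B1" "finite B2" "finite I" "finite J" using finite_base finite_indep B1 B2' I J by blast+
  have "card (B1 - B2) = card (B2 - B1)"
    using card_bases[OF B1(1) B2'(1)] fin by (simp add: card_Diff_subset_Int Int_commute)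
  moreover have "B2 - B1 = J - I" using 1 JB1 B2' by blast
  moreover have "card (B1 - B2) \<le> card (I - J)" using 2 B2' fin by (intro card_mono) auto
  ultimately have "card (J - I) \<le> card (I - J)" by simp
  moreover have "card J = card (J - I) + card (J \<inter> I)" "card I = card (I - J) + card (J \<inter> I)"
    using fin by (simp_all add: card_Diff_subset_Int Int_commute card_mono)
  ultimately have "card J \<le> card I" by linarith
  with card show False by simp
qed

lemma rank_props:
  shows rank_ge: "I \<in> indep_sets \<B> \<Longrightarrow> I \<subseteq> A \<Longrightarrow> card I \<le> matroid_rank \<B> A"
    and rank_attained: "\<exists>I\<in>indep_sets \<B>. I \<subseteq> A \<and> card I = matroid_rank \<B> A"
proof -
  let ?S = "{X \<in> indep_sets \<B>. X \<subseteq> A}"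
  have "?S \<subseteq> Pow {1..n}" using indep_subset by auto
  then have fin: "finite ?S" by (rule finite_subset) simp
  show "I \<in> indep_sets \<B> \<Longrightarrow> I \<subseteq> A \<Longrightarrow> card I \<le> matroid_rank \<B> A"
    unfolding matroid_rank_def using fin by (intro Max_ge) auto
  have "{} \<in> ?S" using indep_empty by simp
  then have "matroid_rank \<B> A \<in> card ` ?S"
    unfolding matroid_rank_def using fin by (intro Max_in) auto
  then show "\<exists>I\<in>indep_sets \<B>. I \<subseteq> A \<and> card I = matroid_rank \<B> A" by (smt (verit) imageE mem_Collect_eq)
qed

lemma extend_to_rank:
  assumes "I \<in> indep_sets \<B>" "I \<subseteq> A"
  obtains J where "J \<in> indep_sets \<B>" "I \<subseteq> J" "J \<subseteq> A" "card J = matroid_rank \<B> A"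
proof -
  have "\<exists>J\<in>indep_sets \<B>. I \<subseteq> J \<and> J \<subseteq> A \<and> card J = matroid_rank \<B> A"
    using assms
  proof (induction "matroid_rank \<B> A - card I" arbitrary: I)
    case 0
    then show ?case using rank_ge[OF 0(2,3)] by (auto intro!: bexI[of _ I])
  next
    case (Suc m)
    obtain K where K: "K \<in> indep_sets \<B>" "K \<subseteq> A" "card K = matroid_rank \<B> A" using rank_attained by blast
    have "card I < card K" using Suc.hyps(2) K(3) by simp
    then obtain y where y: "y \<in> K - I" "insert y I \<in> indep_sets \<B>" using augmentation[OF Suc.prems(1) K(1)] by blast
    have "m = matroid_rank \<B> A - card (insert y I)"
      using Suc.hyps(2) y finite_indep[OF Suc.prems(1)] by simp
    then obtain J where "J \<in> indep_sets \<B>" "insert y I \<subseteq> J" "J \<subseteq> A" "card J = matroid_rank \<B> A"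
      using Suc.hyps(1)[of "insert y I"] y K Suc.prems by auto
    then show ?case by blast
  qed
  then show thesis using that by blast
qed

text \<open>A maximal independent set of X \<inter> Y is extended to a maximal one J of X \<union>
  Y; then J is counted through its parts in X and in Y.\<close>

lemma rank_submodular:
  "matroid_rank \<B> (X \<inter> Y) + matroid_rank \<B> (X \<union> Y) \<le> matroid_rank \<B> X + matroid_rank \<B> Y"
proof -
  obtain I where I: "I \<in> indep_sets \<B>" "I \<subseteq> X \<inter> Y" "card I = matroid_rank \<B> (X \<inter> Y)" using rank_attained by blast
  obtain J where J: "J \<in> indep_sets \<B>" "I \<subseteq> J" "J \<subseteq> X \<union> Y" "card J = matroid_rank \<B> (X \<union> Y)"
    using extend_to_rank[OF I(1), of "X \<union> Y"] I by blast
  have fin: "finite J" using J finite_indep by blast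
  have "card I \<le> card (J \<inter> X \<inter> Y)" using I J fin by (intro card_mono) auto
  moreover have "card (J \<inter> X) + card (J \<inter> Y) = card (J \<inter> X \<union> J \<inter> Y) + card ((J \<inter> X) \<inter> (J \<inter> Y))"
    using fin by (intro card_Un_Int) auto
  moreover have "J \<inter> X \<union> J \<inter> Y = J" "(J \<inter> X) \<inter> (J \<inter> Y) = J \<inter> X \<inter> Y" using J by auto
  moreover have "card (J \<inter> X) \<le> matroid_rank \<B> X" "card (J \<inter> Y) \<le> matroid_rank \<B> Y"
    using indep_mono[OF J(1)] by (auto intro!: rank_ge)
  ultimately show ?thesis using I J by simp
qed

lemma rank_mono: "X \<subseteq> Y \<Longrightarrow> matroid_rank \<B> X \<le> matroid_rank \<B> Y"
proof -
  assume "X \<subseteq> Y"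
  moreover obtain I where "I \<in> indep_sets \<B>" "I \<subseteq> X" "card I = matroid_rank \<B> X" using rank_attained by blast
  ultimately show ?thesis using rank_ge[of I Y] by simp
qed

lemma rank_le_card: "finite A \<Longrightarrow> matroid_rank \<B> A \<le> card A"
proof -
  assume "finite A"
  moreover obtain I where "I \<in> indep_sets \<B>" "I \<subseteq> A" "card I = matroid_rank \<B> A" using rank_attained by blast
  ultimately show ?thesis using card_mono[of A I] by simp
qed

lemma rank_empty: "matroid_rank \<B> {} = 0"
  using rank_le_card[of "{}"] by simp

lemma base_card: "B \<in> \<B> \<Longrightarrow> card B = matroid_rank \<B> {1..n}"
proof -
  assume B: "B \<in> \<B>"
  obtain I where I: "I \<in> indep_sets \<B>" "card I = matroid_rank \<B> {1..n}" using rank_attained[of "{1..n}"] by blast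
  then obtain B' where "B' \<in> \<B>" "I \<subseteq> B'" by (auto simp: indep_sets_def)
  then have "card I \<le> card B" using card_mono[OF finite_base, of B' I] card_bases[OF B, of B'] by simp
  moreover have "card B \<le> matroid_rank \<B> {1..n}" using B base_subset by (intro rank_ge) (auto simp: indep_sets_def)
  ultimately show ?thesis using I by simp
qed

lemma indep_iff_rank: "I \<subseteq> {1..n} \<Longrightarrow> I \<in> indep_sets \<B> \<longleftrightarrow> card I \<le> matroid_rank \<B> I"
proof
  assume "I \<subseteq> {1..n}" and c: "card I \<le> matroid_rank \<B> I"
  then have fin: "finite I" using finite_subset by blast
  obtain K where K: "K \<in> indep_sets \<B>" "K \<subseteq> I" "card K = matroid_rank \<B> I" using rank_attained by blast
  then have "K = I" using c fin by (intro card_seteq) auto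
  then show "I \<in> indep_sets \<B>" using K by simp
qed (simp add: rank_ge)

lemma base_iff: "B \<in> \<B> \<longleftrightarrow> B \<in> indep_sets \<B> \<and> card B = matroid_rank \<B> {1..n}"
proof
  assume "B \<in> \<B>"
  then show "B \<in> indep_sets \<B> \<and> card B = matroid_rank \<B> {1..n}"
    using base_card[of B] unfolding indep_sets_def by blast
next
  assume B: "B \<in> indep_sets \<B> \<and> card B = matroid_rank \<B> {1..n}"
  then obtain B' where B': "B' \<in> \<B>" "B \<subseteq> B'" unfolding indep_sets_def by blast
  then have "card B = card B'" using base_card[of B'] B by simp
  then have "B = B'" using B' by (intro card_subset_eq finite_base)
  then show "B \<in> \<B>" using B' by simp
qed

end

section \<open>Counting integer points by chains of flats\<close>

definition compositions :: "nat set \<Rightarrow> nat \<Rightarrow> (nat \<Rightarrow> nat) set"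
  where "compositions F s = {x. (\<forall>i. i \<notin> F \<longrightarrow> x i = 0) \<and> sum x F = s}"

text \<open>The stars-and-bars number of solutions with b summands. For b = 0 truncated subtraction
  gives the right value as well: 1 if s = 0 and 0 otherwise.\<close>

definition ways :: "nat \<Rightarrow> nat \<Rightarrow> nat"
  where "ways b s = (s + b - 1) choose s"

lemma compositions_split:
  assumes "finite F" "G \<subseteq> F"
  shows "bij_betw (\<lambda>(y, z) i. if i \<in> G then y i else z i)
    (compositions G s' \<times> compositions (F - G) s'') {x \<in> compositions F (s' + s''). sum x G = s'}"
proof (rule bij_betwI[where g = "\<lambda>x. (\<lambda>i. if i \<in> G then x i else 0, \<lambda>i. if i \<in> G then 0 else x i)"])
  have split: "sum x F = sum x G + sum x (F - G)" for x :: "nat \<Rightarrow> nat"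
    using sum.subset_diff[OF assms(2,1), of x] by simp
  show "(\<lambda>(y, z) i. if i \<in> G then y i else z i) \<in> compositions G s' \<times> compositions (F - G) s'' \<rightarrow> {x \<in> compositions F (s' + s''). sum x G = s'}"
  proof
    fix p assume "p \<in> compositions G s' \<times> compositions (F - G) s''"
    then obtain y z where p: "p = (y, z)" and y: "y \<in> compositions G s'" and z: "z \<in> compositions (F - G) s''" by blast
    let ?x = "\<lambda>i. if i \<in> G then y i else z i"
    have 1: "sum ?x G = s'" using y by (simp add: compositions_def)
    moreover have "sum ?x (F - G) = s''" using z by (simp add: compositions_def)
    ultimately have "sum ?x F = s' + s''" using split[of ?x] by simp
    then have "?x \<in> compositions F (s' + s'')"
      using y z assms by (auto simp: compositions_def)
    then show "(\<lambda>(y, z) i. if i \<in> G then y i else z i) p \<in> {x \<in> compositions F (s' + s''). sum x G = s'}"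
      using 1 by (simp only: p prod.case mem_Collect_eq)
  qed
  show "(\<lambda>x. (\<lambda>i. if i \<in> G then x i else 0, \<lambda>i. if i \<in> G then 0 else x i)) \<in>
    {x \<in> compositions F (s' + s''). sum x G = s'} \<rightarrow> compositions G s' \<times> compositions (F - G) s''"
    using split by (auto simp: compositions_def)
qed (use assms in \<open>auto simp: compositions_def fun_eq_iff\<close>)

lemma compositions_empty: "compositions {} s = (if s = 0 then {\<lambda>_. 0} else {})"
  by (auto simp: compositions_def)

lemma finite_compositions:
  assumes "finite F"
  shows "finite (compositions F s)"
proof (rule finite_subset)
  show "compositions F s \<subseteq> (\<lambda>y i. if i \<in> F then y i else 0) ` (\<Pi>\<^sub>E i\<in>F. {..s})"
  proof
    fix x assume x: "x \<in> compositions F s"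
    then have "(\<lambda>i\<in>F. x i) \<in> (\<Pi>\<^sub>E i\<in>F. {..s})"
      using member_le_sum[of _ F x] assms by (auto simp: compositions_def)
    moreover have "x = (\<lambda>i. if i \<in> F then (\<lambda>i\<in>F. x i) i else 0)" using x by (auto simp: compositions_def)
    ultimately show "x \<in> (\<lambda>y i. if i \<in> F then y i else 0) ` (\<Pi>\<^sub>E i\<in>F. {..s})" by blast
  qed
qed (intro finite_imageI finite_PiE assms; simp)

text \<open>Fixing the sum on G decouples the coordinates in G from the others, and h sees only the
  former, so the others contribute a mere factor.\<close>

lemma sum_compositions_fibre:
  assumes "finite F" "G \<subseteq> F" "s' \<le> s" and h: "\<And>x y. (\<And>i. i \<in> G \<Longrightarrow> x i = y i) \<Longrightarrow> h x = h y"
  shows "(\<Sum>x | x \<in> compositions F s \<and> sum x G = s'. h x) =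
    (\<Sum>y\<in>compositions G s'. h y :: int) * int (card (compositions (F - G) (s - s')))"
proof -
  have "{x. x \<in> compositions F s \<and> sum x G = s'} = {x \<in> compositions F (s' + (s - s')). sum x G = s'}"
    using assms(3) by simp
  then have "(\<Sum>x | x \<in> compositions F s \<and> sum x G = s'. h x) =
    (\<Sum>(y, z)\<in>compositions G s' \<times> compositions (F - G) (s - s'). h (\<lambda>i. if i \<in> G then y i else z i))"
    using sum.reindex_bij_betw[OF compositions_split[OF assms(1,2), of s' "s - s'"], of h]
    by (simp add: case_prod_unfold)
  also have "\<dots> = (\<Sum>(y, z)\<in>compositions G s' \<times> compositions (F - G) (s - s'). h y)"
    by (intro sum.cong) (auto intro!: h)
  finally show ?thesis
    by (simp add: sum.cartesian_product[symmetric] sum_distrib_right mult.commute)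
qed

text \<open>Classifying by the sum over F leaves the new coordinate determined; the resulting sum of
  binomial coefficients is the hockey-stick identity, except for empty F.\<close>

lemma card_compositions:
  assumes "finite F"
  shows "card (compositions F s) = ways (card F) s"
  using assms
proof (induction F arbitrary: s rule: finite_induct)
  case empty
  then show ?case by (cases s) (auto simp: compositions_empty ways_def)
next
  case (insert a F)
  have sing: "compositions {a} j = {\<lambda>i. if i = a then j else 0}" for j
    by (auto simp: compositions_def)
  have fib: "card {x. x \<in> compositions (insert a F) s \<and> sum x F = j} = card (compositions F j)" if "j \<le> s" for j
  proof -
    have "insert a F - F = {a}" using insert by auto
    then show ?thesis
      using sum_compositions_fibre[of "insert a F" F j s "\<lambda>_. 1"] insert that by (simp add: subset_insertI sing)
  qed
  have "sum x F \<le> s" if "x \<in> compositions (insert a F) s" for x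
    using that insert by (auto simp: compositions_def)
  then have "compositions (insert a F) s = (\<Union>j\<in>{..s}. {x. x \<in> compositions (insert a F) s \<and> sum x F = j})"
    by auto
  then have "card (compositions (insert a F) s) = card (\<Union>j\<in>{..s}. {x. x \<in> compositions (insert a F) s \<and> sum x F = j})"
    by simp
  also have "\<dots> = (\<Sum>j\<le>s. card {x. x \<in> compositions (insert a F) s \<and> sum x F = j})"
    using finite_compositions[of "insert a F" s] insert by (intro card_UN_disjoint) auto
  also have "\<dots> = (\<Sum>j\<le>s. ways (card F) j)"
    by (intro sum.cong) (auto simp: fib insert.IH)
  also have "\<dots> = ways (Suc (card F)) s"
  proof (cases "card F")
    case 0
    have "(\<Sum>j\<le>s. ways 0 j) = (\<Sum>j\<le>s. if j = 0 then 1 else 0)"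
      by (intro sum.cong) (auto simp: ways_def)
    then show ?thesis using 0 by (simp add: ways_def)
  next
    case (Suc m)
    then have "(\<Sum>j\<le>s. ways (card F) j) = (\<Sum>j\<le>s. (m + j) choose j)" by (simp add: ways_def add.commute)
    also have "\<dots> = Suc (m + s) choose s" by (rule sum_choose_lower)
    finally show ?thesis using Suc by (simp add: ways_def add.commute)
  qed
  finally show ?case using insert by simp
qed

text \<open>Here \<mu> is the Moebius function from an adjoined bottom element, whose own value is
  1. By its recursion the values below any F of V add up to -1. If they vanish off the part below M,
  the sum over V is the sum below M, that is -1.\<close>

lemma moebius_sum_eq:
  fixes \<mu> :: "'a set \<Rightarrow> int"
  assumes fin: "finite V" and M: "M \<in> V" "\<And>B. B \<in> V \<Longrightarrow> B \<inter> M \<in> V" and finV: "\<And>B. B \<in> V \<Longrightarrow> finite B"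
    and \<mu>: "\<And>F. F \<in> V \<Longrightarrow> \<mu> F = - (1 + (\<Sum>G | G \<in> V \<and> G \<subset> F. \<mu> G))"
  shows "(\<Sum>G\<in>V. \<mu> G) = -1"
proof -
  have below: "(\<Sum>G | G \<in> V \<and> G \<subseteq> F. \<mu> G) = -1" if F: "F \<in> V" for F
  proof -
    have "{G \<in> V. G \<subseteq> F} = insert F {G \<in> V. G \<subset> F}" using F by auto
    then show ?thesis using fin \<mu>[OF F] by simp
  qed
  \<comment> \<open>The elements strictly below F are those below F \<inter> M, which is in V and
    hence yields -1, and those not below M, whose values vanish by induction.\<close>
  have zero: "\<mu> F = 0" if "F \<in> V" "\<not> F \<subseteq> M" for F
    using that
  proof (induction "card F" arbitrary: F rule: less_induct)
    case less
    have "{G \<in> V. G \<subset> F} = {G \<in> V. G \<subseteq> F \<inter> M} \<union> {G \<in> V. G \<subset> F \<and> \<not> G \<subseteq> M}" using less.prems by auto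
    then have "(\<Sum>G | G \<in> V \<and> G \<subset> F. \<mu> G) =
      (\<Sum>G | G \<in> V \<and> G \<subseteq> F \<inter> M. \<mu> G) + (\<Sum>G | G \<in> V \<and> G \<subset> F \<and> \<not> G \<subseteq> M. \<mu> G)"
      using fin by (simp only:) (intro sum.union_disjoint; auto)
    also have "(\<Sum>G | G \<in> V \<and> G \<subset> F \<and> \<not> G \<subseteq> M. \<mu> G) = 0"
      using less.hyps finV[OF less.prems(1)] by (intro sum.neutral) (auto intro: psubset_card_mono)
    finally show ?case using \<mu>[OF less.prems(1)] below[OF M(2)[OF less.prems(1)]] by simp
  qed
  have "V = {G \<in> V. G \<subseteq> M} \<union> {G \<in> V. \<not> G \<subseteq> M}" by auto
  then have "(\<Sum>G\<in>V. \<mu> G) = (\<Sum>G | G \<in> V \<and> G \<subseteq> M. \<mu> G) + (\<Sum>G | G \<in> V \<and> \<not> G \<subseteq> M. \<mu> G)"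
    using fin sum.union_disjoint[of "{G \<in> V. G \<subseteq> M}" "{G \<in> V. \<not> G \<subseteq> M}" \<mu>] by auto
  also have "\<dots> = -1" using below[OF M(1)] zero by simp
  finally show ?thesis .
qed

context integer_polymatroid
begin

section \<open>Flats and closures\<close>

declare of_nat_sum [simp del]

definition flats :: "nat set set"
  where "flats = {F. F \<subseteq> {1..n} \<and> (\<forall>i\<in>{1..n} - F. f F < f (insert i F))}"

definition flat_closure :: "nat set \<Rightarrow> nat set"
  where "flat_closure A = {i \<in> {1..n}. f (insert i A) = f A}"

lemma finite_flats: "finite flats"
  by (rule finite_subset[of _ "Pow {1..n}"]) (auto simp: flats_def)

lemma flat_subset: "F \<in> flats \<Longrightarrow> F \<subseteq> {1..n}"
  by (simp add: flats_def)

lemma diminishing: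
  assumes "A \<subseteq> B" "B \<subseteq> {1..n}" "i \<in> {1..n}"
  shows "f (insert i B) - f B \<le> f (insert i A) - f A"
proof (cases "i \<in> B")
  case True
  then show ?thesis using mono[of A "insert i A"] assms by (auto simp: insert_absorb)
next
  case False
  then have "insert i A \<inter> B = A" "insert i A \<union> B = insert i B" using assms by auto
  moreover have "insert i A \<subseteq> {1..n}" using assms by auto
  ultimately show ?thesis using submodular[of "insert i A" B] assms by simp
qed

lemma flat_closure_subset: "A \<subseteq> {1..n} \<Longrightarrow> A \<subseteq> flat_closure A"
  by (auto simp: flat_closure_def insert_absorb)

text \<open>Elements that add nothing to f one at a time add nothing jointly, because gains
  diminish.\<close>

lemma rank_flat_closure:
  assumes A: "A \<subseteq> {1..n}"
  shows "f (flat_closure A) = f A"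
proof -
  have "f (A \<union> B) = f A" if "B \<subseteq> flat_closure A" "finite B" for B
    using that(2,1)
  proof (induction B rule: finite_induct)
    case (insert b B)
    then have b: "b \<in> {1..n}" "f (insert b A) = f A" "B \<subseteq> {1..n}" by (auto simp: flat_closure_def)
    have "f (insert b (A \<union> B)) - f (A \<union> B) \<le> 0" using diminishing[of A "A \<union> B" b] A b by auto
    moreover have "f (A \<union> B) \<le> f (insert b (A \<union> B))" using A b by (intro mono) auto
    ultimately show ?case using insert by simp
  qed simp
  from this[of "flat_closure A"] show ?thesis
    using flat_closure_subset[OF A] by (simp add: Un_absorb1 flat_closure_def)
qed

lemma flat_closure_flat:
  assumes A: "A \<subseteq> {1..n}"
  shows "flat_closure A \<in> flats"
proof -
  have "f (flat_closure A) < f (insert i (flat_closure A))" if i: "i \<in> {1..n} - flat_closure A" for i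
  proof -
    have "f A < f (insert i A)" using i mono[of A "insert i A"] A by (force simp: flat_closure_def)
    also have "\<dots> \<le> f (insert i (flat_closure A))"
      using flat_closure_subset[OF A] i by (intro mono) (auto simp: flat_closure_def)
    finally show ?thesis using rank_flat_closure[OF A] by simp
  qed
  then show ?thesis by (auto simp: flats_def flat_closure_def)
qed

lemma flat_Int:
  assumes "F \<in> flats" "G \<in> flats"
  shows "F \<inter> G \<in> flats"
proof -
  have "f (F \<inter> G) < f (insert i (F \<inter> G))" if i: "i \<in> {1..n} - F \<inter> G" for i
  proof (cases "i \<in> F")
    case True
    then have "f G < f (insert i G)" using i assms by (auto simp: flats_def)
    then show ?thesis using diminishing[of "F \<inter> G" G i] flat_subset[OF assms(2)] i by auto
  next
    case False
    then have "f F < f (insert i F)" using i assms by (auto simp: flats_def)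
    then show ?thesis using diminishing[of "F \<inter> G" F i] flat_subset[OF assms(1)] i by auto
  qed
  then show ?thesis using assms by (auto simp: flats_def)
qed

text \<open>This bounds the length of chains: f is integral and nonnegative, so a strictly
  increasing chain of flats ending in F has at most f F members before F.\<close>

lemma flat_rank_less:
  assumes "G \<in> flats" "G \<subset> F" "F \<subseteq> {1..n}"
  shows "f G < f F"
proof -
  obtain i where i: "i \<in> F - G" using assms by blast
  then have "f G < f (insert i G)" using assms by (auto simp: flats_def)
  also have "\<dots> \<le> f F" using i assms by (intro mono) auto
  finally show ?thesis .
qed

section \<open>Violated flats and their Moebius function\<close>

definition violated :: "nat \<Rightarrow> (nat \<Rightarrow> nat) \<Rightarrow> nat set set"
  where "violated k x = {G \<in> flats. int k * f G < int (sum x G)}"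

text \<open>The Moebius function of the poset of violated flats with a bottom element, cut off at depth l.\<close>

fun chain_weight :: "nat \<Rightarrow> nat \<Rightarrow> nat set \<Rightarrow> (nat \<Rightarrow> nat) \<Rightarrow> int" where
  "chain_weight k 0 F x = -1"
| "chain_weight k (Suc l) F x = - (1 + (\<Sum>G | G \<in> violated k x \<and> G \<subset> F. chain_weight k l G x))"

text \<open>Each descent to a smaller flat lowers f by at least 1, and below a set with f F <= 0
  there is no flat left; so depth f F sees all chains.\<close>

lemma chain_weight_stable:
  assumes "F \<subseteq> {1..n}" "f F \<le> int l"
  shows "chain_weight k l F x = chain_weight k (Suc l) F x"
  using assms
proof (induction l arbitrary: F)
  case 0
  have "{G. G \<in> violated k x \<and> G \<subset> F} = {}"
    using 0 flat_rank_less[of _ F] nonneg[OF flat_subset] by (force simp: violated_def)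
  then show ?case unfolding chain_weight.simps by (simp only: sum.empty)
next
  case (Suc l)
  have "chain_weight k l G x = chain_weight k (Suc l) G x" if "G \<in> violated k x \<and> G \<subset> F" for G
    using that Suc flat_rank_less[of G F] by (intro Suc.IH) (auto simp: violated_def)
  then have "(\<Sum>G | G \<in> violated k x \<and> G \<subset> F. chain_weight k l G x) =
    (\<Sum>G | G \<in> violated k x \<and> G \<subset> F. chain_weight k (Suc l) G x)"
    by (intro sum.cong) auto
  then show ?case by (simp only: chain_weight.simps)
qed

text \<open>The function g = k f - x is submodular and M minimizes it over the flats. Hence g (B
  \<inter> M) is at most g B plus the nonpositive difference of g M and g (B \<union> M), and stays
  negative.\<close>

lemma violated_meet:
  assumes "violated k x \<noteq> {}"
  obtains M where "M \<in> violated k x" "\<And>B. B \<in> violated k x \<Longrightarrow> B \<inter> M \<in> violated k x"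
proof -
  define g where "g A = int k * f A - int (sum x A)" for A
  have viol: "B \<in> violated k x \<longleftrightarrow> B \<in> flats \<and> g B < 0" for B by (auto simp: violated_def g_def)
  obtain M where M: "M \<in> flats" "\<And>B. B \<in> flats \<Longrightarrow> g M \<le> g B"
  proof -
    have ne: "finite (g ` flats)" "g ` flats \<noteq> {}" using finite_flats assms by (auto simp: violated_def)
    then obtain M where "M \<in> flats" "Min (g ` flats) = g M" using Min_in by blast
    then show thesis using that Min_le[OF ne(1)] by auto
  qed
  have "M \<in> violated k x"
  proof -
    obtain B where "B \<in> flats" "g B < 0" using assms viol by blast
    then show ?thesis using M(2)[of B] M(1) viol by simp
  qed
  moreover have "B \<inter> M \<in> violated k x" if B: "B \<in> violated k x" for B
  proof -
    have sub: "B \<subseteq> {1..n}" "M \<subseteq> {1..n}" "B \<in> flats" using B M flat_subset by (auto simp: violated_def)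
    then have fin: "finite B" "finite M" using finite_subset by blast+
    have "sum x (B \<union> M) + sum x (B \<inter> M) = sum x B + sum x M" using sum.union_inter[OF fin] .
    then have m: "int (sum x (B \<union> M)) + int (sum x (B \<inter> M)) = int (sum x B) + int (sum x M)" by linarith
    have "int k * (f (B \<inter> M) + f (B \<union> M)) \<le> int k * (f B + f M)"
      using submodular[OF sub(1,2)] by (intro mult_left_mono) auto
    then have "g (B \<inter> M) + g (B \<union> M) \<le> g B + g M" using m by (simp add: g_def algebra_simps)
    \<comment> \<open>The union need not be a flat, but closing it keeps f and can only enlarge the
      sum of x, so g does not increase.\<close>
    moreover have "g M \<le> g (B \<union> M)"
    proof -
      have BM: "B \<union> M \<subseteq> {1..n}" using sub by auto
      have "sum x (B \<union> M) \<le> sum x (flat_closure (B \<union> M))"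
        using flat_closure_subset[OF BM] by (intro sum_mono2) (auto simp: flat_closure_def)
      then have "g (flat_closure (B \<union> M)) \<le> g (B \<union> M)" using rank_flat_closure[OF BM] by (simp add: g_def)
      then show ?thesis using M(2)[OF flat_closure_flat[OF BM]] by linarith
    qed
    ultimately show ?thesis using B flat_Int[OF sub(3) M(1)] viol by force
  qed
  ultimately show thesis using that by blast
qed

text \<open>The ground set acts as a top element: it is not violated, so every violated flat lies
  strictly below it. Its weight is minus the full Moebius sum including the bottom, hence -1 without
  violated flats and 0 otherwise. Testing flats suffices since closing a set keeps f and enlarges
  sums.\<close>

lemma chain_weight_top:
  assumes x: "int (sum x {1..n}) \<le> int k * f {1..n}" and l: "f {1..n} \<le> int l"
  shows "chain_weight k l {1..n} x = - of_bool (\<forall>A\<subseteq>{1..n}. int (sum x A) \<le> int k * f A)"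
proof -
  let ?V = "violated k x"
  define \<mu> where "\<mu> F = chain_weight k l F x" for F
  have \<mu>: "\<mu> F = - (1 + (\<Sum>G | G \<in> ?V \<and> G \<subset> F. \<mu> G))" if "F \<subseteq> {1..n}" for F
    using chain_weight_stable[OF that, of l k x] mono[OF that] l by (simp add: \<mu>_def)
  have "{1..n} \<notin> ?V" using x by (simp add: violated_def)
  then have "{G. G \<in> ?V \<and> G \<subset> {1..n}} = ?V" using flat_subset by (auto simp: violated_def)
  then have top: "\<mu> {1..n} = - (1 + sum \<mu> ?V)" using \<mu>[of "{1..n}"] by simp
  have "?V = {} \<longleftrightarrow> (\<forall>A\<subseteq>{1..n}. int (sum x A) \<le> int k * f A)"
  proof
    assume V: "?V = {}"
    show "\<forall>A\<subseteq>{1..n}. int (sum x A) \<le> int k * f A"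
    proof (intro allI impI)
      fix A assume A: "A \<subseteq> {1..n}"
      have "sum x A \<le> sum x (flat_closure A)"
        using flat_closure_subset[OF A] by (intro sum_mono2) (auto simp: flat_closure_def)
      moreover have "int (sum x (flat_closure A)) \<le> int k * f (flat_closure A)"
        using flat_closure_flat[OF A] V by (force simp: violated_def)
      ultimately show "int (sum x A) \<le> int k * f A" using rank_flat_closure[OF A] by simp
    qed
  next
    assume "\<forall>A\<subseteq>{1..n}. int (sum x A) \<le> int k * f A"
    then show "?V = {}" using flat_subset by (force simp: violated_def not_less)
  qed
  moreover have "sum \<mu> ?V = -1" if V: "?V \<noteq> {}"
  proof -
    obtain M where M: "M \<in> ?V" "\<And>B. B \<in> ?V \<Longrightarrow> B \<inter> M \<in> ?V" using violated_meet[OF V] by blast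
    have sub: "F \<subseteq> {1..n}" if "F \<in> ?V" for F using that flat_subset by (auto simp: violated_def)
    show ?thesis
    proof (rule moebius_sum_eq[OF _ M])
      show "finite ?V" using finite_flats by (simp add: violated_def)
      fix F assume "F \<in> ?V"
      then show "finite F" "\<mu> F = - (1 + (\<Sum>G | G \<in> ?V \<and> G \<subset> F. \<mu> G))"
        using sub[of F] finite_subset[of F "{1..n}"] \<mu>[of F] by auto
    qed
  qed
  ultimately show ?thesis using top by (auto simp: \<mu>_def)
qed

text \<open>The sum of \<open>chain_weight k l F\<close> over all compositions of s on a set of b
  elements containing F, see \<open>sum_chain_weight\<close>. Of the surrounding set only its size
  matters; s' is the sum over G, and the b - card G coordinates outside G are free.\<close>

fun signed_count :: "nat \<Rightarrow> nat \<Rightarrow> nat set \<Rightarrow> nat \<Rightarrow> nat \<Rightarrow> int" where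
  "signed_count k 0 F b s = - int (ways b s)"
| "signed_count k (Suc l) F b s = - (int (ways b s) + (\<Sum>G | G \<in> flats \<and> G \<subset> F.
     \<Sum>s' | s' \<le> s \<and> int k * f G < int s'. signed_count k l G (card G) s' * int (ways (b - card G) (s - s'))))"

lemma chain_weight_cong:
  assumes "\<And>i. i \<in> F \<Longrightarrow> x i = y i"
  shows "chain_weight k l F x = chain_weight k l F y"
  using assms
proof (induction l arbitrary: F)
  case (Suc l)
  have "sum x G = sum y G" if "G \<subset> F" for G using that Suc.prems by (intro sum.cong) auto
  then have "G \<in> violated k x \<longleftrightarrow> G \<in> violated k y" if "G \<subset> F" for G
    using that by (simp add: violated_def)
  then have "{G. G \<in> violated k x \<and> G \<subset> F} = {G. G \<in> violated k y \<and> G \<subset> F}"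
    by blast
  moreover have "chain_weight k l G x = chain_weight k l G y" if "G \<subset> F" for G
    using that Suc.prems by (intro Suc.IH) auto
  ultimately show ?case by (auto intro!: sum.cong)
qed simp

text \<open>After the sums over points and flats are exchanged, the weight of G depends only on the
  coordinates in G. Grouping the points by their sum on G therefore splits every group into a
  product.\<close>

lemma sum_chain_weight:
  assumes "finite F'" "F \<subseteq> F'"
  shows "(\<Sum>x\<in>compositions F' s. chain_weight k l F x) = signed_count k l F (card F') s"
  using assms
proof (induction l arbitrary: F F' s)
  case 0
  then show ?case by (simp add: card_compositions sum_negf)
next
  case (Suc l)
  let ?X = "compositions F' s"
  have finX: "finite ?X" using Suc.prems finite_compositions by blast
  let ?\<G> = "{G. G \<in> flats \<and> G \<subset> F}"
  have fin\<G>: "finite ?\<G>" using finite_flats by simp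
  have "(\<Sum>x\<in>?X. \<Sum>G | G \<in> violated k x \<and> G \<subset> F. chain_weight k l G x) =
    (\<Sum>x\<in>?X. \<Sum>G\<in>?\<G>. if int k * f G < int (sum x G) then chain_weight k l G x else 0)"
  proof (rule sum.cong[OF refl])
    fix x
    have "{G. G \<in> violated k x \<and> G \<subset> F} = {G \<in> ?\<G>. int k * f G < int (sum x G)}" by (auto simp: violated_def)
    then show "(\<Sum>G | G \<in> violated k x \<and> G \<subset> F. chain_weight k l G x) =
      (\<Sum>G\<in>?\<G>. if int k * f G < int (sum x G) then chain_weight k l G x else 0)"
      by (simp only: sum.inter_filter[OF fin\<G>])
  qed
  also have "\<dots> = (\<Sum>G\<in>?\<G>. \<Sum>x\<in>?X. if int k * f G < int (sum x G) then chain_weight k l G x else 0)"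
    by (rule sum.swap)
  also have "\<dots> = (\<Sum>G\<in>?\<G>. \<Sum>s' | s' \<le> s \<and> int k * f G < int s'.
      signed_count k l G (card G) s' * int (ways (card F' - card G) (s - s')))"
  proof (rule sum.cong[OF refl])
    fix G assume G: "G \<in> ?\<G>"
    then have GF': "G \<subseteq> F'" using Suc.prems by blast
    then have finG: "finite G" using Suc.prems finite_subset by blast
    let ?S = "{s'. s' \<le> s \<and> int k * f G < int s'}"
    have finS: "finite ?S" by (rule finite_subset[of _ "{..s}"]) auto
    have le: "sum x G \<le> s" if "x \<in> ?X" for x
      using that sum_mono2[OF Suc.prems(1) GF', of x] by (auto simp: compositions_def)
    have "(\<Sum>x\<in>?X. if int k * f G < int (sum x G) then chain_weight k l G x else 0) =
      (\<Sum>x | x \<in> ?X \<and> int k * f G < int (sum x G). chain_weight k l G x)"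
      using finX by (simp add: sum.inter_filter)
    also have "\<dots> = (\<Sum>s'\<in>?S. \<Sum>x | x \<in> {x. x \<in> ?X \<and> int k * f G < int (sum x G)} \<and> sum x G = s'. chain_weight k l G x)"
      using finX finS le by (intro sum.group[symmetric]) auto
    also have "\<dots> = (\<Sum>s'\<in>?S. signed_count k l G (card G) s' * int (ways (card F' - card G) (s - s')))"
    proof (rule sum.cong[OF refl])
      fix s' assume s': "s' \<in> ?S"
      have "{x. x \<in> {x. x \<in> ?X \<and> int k * f G < int (sum x G)} \<and> sum x G = s'} = {x. x \<in> ?X \<and> sum x G = s'}"
        using s' by auto
      then have "(\<Sum>x | x \<in> {x. x \<in> ?X \<and> int k * f G < int (sum x G)} \<and> sum x G = s'. chain_weight k l G x) =
        (\<Sum>y\<in>compositions G s'. chain_weight k l G y) * int (card (compositions (F' - G) (s - s')))"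
        using sum_compositions_fibre[OF Suc.prems(1) GF', of s' s "chain_weight k l G", OF _ chain_weight_cong] s'
        by simp
      also have "\<dots> = signed_count k l G (card G) s' * int (ways (card F' - card G) (s - s'))"
        using Suc.IH[OF finG order_refl] card_compositions[of "F' - G"] Suc.prems(1) finG GF' by (simp add: card_Diff_subset)
      finally show "(\<Sum>x | x \<in> {x. x \<in> ?X \<and> int k * f G < int (sum x G)} \<and> sum x G = s'. chain_weight k l G x) =
        signed_count k l G (card G) s' * int (ways (card F' - card G) (s - s'))" .
    qed
    finally show "(\<Sum>x\<in>?X. if int k * f G < int (sum x G) then chain_weight k l G x else 0) =
      (\<Sum>s'\<in>?S. signed_count k l G (card G) s' * int (ways (card F' - card G) (s - s')))" .
  qed
  finally show ?case using Suc.prems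
    by (simp add: sum_subtractf sum_negf card_compositions)
qed

text \<open>The total s keeps the ground set from being violated. Coordinates of F' outside {1..n}
  absorb slack; they enter only through the number of coordinates.\<close>

lemma card_compositions_polymatroid:
  assumes F': "finite F'" "{1..n} \<subseteq> F'" and s: "int s = int k * f {1..n}" and l: "f {1..n} \<le> int l"
  shows "int (card {x \<in> compositions F' s. \<forall>A\<subseteq>{1..n}. int (sum x A) \<le> int k * f A}) =
    - signed_count k l {1..n} (card F') s"
proof -
  let ?X = "compositions F' s"
  have finX: "finite ?X" using F' finite_compositions by blast
  have "int (sum x {1..n}) \<le> int k * f {1..n}" if "x \<in> ?X" for x
  proof -
    have "sum x {1..n} \<le> sum x F'" using F' by (intro sum_mono2) auto
    then show ?thesis using that s by (simp add: compositions_def)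
  qed
  then have "(\<Sum>x\<in>?X. chain_weight k l {1..n} x) = (\<Sum>x\<in>?X. - of_bool (\<forall>A\<subseteq>{1..n}. int (sum x A) \<le> int k * f A))"
    by (intro sum.cong refl chain_weight_top l)
  then have "signed_count k l {1..n} (card F') s = (\<Sum>x\<in>?X. - of_bool (\<forall>A\<subseteq>{1..n}. int (sum x A) \<le> int k * f A))"
    using sum_chain_weight[OF F', where k = k and l = l and s = s] by simp
  then show ?thesis using finX by (simp add: sum_negf Int_def)
qed

end

section \<open>Polynomiality\<close>

text \<open>Polynomial functions of the dilation factor and the total. The total must be an
  independent variable, because the recursion sums over it; only at the end is it tied to the
  factor.\<close>

inductive bivariate :: "(real \<Rightarrow> real \<Rightarrow> real) \<Rightarrow> bool" where
  monomial: "bivariate (\<lambda>x y. a * x ^ i * y ^ j)"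
| add: "bivariate \<phi> \<Longrightarrow> bivariate \<psi> \<Longrightarrow> bivariate (\<lambda>x y. \<phi> x y + \<psi> x y)"

lemma bivariate_const: "bivariate (\<lambda>x y. a)"
  using monomial[of a 0 0] by simp

lemma bivariate_fst: "bivariate (\<lambda>x y. x)" and bivariate_snd: "bivariate (\<lambda>x y. y)"
  using monomial[of 1 1 0] monomial[of 1 0 1] by simp_all

lemma bivariate_mult:
  assumes "bivariate \<phi>" "bivariate \<psi>"
  shows "bivariate (\<lambda>x y. \<phi> x y * \<psi> x y)"
  using assms(1)
proof (induction rule: bivariate.induct)
  case (monomial a i j)
  show ?case using assms(2)
  proof (induction rule: bivariate.induct)
    case (monomial b k l)
    have "(\<lambda>x y. a * x ^ i * y ^ j * (b * x ^ k * y ^ l)) = (\<lambda>x y. (a * b) * x ^ (i + k) * y ^ (j + l))"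
      by (simp add: fun_eq_iff power_add)
    then show ?case using bivariate.monomial by metis
  next
    case (add \<phi> \<psi>)
    then show ?case using bivariate.add[OF add.IH] by (simp add: distrib_left)
  qed
next
  case (add \<phi>' \<psi>')
  then show ?case using bivariate.add[OF add.IH] by (simp add: distrib_right)
qed

lemma bivariate_diff:
  assumes "bivariate \<phi>" "bivariate \<psi>"
  shows "bivariate (\<lambda>x y. \<phi> x y - \<psi> x y)"
  using add[OF assms(1) bivariate_mult[OF bivariate_const[of "-1"] assms(2)]] by simp

lemma bivariate_sum: "finite I \<Longrightarrow> (\<And>i. i \<in> I \<Longrightarrow> bivariate (\<phi> i)) \<Longrightarrow> bivariate (\<lambda>x y. \<Sum>i\<in>I. \<phi> i x y)"
proof (induction I rule: finite_induct)
  case empty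
  then show ?case using bivariate_const[of 0] by simp
next
  case (insert i I)
  then show ?case using add[of "\<phi> i" "\<lambda>x y. \<Sum>i\<in>I. \<phi> i x y"] by simp
qed

lemma bivariate_poly: "bivariate \<phi> \<Longrightarrow> bivariate (\<lambda>x y. poly p (\<phi> x y))"
proof (induction p)
  case 0
  then show ?case using bivariate_const[of 0] by simp
next
  case (pCons a p)
  then show ?case using add[OF bivariate_const[of a] bivariate_mult[of \<phi>]] by simp
qed

lemma bivariate_line: "bivariate \<phi> \<Longrightarrow> \<exists>p. \<forall>x. \<phi> x (x * c) = poly p x"
proof (induction rule: bivariate.induct)
  case (monomial a i j)
  have "a * x ^ i * (x * c) ^ j = poly (smult (a * c ^ j) (monom 1 (i + j))) x" for x
    by (simp add: poly_monom power_add power_mult_distrib)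
  then show ?case by blast
next
  case (add \<phi> \<psi>)
  then show ?case by (metis poly_add)
qed

text \<open>Telescoping the differences of (j + 1)-st powers and expanding them binomially expresses
  the sum of j-th powers by sums of lower powers.\<close>

lemma sum_of_powers_poly: "\<exists>p. \<forall>m. (\<Sum>i\<in>{0<..m}. real i ^ j) = poly p (real m)"
proof (induction j rule: less_induct)
  case (less j)
  then obtain S where S: "\<And>l m. l < j \<Longrightarrow> (\<Sum>i\<in>{0<..m}. real i ^ l) = poly (S l) (real m)" by metis
  define p where "p = smult (1 / real (Suc j)) ([:1, 1:] ^ Suc j - 1 - (\<Sum>l<j. smult (real (Suc j choose l)) (S l)))"
  have "(\<Sum>i\<in>{0<..m}. real i ^ j) = poly p (real m)" for m
  proof -
    have tel: "(\<Sum>i\<in>{0<..m}. (real i + 1) ^ Suc j - real i ^ Suc j) = (real m + 1) ^ Suc j - 1"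
    proof (induction m)
      case (Suc m)
      have "{0<..Suc m} = insert (Suc m) {0<..m}" by auto
      then show ?case using Suc by (simp add: add.commute)
    qed simp
    have "(real i + 1) ^ Suc j - real i ^ Suc j = (\<Sum>l<j. real (Suc j choose l) * real i ^ l) + real (Suc j) * real i ^ j" for i
    proof -
      have "(real i + 1) ^ Suc j = (\<Sum>l\<le>Suc j. real (Suc j choose l) * real i ^ l)"
        by (simp add: binomial_ring del: power_Suc)
      also have "\<dots> = (\<Sum>l<j. real (Suc j choose l) * real i ^ l) + real (Suc j) * real i ^ j + real i ^ Suc j"
        by (simp only: lessThan_Suc_atMost[symmetric] sum.lessThan_Suc) simp
      finally show ?thesis by simp
    qed
    then have "(real m + 1) ^ Suc j - 1 = (\<Sum>i\<in>{0<..m}. (\<Sum>l<j. real (Suc j choose l) * real i ^ l) + real (Suc j) * real i ^ j)"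
      using tel by simp
    also have "\<dots> = (\<Sum>l<j. real (Suc j choose l) * (\<Sum>i\<in>{0<..m}. real i ^ l)) + real (Suc j) * (\<Sum>i\<in>{0<..m}. real i ^ j)"
      by (simp add: sum.distrib sum_distrib_left sum.swap[of _ "{0<..m}" "{..<j}"])
    also have "(\<Sum>l<j. real (Suc j choose l) * (\<Sum>i\<in>{0<..m}. real i ^ l)) = (\<Sum>l<j. real (Suc j choose l) * poly (S l) (real m))"
      using S by simp
    finally have "real (Suc j) * (\<Sum>i\<in>{0<..m}. real i ^ j) = (real m + 1) ^ Suc j - 1 - (\<Sum>l<j. real (Suc j choose l) * poly (S l) (real m))"
      by simp
    moreover have "poly p (real m) = ((real m + 1) ^ Suc j - 1 - (\<Sum>l<j. real (Suc j choose l) * poly (S l) (real m))) / real (Suc j)"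
      by (simp add: p_def poly_sum add.commute del: power_Suc of_nat_Suc)
    ultimately show ?thesis by (metis nonzero_mult_div_cancel_left of_nat_neq_0)
  qed
  then show ?case by blast
qed

text \<open>For monomials the sum is a power sum over an interval, that is the difference of a
  power-sum polynomial at s and at k c. This is valid only when the lower limit does not exceed the
  upper one.\<close>

lemma bivariate_convolution:
  assumes "bivariate \<phi>" "bivariate \<theta>"
  shows "\<exists>\<psi>. bivariate \<psi> \<and> (\<forall>k s. k * c \<le> s \<longrightarrow>
    (\<Sum>s'\<in>{k * c<..s}. \<phi> (real k) (real s') * \<theta> (real s') (real s)) = \<psi> (real k) (real s))"
  using assms(1)
proof (induction rule: bivariate.induct)
  case (monomial a i j)
  show ?case using assms(2)
  proof (induction rule: bivariate.induct)
    case (monomial b m l)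
    obtain p where p: "\<And>M. (\<Sum>i\<in>{0<..M}. real i ^ (j + m)) = poly p (real M)" using sum_of_powers_poly by metis
    define \<psi> where "\<psi> = (\<lambda>x y. (a * b * x ^ i * y ^ l) * (poly p y - poly p (x * real c)))"
    have "bivariate \<psi>" unfolding \<psi>_def
      by (intro bivariate_mult bivariate.monomial bivariate_diff bivariate_poly bivariate_const bivariate_fst bivariate_snd)
    moreover have "(\<Sum>s'\<in>{k * c<..s}. a * real k ^ i * real s' ^ j * (b * real s' ^ m * real s ^ l)) = \<psi> (real k) (real s)"
      if ks: "k * c \<le> s" for k s
    proof -
      have "{0<..s} = {0<..k * c} \<union> {k * c<..s}" using ks by auto
      then have "(\<Sum>i\<in>{0<..s}. real i ^ (j + m)) = (\<Sum>i\<in>{0<..k * c}. real i ^ (j + m)) + (\<Sum>i\<in>{k * c<..s}. real i ^ (j + m))"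
        by (simp only:) (intro sum.union_disjoint; auto)
      then have "(\<Sum>s'\<in>{k * c<..s}. real s' ^ (j + m)) = poly p (real s) - poly p (real k * real c)" using p by simp
      moreover have "(\<Sum>s'\<in>{k * c<..s}. a * real k ^ i * real s' ^ j * (b * real s' ^ m * real s ^ l)) =
        (a * b * real k ^ i * real s ^ l) * (\<Sum>s'\<in>{k * c<..s}. real s' ^ (j + m))"
        unfolding sum_distrib_left by (intro sum.cong) (simp_all add: power_add)
      ultimately show ?thesis by (simp add: \<psi>_def)
    qed
    ultimately show ?case by blast
  next
    case (add \<theta>1 \<theta>2)
    then obtain \<psi>1 \<psi>2 where \<psi>: "bivariate \<psi>1" "bivariate \<psi>2"
      "\<And>k s. k * c \<le> s \<Longrightarrow> (\<Sum>s'\<in>{k * c<..s}. a * real k ^ i * real s' ^ j * \<theta>1 (real s') (real s)) = \<psi>1 (real k) (real s)"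
      "\<And>k s. k * c \<le> s \<Longrightarrow> (\<Sum>s'\<in>{k * c<..s}. a * real k ^ i * real s' ^ j * \<theta>2 (real s') (real s)) = \<psi>2 (real k) (real s)"
      by blast
    show ?case
      by (rule exI[of _ "\<lambda>x y. \<psi>1 x y + \<psi>2 x y"])
        (simp add: \<psi> bivariate.add distrib_left sum.distrib)
  qed
next
  case (add \<phi>1 \<phi>2)
  then obtain \<psi>1 \<psi>2 where \<psi>: "bivariate \<psi>1" "bivariate \<psi>2"
    "\<And>k s. k * c \<le> s \<Longrightarrow> (\<Sum>s'\<in>{k * c<..s}. \<phi>1 (real k) (real s') * \<theta> (real s') (real s)) = \<psi>1 (real k) (real s)"
    "\<And>k s. k * c \<le> s \<Longrightarrow> (\<Sum>s'\<in>{k * c<..s}. \<phi>2 (real k) (real s') * \<theta> (real s') (real s)) = \<psi>2 (real k) (real s)"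
    by blast
  show ?case
    by (rule exI[of _ "\<lambda>x y. \<psi>1 x y + \<psi>2 x y"])
      (simp add: \<psi> bivariate.add distrib_right sum.distrib)
qed

text \<open>By symmetry the lower index becomes the constant b - 1. For b = 0 the function is the
  indicator of s = 0 and no polynomial.\<close>

lemma ways_poly:
  assumes "0 < b"
  shows "\<exists>p. \<forall>s. real (ways b s) = poly p (real s)"
proof -
  define p where "p = smult (1 / fact (b - 1)) (\<Prod>i<b - 1. [:real (b - 1) - real i, 1:])"
  have "real (ways b s) = poly p (real s)" for s
  proof -
    have "ways b s = (s + (b - 1)) choose (b - 1)"
      using assms binomial_symmetric[of s "s + (b - 1)"] by (simp add: ways_def)
    also have "real \<dots> = (\<Prod>i<b - 1. real (s + (b - 1)) - real i) / fact (b - 1)"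
      by (simp only: binomial_gbinomial gbinomial_prod_rev atLeast0LessThan)
    finally show ?thesis by (simp add: p_def poly_prod algebra_simps)
  qed
  then show ?thesis by blast
qed

context integer_polymatroid
begin

text \<open>Disposes of the empty flat, the case without coordinates in which \<open>ways\<close> is
  not polynomial: it is violated only by sums s' > 0, which no composition of the empty set
  has.\<close>

lemma signed_count_empty: "0 < s \<Longrightarrow> signed_count k l {} 0 s = 0"
  by (cases l) (auto simp: ways_def)

text \<open>The polynomial agrees with the count only for s >= k f F. This region is stable under
  the recursion: G is evaluated at s' > k f G, and k f G <= k f F <= s makes the summation interval
  a proper one.\<close>

lemma signed_count_bivariate:
  assumes "F \<subseteq> {1..n}" "card F \<le> b" "0 < b"
  shows "\<exists>\<psi>. bivariate \<psi> \<and> (\<forall>k s. int k * f F \<le> int s \<longrightarrow> real_of_int (signed_count k l F b s) = \<psi> (real k) (real s))"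
  using assms
proof (induction l arbitrary: F b)
  case 0
  obtain p where p: "\<And>s. real (ways b s) = poly p (real s)" using ways_poly[OF 0(3)] by blast
  show ?case
    by (rule exI[of _ "\<lambda>x y. -1 * poly p y"])
      (use bivariate_mult[OF bivariate_const[of "-1"] bivariate_poly[OF bivariate_snd, of p]] in \<open>simp add: p\<close>)
next
  case (Suc l)
  obtain p where p: "\<And>s. real (ways b s) = poly p (real s)" using ways_poly[OF Suc.prems(3)] by blast
  let ?\<G> = "{G. G \<in> flats \<and> G \<subset> F}"
  let ?T = "\<lambda>G k s. \<Sum>s' | s' \<le> s \<and> int k * f G < int s'. signed_count k l G (card G) s' * int (ways (b - card G) (s - s'))"
  have "\<exists>\<psi>. bivariate \<psi> \<and> (\<forall>k s. int k * f F \<le> int s \<longrightarrow> real_of_int (?T G k s) = \<psi> (real k) (real s))" if G: "G \<in> ?\<G>" for G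
  proof (cases "G = {}")
    case True
    have "?T G k s = 0" for k s
      by (rule sum.neutral) (auto simp: True empty signed_count_empty)
    then show ?thesis using bivariate_const[of 0] by (intro exI[of _ "\<lambda>x y. 0"]) simp
  next
    case False
    have Gn: "G \<subseteq> {1..n}" using G flat_subset by blast
    have fin: "finite F" "finite G" using Gn Suc.prems(1) finite_subset by blast+
    have "card G < card F" using G fin by (intro psubset_card_mono) auto
    then have cG: "card G < b" using Suc.prems by linarith
    obtain q where q: "\<And>s. real (ways (b - card G) s) = poly q (real s)" using ways_poly[of "b - card G"] cG by auto
    have "0 < card G" using False fin by (simp add: card_gt_0_iff)
    then obtain \<phi> where \<phi>: "bivariate \<phi>" "\<And>k s. int k * f G \<le> int s \<Longrightarrow> real_of_int (signed_count k l G (card G) s) = \<phi> (real k) (real s)"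
      using Suc.IH[OF Gn order_refl] by blast
    define c where "c = nat (f G)"
    have c: "int c = f G" using nonneg[OF Gn] by (simp add: c_def)
    have "bivariate (\<lambda>x y. poly q (y - x))"
      by (intro bivariate_poly bivariate_diff bivariate_fst bivariate_snd)
    then obtain \<psi> where \<psi>: "bivariate \<psi>" "\<And>k s. k * c \<le> s \<Longrightarrow>
      (\<Sum>s'\<in>{k * c<..s}. \<phi> (real k) (real s') * poly q (real s - real s')) = \<psi> (real k) (real s)"
      using bivariate_convolution[OF \<phi>(1)] by blast
    have "real_of_int (?T G k s) = \<psi> (real k) (real s)" if s: "int k * f F \<le> int s" for k s
    proof -
      have "int k * f G \<le> int k * f F" using G Suc.prems(1) by (intro mult_left_mono mono) auto
      then have "int (k * c) \<le> int s" using s c by simp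
      then have ks: "k * c \<le> s" by linarith
      have set: "{s'. s' \<le> s \<and> int k * f G < int s'} = {k * c<..s}"
        by (auto simp: c[symmetric] simp flip: of_nat_mult)
      have "real_of_int (?T G k s) = (\<Sum>s'\<in>{k * c<..s}. \<phi> (real k) (real s') * poly q (real s - real s'))"
        unfolding set of_int_sum
      proof (intro sum.cong refl)
        fix s' assume s': "s' \<in> {k * c<..s}"
        then have "int (k * c) \<le> int s'" unfolding of_nat_le_iff by simp
        then have "int k * f G \<le> int s'" using c by simp
        then show "real_of_int (signed_count k l G (card G) s' * int (ways (b - card G) (s - s'))) =
          \<phi> (real k) (real s') * poly q (real s - real s')"
          using \<phi>(2)[of k s'] q[of "s - s'"] s' by (simp add: of_nat_diff)
      qed
      then show ?thesis using \<psi>(2)[OF ks] by simp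
    qed
    then show ?thesis using \<psi>(1) by blast
  qed
  then have "\<forall>G\<in>?\<G>. \<exists>\<psi>. bivariate \<psi> \<and> (\<forall>k s. int k * f F \<le> int s \<longrightarrow> real_of_int (?T G k s) = \<psi> (real k) (real s))"
    by blast
  from bchoice[OF this] obtain \<psi> where \<psi>: "\<And>G. G \<in> ?\<G> \<Longrightarrow> bivariate (\<psi> G)"
    "\<And>G k s. G \<in> ?\<G> \<Longrightarrow> int k * f F \<le> int s \<Longrightarrow> real_of_int (?T G k s) = \<psi> G (real k) (real s)"
    by blast
  define \<Psi> where "\<Psi> = (\<lambda>x y. -1 * (poly p y + (\<Sum>G\<in>?\<G>. \<psi> G x y)))"
  have "bivariate \<Psi>" unfolding \<Psi>_def
    using finite_flats \<psi>(1) by (intro bivariate_mult bivariate_const add bivariate_poly bivariate_snd bivariate_sum) auto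
  moreover have "real_of_int (signed_count k (Suc l) F b s) = \<Psi> (real k) (real s)" if "int k * f F \<le> int s" for k s
  proof -
    have "real_of_int (\<Sum>G\<in>?\<G>. ?T G k s) = (\<Sum>G\<in>?\<G>. \<psi> G (real k) (real s))"
      unfolding of_int_sum[of _ ?\<G>] using \<psi>(2)[OF _ that] by (intro sum.cong refl)
    then show ?thesis by (simp only: signed_count.simps \<Psi>_def of_int_minus of_int_add p of_int_of_nat_eq) simp
  qed
  ultimately show ?case by blast
qed

end

section \<open>The leading coefficient is the normalized volume\<close>

lemma sum_fun_apply: "(\<Sum>j\<in>J. g j) i = (\<Sum>j\<in>J. g j i)" for g :: "'a \<Rightarrow> 'b \<Rightarrow> real"
  by (induction J rule: infinite_finite_induct) simp_all

lemma integer_pointsD: "x \<in> integer_points \<Longrightarrow> x i \<in> \<int>"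
  by (simp add: integer_points_def)

lemma span_vanish:
  assumes "x \<in> span T" "\<And>y. y \<in> T \<Longrightarrow> y i = 0"
  shows "x i = (0 :: real)"
proof -
  have "subspace {x :: 'a \<Rightarrow> real. x i = 0}" by (simp add: subspace_def scaleR_fun_def)
  then have "span T \<subseteq> {x. x i = 0}" using assms(2) by (intro span_minimal) auto
  then show ?thesis using assms(1) by auto
qed

section \<open>Bases of lattices of integer vectors\<close>

lemma subgroup_multiple:
  fixes L :: "(nat \<Rightarrow> real) set"
  assumes 0: "0 \<in> L" and diff: "\<And>x y. x \<in> L \<Longrightarrow> y \<in> L \<Longrightarrow> x - y \<in> L" and x: "x \<in> L"
  shows "of_int z *\<^sub>R x \<in> L"
proof -
  have neg': "- y \<in> L" if "y \<in> L" for y using diff[OF 0 that] by simp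
  have add: "y + w \<in> L" if "y \<in> L" "w \<in> L" for y w using diff[OF that(1) neg'[OF that(2)]] by simp
  have nat: "real m *\<^sub>R x \<in> L" for m
  proof (induction m)
    case (Suc m)
    have "real (Suc m) *\<^sub>R x = x + real m *\<^sub>R x" by (simp add: fun_eq_iff scaleR_fun_def algebra_simps)
    then show ?case using add[OF x Suc] by (simp only:)
  qed (use 0 in \<open>simp only: of_nat_0 scaleR_zero_left\<close>)
  show ?thesis
  proof (cases z)
    case (nonneg m) then show ?thesis using nat by simp
  next
    case (neg m)
    then have "of_int z = - real (Suc m)" by simp
    then show ?thesis using neg'[OF nat[of "Suc m"]] by (simp only: scaleR_minus_left)
  qed
qed

lemma lattice_basis_mem:
  assumes "lattice_basis d b L"
  shows "x \<in> L \<longleftrightarrow> (\<exists>c :: nat \<Rightarrow> int. x = (\<Sum>j<d. of_int (c j) *\<^sub>R b j))"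
proof -
  have "L = {\<Sum>j<d. real_of_int (c j) *\<^sub>R b j | c. True}" using assms unfolding lattice_basis_def by blast
  then show ?thesis by blast
qed

text \<open>Induction on the number of coordinates. The vectors with last coordinate 0 have a basis,
  and a vector v with the least positive last coordinate completes it: division with remainder
  reduces every other vector by a multiple of v.\<close>

lemma lattice_basis_exists:
  assumes "0 \<in> L" "\<And>x y. x \<in> L \<Longrightarrow> y \<in> L \<Longrightarrow> x - y \<in> L" "L \<subseteq> integer_points"
    "\<And>x i. x \<in> L \<Longrightarrow> i \<notin> {1..n} \<Longrightarrow> x i = 0"
  shows "\<exists>d b. d \<le> n \<and> lattice_basis d b L"
  using assms
proof (induction n arbitrary: L)
  case 0
  have "x = 0" if "x \<in> L" for x using 0(4)[OF that] by (intro ext) simp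
  then have "L = {0}" using 0(1) by blast
  then have "lattice_basis 0 (\<lambda>_. 0) L" by (simp add: lattice_basis_def independent_empty)
  then show ?case by blast
next
  case (Suc n)
  define L' where "L' = {x \<in> L. x (Suc n) = 0}"
  have supp: "x i = 0" if "x \<in> L'" "i \<notin> {1..n}" for x i
    using that Suc.prems(4)[of x i] by (cases "i = Suc n") (auto simp: L'_def)
  have "\<exists>d b. d \<le> n \<and> lattice_basis d b L'"
  proof (rule Suc.IH)
    show "0 \<in> L'" using Suc.prems(1) unfolding L'_def mem_Collect_eq zero_fun_apply by blast
    show "x - y \<in> L'" if "x \<in> L'" "y \<in> L'" for x y
      using that Suc.prems(2)[of x y] unfolding L'_def mem_Collect_eq minus_apply by simp
    show "L' \<subseteq> integer_points" using Suc.prems(3) unfolding L'_def by blast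
  qed (rule supp)
  then obtain d b where d: "d \<le> n" and b: "lattice_basis d b L'" by blast
  show ?case
  proof (cases "L' = L")
    case True
    then show ?thesis using d b le_SucI by blast
  next
    case False
    then obtain y where y: "y \<in> L" "y (Suc n) \<noteq> 0" by (auto simp: L'_def)
    obtain z where z: "y (Suc n) = of_int z" using integer_pointsD[of y "Suc n"] Suc.prems(3) y(1) by (auto elim: Ints_cases)
    define G where "G m \<longleftrightarrow> 0 < m \<and> (\<exists>v\<in>L. v (Suc n) = real m)" for m :: nat
    have "G (nat \<bar>z\<bar>)"
    proof -
      \<comment> \<open>The sign makes the last coordinate positive, so that a least positive one
        exists.\<close>
      have "of_int (sgn z) *\<^sub>R y \<in> L" by (rule subgroup_multiple[OF Suc.prems(1,2) y(1)])
      moreover have "(of_int (sgn z) *\<^sub>R y) (Suc n) = real (nat \<bar>z\<bar>)"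
        using z by (simp add: scaleR_fun_def abs_sgn flip: of_int_mult) (simp add: mult.commute sgn_if)
      ultimately show ?thesis using y(2) z by (auto simp: G_def)
    qed
    define g where "g = (LEAST m. G m)"
    have "G g" unfolding g_def using \<open>G (nat \<bar>z\<bar>)\<close> by (rule LeastI)
    then obtain v where g: "0 < g" and v: "v \<in> L" "v (Suc n) = real g" by (auto simp: G_def)
    have reduce: "\<exists>q::int. x - of_int q *\<^sub>R v \<in> L'" if x: "x \<in> L" for x
    proof -
      obtain w where w: "x (Suc n) = of_int w" using integer_pointsD[of x "Suc n"] Suc.prems(3) x by (auto elim: Ints_cases)
      define q where "q = w div int g"
      let ?x = "x - of_int q *\<^sub>R v"
      have xL: "?x \<in> L" using Suc.prems(2)[OF x subgroup_multiple[OF Suc.prems(1,2) v(1)]] .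
      have "?x (Suc n) = of_int (w - q * int g)" using w v by (simp add: scaleR_fun_def)
      also have "w - q * int g = w mod int g" by (simp add: q_def minus_div_mult_eq_mod)
      finally have e: "?x (Suc n) = real (nat (w mod int g))" using g by simp
      \<comment> \<open>A nonzero remainder would be a positive last coordinate smaller than the
        least one.\<close>
      have "nat (w mod int g) = 0"
      proof (rule ccontr)
        assume "nat (w mod int g) \<noteq> 0"
        then have "G (nat (w mod int g))" using xL e unfolding G_def by blast
        then have "g \<le> nat (w mod int g)" unfolding g_def by (rule Least_le)
        moreover have "nat (w mod int g) < g" using g by (simp add: nat_less_iff)
        ultimately show False by simp
      qed
      then have "?x \<in> L'" using xL e unfolding L'_def by simp
      then show ?thesis by blast
    qed
    define b' where "b' = b(d := v)"
    have img: "b' ` {..<Suc d} = insert v (b ` {..<d})" by (auto simp: b'_def lessThan_Suc)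
    have bL: "b j \<in> L'" if "j < d" for j
    proof -
      let ?c = "\<lambda>i. if i = j then 1 else 0 :: int"
      have "b j = (\<Sum>i<d. of_int (?c i) *\<^sub>R b i)"
        using that by (intro ext) (simp add: sum_fun_apply scaleR_fun_def if_distrib[of of_int] if_distrib[of "\<lambda>x. x * _"] cong: if_cong)
      then show ?thesis unfolding lattice_basis_mem[OF b] by (rule exI[of _ ?c])
    qed
    have "v \<notin> span (b ` {..<d})"
    proof
      assume "v \<in> span (b ` {..<d})"
      then have "v (Suc n) = 0" by (rule span_vanish) (use bL in \<open>unfold L'_def, blast\<close>)
      then show False using v g by simp
    qed
    then have "independent (b' ` {..<Suc d})" "v \<notin> b ` {..<d}"
      using b independent_insertI[of v "b ` {..<d}"] span_base[of v "b ` {..<d}"] unfolding img lattice_basis_def by blast+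
    moreover from this have "inj_on b' {..<Suc d}"
    proof -
      have "inj_on b' {..<d}" using b unfolding lattice_basis_def by (auto simp: b'_def inj_on_def)
      moreover have "b' d \<notin> b' ` {..<d}" using \<open>v \<notin> b ` {..<d}\<close> by (auto simp: b'_def)
      ultimately show ?thesis by (simp add: lessThan_Suc)
    qed
    moreover have "L = {\<Sum>j<Suc d. of_int (c j) *\<^sub>R b' j | c. True}"
    proof (intro set_eqI iffI)
      fix x assume "x \<in> L"
      then obtain q :: int where "x - of_int q *\<^sub>R v \<in> L'" using reduce by blast
      then obtain c where c: "x - of_int q *\<^sub>R v = (\<Sum>j<d. of_int (c j) *\<^sub>R b j)"
        unfolding lattice_basis_mem[OF b] by blast
      have "(\<Sum>j<d. of_int ((c(d := q)) j) *\<^sub>R b' j) = (\<Sum>j<d. of_int (c j) *\<^sub>R b j)"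
        by (intro sum.cong) (auto simp: b'_def)
      then have "x = (\<Sum>j<Suc d. of_int ((c(d := q)) j) *\<^sub>R b' j)"
        using c unfolding sum.lessThan_Suc b'_def fun_upd_same by (metis diff_add_cancel)
      then show "x \<in> {\<Sum>j<Suc d. of_int (c j) *\<^sub>R b' j | c. True}" by blast
    next
      fix x assume "x \<in> {\<Sum>j<Suc d. of_int (c j) *\<^sub>R b' j | c. True}"
      then obtain c where c: "x = (\<Sum>j<Suc d. of_int (c j) *\<^sub>R b' j)" by blast
      moreover have "(\<Sum>j<d. of_int (c j) *\<^sub>R b' j) = (\<Sum>j<d. of_int (c j) *\<^sub>R b j)"
        by (intro sum.cong) (auto simp: b'_def)
      ultimately have x_eq: "x = (\<Sum>j<d. of_int (c j) *\<^sub>R b j) - of_int (- c d) *\<^sub>R v"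
        unfolding sum.lessThan_Suc of_int_minus scaleR_minus_left diff_minus_eq_add b'_def fun_upd_same by (simp only:)
      have mem: "(\<Sum>j<d. of_int (c j) *\<^sub>R b j) \<in> L"
      proof -
        have "(\<Sum>j<d. of_int (c j) *\<^sub>R b j) \<in> L'" unfolding lattice_basis_mem[OF b] by blast
        then show ?thesis unfolding L'_def by blast
      qed
      show "x \<in> L" unfolding x_eq
        by (rule Suc.prems(2)[OF mem subgroup_multiple[OF Suc.prems(1,2) v(1)]])
    qed
    ultimately have "lattice_basis (Suc d) b' L" unfolding lattice_basis_def by (intro conjI)
    then show ?thesis using d by (intro exI[of _ "Suc d"] exI[of _ b'] conjI) simp_all
  qed
qed

section \<open>Asymptotics of polynomials\<close>

lemma tendsto_power_quotient:
  assumes "i < D"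
  shows "(\<lambda>k. real k ^ i / real k ^ D) \<longlonglongrightarrow> 0"
proof -
  have "(\<lambda>k. inverse (real k ^ (D - i))) \<longlonglongrightarrow> 0"
    using assms by (intro tendsto_inverse_0_at_top filterlim_pow_at_top filterlim_real_sequentially) simp
  moreover have "\<forall>\<^sub>F k in sequentially. inverse (real k ^ (D - i)) = real k ^ i / real k ^ D"
    using eventually_gt_at_top[of 0]
  proof eventually_elim
    case (elim k)
    have "real k ^ D = real k ^ (D - i) * real k ^ i" using assms by (simp flip: power_add)
    then show ?case using elim by (simp add: field_simps)
  qed
  ultimately show ?thesis by (rule Lim_transform_eventually)
qed

lemma tendsto_poly_quotient:
  "(\<lambda>k. poly p (real k) / real k ^ degree p) \<longlonglongrightarrow> lead_coeff p"
proof -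
  have "(\<lambda>k. \<Sum>i\<le>degree p. coeff p i * (real k ^ i / real k ^ degree p)) \<longlonglongrightarrow>
    (\<Sum>i\<le>degree p. coeff p i * (if i = degree p then 1 else 0))"
  proof (intro tendsto_sum tendsto_mult tendsto_const)
    fix i assume "i \<in> {..degree p}"
    then consider "i = degree p" | "i < degree p" by fastforce
    then show "(\<lambda>k. real k ^ i / real k ^ degree p) \<longlonglongrightarrow> (if i = degree p then 1 else 0)"
    proof cases
      case 1
      have "\<forall>\<^sub>F k in sequentially. 1 = real k ^ i / real k ^ degree p"
        using eventually_gt_at_top[of 0] by eventually_elim (simp add: 1)
      then show ?thesis using 1 Lim_transform_eventually[OF tendsto_const[of 1]] by simp
    next
      case 2
      then show ?thesis using tendsto_power_quotient[OF 2] by simp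
    qed
  qed
  then show ?thesis by (simp add: poly_altdef sum_divide_distrib if_distrib[of "(*) _"] cong: if_cong)
qed

lemma poly_leading_term:
  assumes lim: "(\<lambda>k. poly p (real k) / real k ^ d) \<longlonglongrightarrow> \<mu>" and \<mu>: "\<mu> \<noteq> 0"
  shows "degree p = d" "lead_coeff p = \<mu>"
proof -
  have p: "p \<noteq> 0" using assms LIMSEQ_const_iff[of 0 \<mu>] by auto
  have eq: "\<forall>\<^sub>F k in sequentially. poly p (real k) / real k ^ i * (real k ^ i / real k ^ j) = poly p (real k) / real k ^ j" for i j
    using eventually_gt_at_top[of 0] by eventually_elim simp
  show d: "degree p = d"
  proof (rule linorder_cases)
    assume "degree p < d"
    then have "(\<lambda>k. poly p (real k) / real k ^ degree p * (real k ^ degree p / real k ^ d)) \<longlonglongrightarrow> lead_coeff p * 0"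
      by (intro tendsto_mult tendsto_poly_quotient tendsto_power_quotient)
    then have "(\<lambda>k. poly p (real k) / real k ^ d) \<longlonglongrightarrow> 0" using Lim_transform_eventually[OF _ eq] by simp
    then show ?thesis using LIMSEQ_unique[OF lim] \<mu> by blast
  next
    assume "d < degree p"
    then have "(\<lambda>k. poly p (real k) / real k ^ d * (real k ^ d / real k ^ degree p)) \<longlonglongrightarrow> \<mu> * 0"
      by (intro tendsto_mult lim tendsto_power_quotient)
    then have "(\<lambda>k. poly p (real k) / real k ^ degree p) \<longlonglongrightarrow> 0" using Lim_transform_eventually[OF _ eq] by simp
    then have "lead_coeff p = 0" using LIMSEQ_unique[OF tendsto_poly_quotient] by blast
    then show ?thesis using p by simp
  qed
  show "lead_coeff p = \<mu>" using LIMSEQ_unique[OF tendsto_poly_quotient] lim d by blast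
qed

text \<open>The shift by m is negligible, as m / k tends to 0; so p(k) / k^d is squeezed to \<mu>,
  which determines degree and leading coefficient because \<mu> is nonzero.\<close>

lemma poly_sandwich:
  assumes le: "\<And>k. 0 < k \<Longrightarrow> poly p (real k) \<le> real (k + m) ^ d * \<mu>"
    and ge: "\<And>k. 0 < k \<Longrightarrow> real k ^ d * \<mu> \<le> poly p (real (k + m))" and \<mu>: "\<mu> \<noteq> 0"
  shows "degree p = d" "lead_coeff p = \<mu>"
proof -
  have 1: "(\<lambda>k. real m / real k) \<longlonglongrightarrow> 0" by (rule lim_const_over_n)
  have "(\<lambda>k. poly p (real k) / real k ^ d) \<longlonglongrightarrow> \<mu>"
  proof (rule tendsto_sandwich)
    show "\<forall>\<^sub>F k in sequentially. (1 - real m / real k) ^ d * \<mu> \<le> poly p (real k) / real k ^ d"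
      using eventually_gt_at_top[of m]
    proof eventually_elim
      case (elim k)
      have "real (k - m) ^ d * \<mu> \<le> poly p (real k)" using ge[of "k - m"] elim by simp
      moreover have "real (k - m) = (1 - real m / real k) * real k" using elim by (simp add: field_simps of_nat_diff)
      ultimately have "(1 - real m / real k) ^ d * \<mu> * real k ^ d \<le> poly p (real k)"
        by (simp only: power_mult_distrib mult_ac)
      then show ?case using elim by (simp add: pos_le_divide_eq)
    qed
    show "\<forall>\<^sub>F k in sequentially. poly p (real k) / real k ^ d \<le> (1 + real m / real k) ^ d * \<mu>"
      using eventually_gt_at_top[of 0]
    proof eventually_elim
      case (elim k)
      have "real (k + m) = (1 + real m / real k) * real k" using elim by (simp add: field_simps)
      then have "poly p (real k) \<le> (1 + real m / real k) ^ d * \<mu> * real k ^ d"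
        using le[of k] elim by (simp only: power_mult_distrib mult_ac)
      then show ?case using elim by (simp add: pos_divide_le_eq)
    qed
    have "(\<lambda>k. (1 - real m / real k) ^ d * \<mu>) \<longlonglongrightarrow> (1 - 0) ^ d * \<mu>"
      by (intro tendsto_intros 1)
    then show "(\<lambda>k. (1 - real m / real k) ^ d * \<mu>) \<longlonglongrightarrow> \<mu>" by simp
    have "(\<lambda>k. (1 + real m / real k) ^ d * \<mu>) \<longlonglongrightarrow> (1 + 0) ^ d * \<mu>"
      by (intro tendsto_intros 1)
    then show "(\<lambda>k. (1 + real m / real k) ^ d * \<mu>) \<longlonglongrightarrow> \<mu>" by simp
  qed
  from poly_leading_term[OF this \<mu>] show "degree p = d" "lead_coeff p = \<mu>" .
qed

section \<open>Dilates of convex sets and grid cubes\<close>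

lemma convex_dilate_add:
  fixes P :: "(nat \<Rightarrow> real) set"
  assumes "convex P" "x \<in> (\<lambda>x. real j *\<^sub>R x) ` P" "y \<in> (\<lambda>x. real k *\<^sub>R x) ` P" "0 < j + k"
  shows "x + y \<in> (\<lambda>x. real (j + k) *\<^sub>R x) ` P"
proof -
  obtain u v where uv: "u \<in> P" "x = real j *\<^sub>R u" "v \<in> P" "y = real k *\<^sub>R v" using assms by blast
  define w where "w = (real j / real (j + k)) *\<^sub>R u + (real k / real (j + k)) *\<^sub>R v"
  have "w \<in> P" unfolding w_def
    using assms(1,4) uv by (intro convexD) (auto simp flip: add_divide_distrib)
  moreover have "x + y = real (j + k) *\<^sub>R w"
  proof (rule ext)
    fix i
    have "real (j + k) \<noteq> 0" unfolding of_nat_eq_0_iff using assms(4) by simp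
    then show "(x + y) i = (real (j + k) *\<^sub>R w) i"
      by (simp add: uv w_def scaleR_fun_def distrib_left del: of_nat_add)
  qed
  ultimately show ?thesis by blast
qed

lemma measure_grid_cube:
  assumes "0 < k"
  shows "emeasure (Pi\<^sub>M {..<d} (\<lambda>_. lborel)) (\<Pi>\<^sub>E j\<in>{..<d}. {of_int (c j) / real k..<(of_int (c j) + 1) / real k}) = ennreal (1 / real k ^ d)"
    "(\<Pi>\<^sub>E j\<in>{..<d}. {of_int (c j) / real k..<(of_int (c j) + 1) / real k}) \<in> sets (Pi\<^sub>M {..<d} (\<lambda>_. lborel))"
proof -
  interpret product_sigma_finite "\<lambda>_::nat. lborel :: real measure" by standard
  have "emeasure (Pi\<^sub>M {..<d} (\<lambda>_. lborel)) (\<Pi>\<^sub>E j\<in>{..<d}. {of_int (c j) / real k..<(of_int (c j) + 1) / real k}) =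
    (\<Prod>j<d. emeasure lborel {of_int (c j) / real k..<(of_int (c j) + 1) / real k})"
    by (rule emeasure_PiM) auto
  also have "\<dots> = (\<Prod>j<d. ennreal (1 / real k))"
  proof (rule prod.cong[OF refl])
    fix j
    have "(of_int (c j) + 1) / real k - of_int (c j) / real k = 1 / real k" by (simp add: add_divide_distrib)
    then show "emeasure lborel {of_int (c j) / real k..<(of_int (c j) + 1) / real k} = ennreal (1 / real k)"
      by (subst emeasure_lborel_Ico) (simp_all add: divide_right_mono)
  qed
  also have "\<dots> = ennreal (1 / real k ^ d)" by (simp add: ennreal_power power_divide)
  finally show "emeasure (Pi\<^sub>M {..<d} (\<lambda>_. lborel)) (\<Pi>\<^sub>E j\<in>{..<d}. {of_int (c j) / real k..<(of_int (c j) + 1) / real k}) = ennreal (1 / real k ^ d)" .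
  show "(\<Pi>\<^sub>E j\<in>{..<d}. {of_int (c j) / real k..<(of_int (c j) + 1) / real k}) \<in> sets (Pi\<^sub>M {..<d} (\<lambda>_. lborel))"
    by (rule sets_PiM_I_finite) auto
qed

lemma in_grid_cube_iff:
  assumes "0 < k"
  shows "t \<in> (\<Pi>\<^sub>E j\<in>{..<d}. {of_int (c j) / real k..<(of_int (c j) + 1) / real k}) \<longleftrightarrow>
    t \<in> extensional {..<d} \<and> (\<forall>j<d. \<lfloor>real k * t j\<rfloor> = c j)"
proof -
  have "t j \<in> {of_int (c j) / real k..<(of_int (c j) + 1) / real k} \<longleftrightarrow> \<lfloor>real k * t j\<rfloor> = c j" for j
    using assms by (simp add: floor_eq_iff pos_divide_le_eq pos_less_divide_eq mult.commute)
  then show ?thesis unfolding PiE_iff by (auto simp only: lessThan_iff)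
qed

text \<open>In coordinates with respect to a point a of S and a basis of the direction lattice,
  lattice points of dilates are integer vectors and the polytope is a set Q. A fixed dilate m P
  contains a box of radius 1 centred at a lattice point, so k P plus this box lies in (k + m) P.
  This absorbs the rounding error in both directions and bounds the count at k above and the count
  at k + m below by volumes of Q.\<close>

theorem ehrhart_leading_coefficient:
  assumes fin: "finite S" and ne: "S \<noteq> {}" and int: "S \<subseteq> integer_points"
    and supp: "\<And>x i. x \<in> S \<Longrightarrow> i \<notin> {1..n} \<Longrightarrow> x i = 0" and P: "P = convex hull S"
    and meas: "\<And>(d :: nat) a b. {t \<in> {..<d} \<rightarrow>\<^sub>E UNIV. a + (\<Sum>j<d. t j *\<^sub>R b j) \<in> P} \<in> sets (Pi\<^sub>M {..<d} (\<lambda>_. lborel))"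
    and p: "is_ehrhart_poly P p"
  shows "degree p \<le> n" "has_normalized_volume P (lead_coeff p)"
proof -
  obtain a where a: "a \<in> S" using ne by blast
  have SP: "S \<subseteq> P" unfolding P by (rule hull_subset)
  have aP: "a \<in> P" using a SP by blast
  have cP: "convex P" unfolding P by (rule convex_convex_hull)
  define L where "L = direction_lattice P"
  have Psupp: "x i = 0" if "x \<in> P" "i \<notin> {1..n}" for x i
  proof -
    have "convex {x :: nat \<Rightarrow> real. x i = 0}" by (auto simp: convex_def scaleR_fun_def)
    then have "P \<subseteq> {x. x i = 0}" unfolding P using supp that by (intro hull_minimal) auto
    then show ?thesis using that by blast
  qed
  define R where "R = (\<Sum>s\<in>S. \<Sum>i\<in>{1..n}. \<bar>s i\<bar>)"
  have Pbound: "\<bar>x i\<bar> \<le> R" if "x \<in> P" for x i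
  proof -
    have "\<bar>s i\<bar> \<le> R" if s: "s \<in> S" for s
    proof -
      have "\<bar>s i\<bar> \<le> (\<Sum>i\<in>{1..n}. \<bar>s i\<bar>)"
      proof (cases "i \<in> {1..n}")
        case True then show ?thesis by (intro member_le_sum) auto
      next
        case False then show ?thesis using supp[OF s False] by (simp add: sum_nonneg)
      qed
      also have "\<dots> \<le> R" unfolding R_def using fin s by (intro member_le_sum[where f = "\<lambda>s. \<Sum>i\<in>{1..n}. \<bar>s i\<bar>"]) (auto intro: sum_nonneg)
      finally show ?thesis .
    qed
    moreover have "convex {x :: nat \<Rightarrow> real. \<bar>x i\<bar> \<le> R}"
    proof (rule convexI)
      fix x y :: "nat \<Rightarrow> real" and u v :: real
      assume "x \<in> {x. \<bar>x i\<bar> \<le> R}" "y \<in> {x. \<bar>x i\<bar> \<le> R}" and uv: "0 \<le> u" "0 \<le> v" "u + v = 1"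
      then have "u * \<bar>x i\<bar> \<le> u * R" "v * \<bar>y i\<bar> \<le> v * R" by (auto intro: mult_left_mono)
      moreover have "\<bar>u * x i + v * y i\<bar> \<le> u * \<bar>x i\<bar> + v * \<bar>y i\<bar>"
        using abs_triangle_ineq[of "u * x i" "v * y i"] uv by (simp add: abs_mult)
      moreover have "u * R + v * R = R" using uv by (simp flip: distrib_right)
      ultimately show "u *\<^sub>R x + v *\<^sub>R y \<in> {x. \<bar>x i\<bar> \<le> R}" by (simp add: scaleR_fun_def)
    qed
    ultimately have "P \<subseteq> {x. \<bar>x i\<bar> \<le> R}" unfolding P by (intro hull_minimal) auto
    then show ?thesis using that by blast
  qed
  let ?D = "{x - y | x y. x \<in> P \<and> y \<in> P}"
  have Dsupp: "x i = 0" if "x \<in> span ?D" "i \<notin> {1..n}" for x i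
    by (rule span_vanish[OF that(1)]) (auto simp: Psupp[OF _ that(2)])
  obtain d b where d: "d \<le> n" and b: "lattice_basis d b L"
  proof -
    have "\<exists>d b. d \<le> n \<and> lattice_basis d b L"
    proof (rule lattice_basis_exists)
      show "0 \<in> L" unfolding L_def direction_lattice_def
        by (intro IntI span_zero) (simp add: integer_points_def)
      show "x - y \<in> L" if "x \<in> L" "y \<in> L" for x y
        using that span_diff[of x ?D y] unfolding L_def direction_lattice_def integer_points_def by simp
    qed (use Dsupp in \<open>unfold L_def direction_lattice_def, blast+\<close>)
    then show thesis using that by blast
  qed
  define comb where "comb t = (\<Sum>j<d. t j *\<^sub>R b j)" for t
  have comb_apply: "comb t i = (\<Sum>j<d. t j * b j i)" for t i
    by (simp add: comb_def sum_fun_apply scaleR_fun_def)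
  have comb_add: "comb t + comb u = comb (\<lambda>j. t j + u j)" for t u
    by (rule ext) (simp add: comb_apply sum.distrib distrib_right)
  have comb_cong: "comb t = comb u" if "\<And>j. j < d \<Longrightarrow> t j = u j" for t u
    unfolding comb_def by (intro sum.cong) (use that in auto)
  have Lmem: "x \<in> L \<longleftrightarrow> (\<exists>c :: nat \<Rightarrow> int. x = comb (\<lambda>j. of_int (c j)))" for x
    unfolding comb_def by (rule lattice_basis_mem[OF b])
  have comb_inj: "t j = u j" if eq: "comb t = comb u" and j: "j < d" for t u j
  proof -
    have inj: "inj_on b {..<d}" and ind: "independent (b ` {..<d})" using b unfolding lattice_basis_def by blast+
    define g where "g v = t (the_inv_into {..<d} b v) - u (the_inv_into {..<d} b v)" for v
    have gb: "g (b i) = t i - u i" if "i < d" for i using inj that by (simp add: g_def the_inv_into_f_f)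
    have "(\<Sum>v\<in>b ` {..<d}. g v *\<^sub>R v) = (\<Sum>i<d. g (b i) *\<^sub>R b i)"
      by (simp add: sum.reindex[OF inj])
    also have "\<dots> = comb (\<lambda>i. t i - u i)" unfolding comb_def by (intro sum.cong) (auto simp: gb)
    also have "\<dots> = comb t - comb u" by (rule ext) (simp add: comb_apply sum_subtractf left_diff_distrib)
    also have "\<dots> = 0" using eq by simp
    finally have "g (b j) = 0" using independentD[OF ind, of "b ` {..<d}" g "b j"] j by blast
    then show ?thesis using gb[OF j] by simp
  qed
  have spanS: "x - a \<in> span ((\<lambda>s. s - a) ` S)" if "x \<in> P" for x
  proof -
    let ?V = "span ((\<lambda>s. s - a) ` S)"
    have "convex {x. x - a \<in> ?V}"
    proof (rule convexI)
      fix x y and u v :: real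
      assume xy: "x \<in> {x. x - a \<in> ?V}" "y \<in> {x. x - a \<in> ?V}" and uv: "u + v = 1"
      have "u *\<^sub>R (x - a) + v *\<^sub>R (y - a) \<in> ?V" using xy by (intro span_add span_scale) auto
      moreover have "u *\<^sub>R (x - a) + v *\<^sub>R (y - a) = u *\<^sub>R x + v *\<^sub>R y - a"
      proof (rule ext)
        fix i
        have "u * a i + v * a i = a i" using uv by (simp flip: distrib_right)
        then show "(u *\<^sub>R (x - a) + v *\<^sub>R (y - a)) i = (u *\<^sub>R x + v *\<^sub>R y - a) i"
          by (simp add: scaleR_fun_def right_diff_distrib)
      qed
      ultimately show "u *\<^sub>R x + v *\<^sub>R y \<in> {x. x - a \<in> ?V}" unfolding mem_Collect_eq by (simp only:)
    qed
    then have "P \<subseteq> {x. x - a \<in> ?V}" unfolding P by (intro hull_minimal) (auto intro: span_base)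
    then show ?thesis using that by blast
  qed
  \<comment> \<open>Directions of the affine hull are combinations of the points of S with weights
    of total 0, which can later be added to convex weights.\<close>
  have "\<exists>l. b j = (\<Sum>s\<in>S. l s *\<^sub>R s) \<and> sum l S = 0" if j: "j < d" for j
  proof -
    let ?V = "span ((\<lambda>s. s - a) ` S)"
    have "?D \<subseteq> ?V"
    proof
      fix z assume "z \<in> ?D"
      then obtain x y where xy: "x \<in> P" "y \<in> P" "z = x - y" by blast
      have "(x - a) - (y - a) \<in> ?V" by (rule span_diff[OF spanS[OF xy(1)] spanS[OF xy(2)]])
      moreover have "(x - a) - (y - a) = x - y" by (rule ext) simp
      ultimately show "z \<in> ?V" using xy(3) by (simp only:)
    qed
    then have "span ?D \<subseteq> ?V" by (rule span_minimal) (rule subspace_span)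
    moreover have "b j \<in> L"
    proof -
      have "b j = comb (\<lambda>i. of_int (if i = j then 1 else 0))"
        using j by (intro ext) (simp add: comb_apply if_distrib[of of_int] if_distrib[of "\<lambda>x. x * _"] cong: if_cong)
      then show ?thesis unfolding Lmem by (rule exI[where x = "\<lambda>i. if i = j then 1 else 0"])
    qed
    ultimately have "b j \<in> ?V" unfolding L_def direction_lattice_def by blast
    then obtain u where u: "b j = (\<Sum>v\<in>(\<lambda>s. s - a) ` S. u v *\<^sub>R v)"
      unfolding span_finite[OF finite_imageI[OF fin]] by blast
    have inj: "inj_on (\<lambda>s. s - a) S" by (auto simp: inj_on_def)
    \<comment> \<open>The weight of a takes up minus the total of the others; the vector a - a is 0,
      so its own coefficient u (a - a) is arbitrary.\<close>
    define l where "l s = (if s = a then u (a - a) - (\<Sum>s\<in>S. u (s - a)) else u (s - a))" for s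
    have l: "l s = u (s - a) - (if s = a then \<Sum>s\<in>S. u (s - a) else 0)" for s by (simp add: l_def)
    have "sum l S = 0" unfolding l sum_subtractf using fin a by simp
    moreover have "b j = (\<Sum>s\<in>S. l s *\<^sub>R s)"
    proof (rule ext)
      fix i
      have "b j i = (\<Sum>s\<in>S. u (s - a) * (s i - a i))"
        unfolding u sum.reindex[OF inj] by (simp add: sum_fun_apply scaleR_fun_def)
      also have "\<dots> = (\<Sum>s\<in>S. u (s - a) * s i) - (\<Sum>s\<in>S. u (s - a)) * a i"
        by (simp add: right_diff_distrib sum_subtractf sum_distrib_right)
      also have "(\<Sum>s\<in>S. u (s - a)) * a i = (\<Sum>s\<in>S. (if s = a then \<Sum>s\<in>S. u (s - a) else 0) * s i)"
        using fin a by (simp add: if_distrib[of "\<lambda>x. x * _"] cong: if_cong)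
      finally show "b j i = (\<Sum>s\<in>S. l s *\<^sub>R s) i"
        by (simp only: sum_fun_apply scaleR_fun_def real_scaleR_def l left_diff_distrib sum_subtractf)
    qed
    ultimately show ?thesis by blast
  qed
  then obtain l where l: "\<And>j. j < d \<Longrightarrow> b j = (\<Sum>s\<in>S. l j s *\<^sub>R s)" "\<And>j. j < d \<Longrightarrow> sum (l j) S = 0"
    by metis
  define N where "N = card S"
  have N: "0 < N" using fin ne by (simp add: N_def card_gt_0_iff)
  obtain M :: nat where M: "0 < M" "(\<Sum>j<d. \<Sum>s\<in>S. \<bar>l j s\<bar>) \<le> real M"
  proof -
    obtain M0 :: nat where "(\<Sum>j<d. \<Sum>s\<in>S. \<bar>l j s\<bar>) \<le> real M0" using real_arch_simple by blast
    then show thesis using that[of "Suc M0"] by simp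
  qed
  \<comment> \<open>In the m-th dilate, M times the sum of S has weight M on each point of S. Adding
    \<open>comb u\<close> with all |u j| <= 1 alters each weight by at most M, so all weights stay
    nonnegative.\<close>
  define m where "m = N * M"
  have m: "0 < m" using N M by (simp add: m_def)
  have inner: "(\<lambda>i. real M * (\<Sum>s\<in>S. s i)) + comb u \<in> (\<lambda>x. real m *\<^sub>R x) ` P" if u: "\<And>j. j < d \<Longrightarrow> \<bar>u j\<bar> \<le> 1" for u
  proof -
    define c where "c s = 1 / real N + (\<Sum>j<d. u j * l j s) / real m" for s
    have "0 \<le> c s" if s: "s \<in> S" for s
    proof -
      have "\<bar>\<Sum>j<d. u j * l j s\<bar> \<le> (\<Sum>j<d. \<bar>u j * l j s\<bar>)" by (rule sum_abs)
      also have "\<dots> \<le> (\<Sum>j<d. \<Sum>s\<in>S. \<bar>l j s\<bar>)"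
      proof (rule sum_mono)
        fix j assume "j \<in> {..<d}"
        then have "\<bar>u j * l j s\<bar> \<le> \<bar>l j s\<bar>" using u[of j] by (simp add: abs_mult mult_left_le_one_le)
        also have "\<dots> \<le> (\<Sum>s\<in>S. \<bar>l j s\<bar>)" using fin s by (intro member_le_sum) auto
        finally show "\<bar>u j * l j s\<bar> \<le> (\<Sum>s\<in>S. \<bar>l j s\<bar>)" .
      qed
      finally have "\<bar>\<Sum>j<d. u j * l j s\<bar> \<le> real M" using M(2) by linarith
      then have "- real M / real m \<le> (\<Sum>j<d. u j * l j s) / real m" using m by (intro divide_right_mono) auto
      moreover have "real M / real m = 1 / real N" using N M by (simp add: m_def)
      ultimately show ?thesis unfolding c_def by simp
    qed
    moreover have "sum c S = 1"
    proof -
      have "(\<Sum>s\<in>S. \<Sum>j<d. u j * l j s) = (\<Sum>j<d. u j * sum (l j) S)"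
        by (subst sum.swap) (simp add: sum_distrib_left)
      also have "\<dots> = 0" using l(2) by simp
      finally have "(\<Sum>s\<in>S. (\<Sum>j<d. u j * l j s) / real m) = 0" by (simp flip: sum_divide_distrib)
      then show ?thesis using N by (simp add: c_def sum.distrib N_def)
    qed
    ultimately have "(\<Sum>s\<in>S. c s *\<^sub>R s) \<in> P" using fin SP by (intro convex_sum[OF _ cP]) auto
    moreover have "(\<lambda>i. real M * (\<Sum>s\<in>S. s i)) + comb u = real m *\<^sub>R (\<Sum>s\<in>S. c s *\<^sub>R s)"
    proof (rule ext)
      fix i
      have "comb u i = (\<Sum>j<d. u j * (\<Sum>s\<in>S. l j s * s i))"
        unfolding comb_apply by (intro sum.cong) (auto simp: l(1) sum_fun_apply scaleR_fun_def)
      also have "\<dots> = (\<Sum>s\<in>S. (\<Sum>j<d. u j * l j s) * s i)"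
        unfolding sum_distrib_left sum_distrib_right by (subst sum.swap) (simp add: mult.assoc)
      finally have 1: "comb u i = (\<Sum>s\<in>S. (\<Sum>j<d. u j * l j s) * s i)" .
      have "real m * c s = real M + (\<Sum>j<d. u j * l j s)" for s
        using m N by (simp add: c_def distrib_left) (simp add: m_def)
      then have "real m * (\<Sum>s\<in>S. c s * s i) = (\<Sum>s\<in>S. (real M + (\<Sum>j<d. u j * l j s)) * s i)"
        unfolding sum_distrib_left by (simp flip: mult.assoc)
      also have "\<dots> = real M * (\<Sum>s\<in>S. s i) + comb u i"
        unfolding 1 by (simp add: distrib_right sum.distrib sum_distrib_left)
      finally show "((\<lambda>i. real M * (\<Sum>s\<in>S. s i)) + comb u) i = (real m *\<^sub>R (\<Sum>s\<in>S. c s *\<^sub>R s)) i"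
        by (simp add: scaleR_fun_def sum_fun_apply)
    qed
    ultimately show ?thesis by blast
  qed
  have "(\<lambda>i. real M * (\<Sum>s\<in>S. s i)) - real m *\<^sub>R a \<in> L"
  proof -
    have "(\<lambda>i. real M * (\<Sum>s\<in>S. s i)) - real m *\<^sub>R a = real M *\<^sub>R (\<Sum>s\<in>S. s - a)"
      by (rule ext) (simp add: scaleR_fun_def sum_fun_apply sum_subtractf right_diff_distrib m_def N_def)
    moreover have "real M *\<^sub>R (\<Sum>s\<in>S. s - a) \<in> span ?D"
      using SP aP by (intro span_scale span_sum span_base) blast
    moreover have "((\<lambda>i. real M * (\<Sum>s\<in>S. s i)) - real m *\<^sub>R a) i \<in> \<int>" for i
    proof -
      have "s i \<in> \<int>" if "s \<in> S" for s using int that integer_pointsD by blast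
      then show ?thesis using a by (auto simp: scaleR_fun_def intro!: Ints_diff Ints_mult Ints_sum)
    qed
    ultimately show ?thesis unfolding L_def direction_lattice_def integer_points_def by simp
  qed
  \<comment> \<open>The centre of the box differs from m a by a lattice vector; its coordinates z
    shift all cubes below.\<close>
  then obtain z :: "nat \<Rightarrow> int" where z: "(\<lambda>i. real M * (\<Sum>s\<in>S. s i)) - real m *\<^sub>R a = comb (\<lambda>j. of_int (z j))"
    unfolding Lmem by blast
  have box: "real m *\<^sub>R a + comb (\<lambda>j. of_int (z j) + u j) \<in> (\<lambda>x. real m *\<^sub>R x) ` P" if "\<And>j. j < d \<Longrightarrow> \<bar>u j\<bar> \<le> 1" for u
  proof -
    have "real m *\<^sub>R a + comb (\<lambda>j. of_int (z j) + u j) = (\<lambda>i. real M * (\<Sum>s\<in>S. s i)) + comb u"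
      unfolding comb_add[symmetric] z[symmetric] by (rule ext) simp
    then show ?thesis using inner[of u] that by (simp only:)
  qed
  define C where "C k = {c \<in> {..<d} \<rightarrow>\<^sub>E (UNIV :: int set). real k *\<^sub>R a + comb (\<lambda>j. of_int (c j)) \<in> (\<lambda>x. real k *\<^sub>R x) ` P}" for k
  have C: "bij_betw (\<lambda>c. real k *\<^sub>R a + comb (\<lambda>j. of_int (c j))) (C k) ((\<lambda>x. real k *\<^sub>R x) ` P \<inter> integer_points)" for k
    unfolding bij_betw_def
  proof
    show "inj_on (\<lambda>c. real k *\<^sub>R a + comb (\<lambda>j. of_int (c j))) (C k)"
    proof (rule inj_onI)
      fix c c' assume cc: "c \<in> C k" "c' \<in> C k" and "real k *\<^sub>R a + comb (\<lambda>j. of_int (c j)) = real k *\<^sub>R a + comb (\<lambda>j. of_int (c' j))"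
      then have eq: "comb (\<lambda>j. of_int (c j)) = comb (\<lambda>j. of_int (c' j))" by (simp only: add_left_cancel)
      have "c j = c' j" if "j < d" for j using comb_inj[OF eq that] by simp
      then show "c = c'" using cc by (intro extensionalityI[of c "{..<d}" c']) (auto simp: C_def PiE_def)
    qed
    show "(\<lambda>c. real k *\<^sub>R a + comb (\<lambda>j. of_int (c j))) ` C k = (\<lambda>x. real k *\<^sub>R x) ` P \<inter> integer_points"
    proof (intro equalityI subsetI)
      fix y assume "y \<in> (\<lambda>c. real k *\<^sub>R a + comb (\<lambda>j. of_int (c j))) ` C k"
      then obtain c where c: "c \<in> C k" "y = real k *\<^sub>R a + comb (\<lambda>j. of_int (c j))" by blast
      have "comb (\<lambda>j. of_int (c j)) \<in> L" unfolding Lmem by blast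
      then have "comb (\<lambda>j. of_int (c j)) \<in> integer_points" unfolding L_def direction_lattice_def by blast
      then have "y \<in> integer_points" using c(2) a int
        by (auto simp: integer_points_def scaleR_fun_def intro!: Ints_add Ints_mult)
      then show "y \<in> (\<lambda>x. real k *\<^sub>R x) ` P \<inter> integer_points" using c unfolding C_def by blast
    next
      fix y assume y: "y \<in> (\<lambda>x. real k *\<^sub>R x) ` P \<inter> integer_points"
      then obtain x where x: "x \<in> P" "y = real k *\<^sub>R x" by blast
      have "y - real k *\<^sub>R a = real k *\<^sub>R (x - a)" unfolding x by (rule ext) (simp add: scaleR_fun_def right_diff_distrib)
      moreover have "real k *\<^sub>R (x - a) \<in> span ?D" using x aP by (intro span_scale span_base) blast
      moreover have "y - real k *\<^sub>R a \<in> integer_points" using y a int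
        by (auto simp: integer_points_def scaleR_fun_def intro!: Ints_diff Ints_mult)
      ultimately have "y - real k *\<^sub>R a \<in> L" unfolding L_def direction_lattice_def by simp
      then obtain c :: "nat \<Rightarrow> int" where c: "y - real k *\<^sub>R a = comb (\<lambda>j. of_int (c j))" unfolding Lmem by blast
      define c' where "c' = restrict c {..<d}"
      have "comb (\<lambda>j. of_int (c' j)) = comb (\<lambda>j. of_int (c j))" by (rule comb_cong) (simp add: c'_def)
      then have "y = real k *\<^sub>R a + comb (\<lambda>j. of_int (c' j))" unfolding c[symmetric] by (metis add.commute diff_add_cancel)
      moreover from this have "c' \<in> C k" using y by (auto simp: C_def c'_def)
      ultimately show "y \<in> (\<lambda>c. real k *\<^sub>R a + comb (\<lambda>j. of_int (c j))) ` C k" by blast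
    qed
  qed
  have finC: "finite (C k)" for k
  proof -
    have "finite ((\<lambda>x. real k *\<^sub>R x) ` P \<inter> integer_points)"
    proof (rule finite_subset[OF _ finite_bounded_integer_points[of n "real k * R"]])
      show "(\<lambda>x. real k *\<^sub>R x) ` P \<inter> integer_points \<subseteq> {x \<in> integer_points. (\<forall>i. i \<notin> {1..n} \<longrightarrow> x i = 0) \<and> (\<forall>i. \<bar>x i\<bar> \<le> real k * R)}"
        using Psupp Pbound by (auto simp: scaleR_fun_def abs_mult intro!: mult_left_mono)
    qed
    then show ?thesis using bij_betw_finite[OF C] by blast
  qed
  have cardC: "poly p (real k) = real (card (C k))" if "0 < k" for k
    using p that bij_betw_same_card[OF C[of k]] by (simp add: is_ehrhart_poly_def ehrhart_count_def)
  define PM where "PM = (Pi\<^sub>M {..<d} (\<lambda>_. lborel) :: (nat \<Rightarrow> real) measure)"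
  define Q where "Q = {t \<in> {..<d} \<rightarrow>\<^sub>E UNIV. a + comb t \<in> P}"
  have Qm: "Q \<in> sets PM" unfolding Q_def PM_def comb_def by (rule meas)
  define cube :: "nat \<Rightarrow> (nat \<Rightarrow> int) \<Rightarrow> (nat \<Rightarrow> real) set" where
    "cube k c = (\<Pi>\<^sub>E j\<in>{..<d}. {of_int (c j) / real k..<(of_int (c j) + 1) / real k})" for k c
  have cube: "emeasure PM (cube k c) = ennreal (1 / real k ^ d)" "cube k c \<in> sets PM"
    "t \<in> cube k c \<longleftrightarrow> t \<in> extensional {..<d} \<and> (\<forall>j<d. \<lfloor>real k * t j\<rfloor> = c j)" if "0 < k" for k c t
    unfolding PM_def cube_def by (rule measure_grid_cube[OF that] in_grid_cube_iff[OF that])+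
  \<comment> \<open>Rounding the coordinates of k t down changes each by less than 1, which the box
    absorbs; so every cube of mesh 1 / k that meets Q is accounted for by a lattice point of the (k
    + m)-th dilate.\<close>
  have upper: "emeasure PM Q \<le> ennreal (poly p (real (k + m)) / real k ^ d)" if k: "0 < k" for k
  proof -
    have "Q \<subseteq> (\<Union>c\<in>C (k + m). cube k (\<lambda>j. c j - z j))"
    proof
      fix t assume t: "t \<in> Q"
      define c where "c = (\<lambda>j\<in>{..<d}. \<lfloor>real k * t j\<rfloor> + z j)"
      have cPi: "c \<in> {..<d} \<rightarrow>\<^sub>E UNIV" by (simp add: c_def)
      define u where "u j = of_int \<lfloor>real k * t j\<rfloor> - real k * t j" for j
      have abs: "\<bar>u j\<bar> \<le> 1" for j unfolding u_def by linarith
      have 1: "real m *\<^sub>R a + comb (\<lambda>j. of_int (z j) + u j) \<in> (\<lambda>x. real m *\<^sub>R x) ` P" by (rule box) (use abs in blast)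
      have "real k *\<^sub>R (a + comb t) \<in> (\<lambda>x. real k *\<^sub>R x) ` P" using t unfolding Q_def by blast
      from convex_dilate_add[OF cP this 1] have "real k *\<^sub>R (a + comb t) + (real m *\<^sub>R a + comb (\<lambda>j. of_int (z j) + u j)) \<in> (\<lambda>x. real (k + m) *\<^sub>R x) ` P"
        using k by simp
      also have "real k *\<^sub>R (a + comb t) + (real m *\<^sub>R a + comb (\<lambda>j. of_int (z j) + u j)) = real (k + m) *\<^sub>R a + comb (\<lambda>j. of_int (c j))"
        by (rule ext) (simp add: scaleR_fun_def comb_apply c_def u_def algebra_simps sum.distrib sum_distrib_left sum_subtractf)
      finally have "c \<in> C (k + m)" unfolding C_def using cPi by blast
      moreover have "t \<in> cube k (\<lambda>j. c j - z j)" using t unfolding cube(3)[OF k] by (auto simp: Q_def c_def PiE_def)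
      ultimately show "t \<in> (\<Union>c\<in>C (k + m). cube k (\<lambda>j. c j - z j))" by blast
    qed
    then have "emeasure PM Q \<le> emeasure PM (\<Union>c\<in>C (k + m). cube k (\<lambda>j. c j - z j))"
      using cube(2)[OF k] finC by (intro emeasure_mono sets.finite_UN) auto
    also have "\<dots> \<le> (\<Sum>c\<in>C (k + m). emeasure PM (cube k (\<lambda>j. c j - z j)))"
      using cube(2)[OF k] finC by (intro emeasure_subadditive_finite) auto
    also have "\<dots> = ennreal (real (card (C (k + m))) * (1 / real k ^ d))"
      by (simp add: cube(1)[OF k] ennreal_of_nat_eq_real_of_nat ennreal_mult''[symmetric])
    finally show ?thesis using cardC[of "k + m"] k by simp
  qed
  \<comment> \<open>Conversely, a lattice point of the k-th dilate, shifted by z, owns a cube of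
    mesh 1 / (k + m) inside Q, since the offset within the cube is covered by the box. Distinct
    lattice points own disjoint cubes.\<close>
  have lower: "ennreal (poly p (real k) / real (k + m) ^ d) \<le> emeasure PM Q" if k: "0 < k" for k
  proof -
    have km: "0 < k + m" using k by simp
    have sub: "(\<Union>c\<in>C k. cube (k + m) (\<lambda>j. c j + z j)) \<subseteq> Q"
    proof
      fix t assume "t \<in> (\<Union>c\<in>C k. cube (k + m) (\<lambda>j. c j + z j))"
      then obtain c where c: "c \<in> C k" and "t \<in> cube (k + m) (\<lambda>j. c j + z j)" by blast
      then have t: "t \<in> extensional {..<d}" "\<And>j. j < d \<Longrightarrow> \<lfloor>real (k + m) * t j\<rfloor> = c j + z j"
        unfolding cube(3)[OF km] by blast+
      define u where "u j = real (k + m) * t j - of_int (c j) - of_int (z j)" for j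
      have abs: "\<bar>u j\<bar> \<le> 1" if "j < d" for j unfolding u_def using t(2)[OF that] by linarith
      have 1: "real m *\<^sub>R a + comb (\<lambda>j. of_int (z j) + u j) \<in> (\<lambda>x. real m *\<^sub>R x) ` P" by (rule box) (use abs in blast)
      have "real k *\<^sub>R a + comb (\<lambda>j. of_int (c j)) \<in> (\<lambda>x. real k *\<^sub>R x) ` P" using c unfolding C_def by blast
      from convex_dilate_add[OF cP this 1] have "real k *\<^sub>R a + comb (\<lambda>j. of_int (c j)) + (real m *\<^sub>R a + comb (\<lambda>j. of_int (z j) + u j)) \<in> (\<lambda>x. real (k + m) *\<^sub>R x) ` P"
        using k by simp
      also have "real k *\<^sub>R a + comb (\<lambda>j. of_int (c j)) + (real m *\<^sub>R a + comb (\<lambda>j. of_int (z j) + u j)) = real (k + m) *\<^sub>R (a + comb t)"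
        by (rule ext) (simp add: scaleR_fun_def comb_apply u_def algebra_simps sum.distrib sum_distrib_left sum_subtractf)
      finally obtain x where x: "x \<in> P" "real (k + m) *\<^sub>R (a + comb t) = real (k + m) *\<^sub>R x" by blast
      then have "a + comb t = x" using km by (metis less_irrefl of_nat_0_less_iff scaleR_left_imp_eq)
      then show "t \<in> Q" unfolding Q_def using x(1) t(1) by (simp add: PiE_def)
    qed
    have disj: "disjoint_family_on (\<lambda>c. cube (k + m) (\<lambda>j. c j + z j)) (C k)"
    proof (unfold disjoint_family_on_def, intro ballI impI)
      fix c c' assume cc: "c \<in> C k" "c' \<in> C k" "c \<noteq> c'"
      show "cube (k + m) (\<lambda>j. c j + z j) \<inter> cube (k + m) (\<lambda>j. c' j + z j) = {}"
      proof (rule ccontr)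
        assume "cube (k + m) (\<lambda>j. c j + z j) \<inter> cube (k + m) (\<lambda>j. c' j + z j) \<noteq> {}"
        then obtain t where "t \<in> cube (k + m) (\<lambda>j. c j + z j)" "t \<in> cube (k + m) (\<lambda>j. c' j + z j)" by blast
        then have "c j = c' j" if "j < d" for j using that unfolding cube(3)[OF km] by force
        then have "c = c'" using cc by (intro extensionalityI[of c "{..<d}" c']) (auto simp: C_def PiE_def)
        then show False using cc by simp
      qed
    qed
    have "ennreal (poly p (real k) / real (k + m) ^ d) = (\<Sum>c\<in>C k. emeasure PM (cube (k + m) (\<lambda>j. c j + z j)))"
      using cardC[OF k] by (simp add: cube(1)[OF km] ennreal_of_nat_eq_real_of_nat ennreal_mult''[symmetric])
    also have "\<dots> = emeasure PM (\<Union>c\<in>C k. cube (k + m) (\<lambda>j. c j + z j))"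
      using cube(2)[OF km] by (intro sum_emeasure finC disj) auto
    also have "\<dots> \<le> emeasure PM Q" by (rule emeasure_mono[OF sub Qm])
    finally show ?thesis .
  qed
  define \<mu> where "\<mu> = measure PM Q"
  have finQ: "emeasure PM Q = ennreal \<mu>"
  proof -
    have "emeasure PM Q < \<infinity>" using upper[of 1] by (auto intro: le_less_trans)
    then show ?thesis unfolding \<mu>_def by (simp add: emeasure_eq_ennreal_measure less_top)
  qed
  have \<mu>0: "0 \<le> \<mu>" by (simp add: \<mu>_def)
  have pnn: "0 \<le> poly p (real k)" for k using p by (simp add: is_ehrhart_poly_def)
  have le: "poly p (real k) \<le> real (k + m) ^ d * \<mu>" if k: "0 < k" for k
  proof -
    have "poly p (real k) / real (k + m) ^ d \<le> \<mu>" using lower[OF k] \<mu>0 unfolding finQ by simp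
    then show ?thesis using k by (simp add: pos_divide_le_eq mult.commute)
  qed
  have ge: "real k ^ d * \<mu> \<le> poly p (real (k + m))" if k: "0 < k" for k
  proof -
    have "\<mu> \<le> poly p (real (k + m)) / real k ^ d" using upper[OF k] pnn[of "k + m"] unfolding finQ by (simp add: ennreal_le_iff)
    then show ?thesis using k by (simp add: pos_le_divide_eq mult.commute)
  qed
  \<comment> \<open>Otherwise the first dilate would contain no lattice point, but it contains
    a.\<close>
  have \<mu>1: "\<mu> \<noteq> 0"
  proof
    assume "\<mu> = 0"
    then have "poly p (real 1) \<le> 0" using le[of 1] by simp
    moreover have "restrict (\<lambda>_. 0) {..<d} \<in> C 1"
    proof -
      have "comb (\<lambda>j. of_int (restrict (\<lambda>_. 0) {..<d} j)) = 0" by (rule ext) (simp add: comb_apply)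
      then show ?thesis using aP unfolding C_def by (simp add: image_iff)
    qed
    moreover from this have "0 < card (C 1)" using finC[of 1] by (auto simp: card_gt_0_iff)
    ultimately show False using cardC[of 1] by simp
  qed
  have "degree p = d" "lead_coeff p = \<mu>" by (rule poly_sandwich[OF le ge \<mu>1]; assumption)+
  then show "degree p \<le> n" "has_normalized_volume P (lead_coeff p)"
    using d aP b unfolding has_normalized_volume_def L_def \<mu>_def PM_def Q_def comb_def by blast+
qed

section \<open>Interpolation\<close>

text \<open>The rising factorial of b divided by s!; the division is exact. This form is a quotient
  of two loops and needs no special treatment of b = 0.\<close>

definition ways_int :: "int \<Rightarrow> int \<Rightarrow> int"
  where "ways_int b s = (\<Prod>i\<in>{0..<s}. b + i) div (\<Prod>i\<in>{0..<s}. 1 + i)"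

lemma prod_Suc_fact: "(\<Prod>i<s. 1 + int i) = fact s"
  by (induction s) simp_all

lemma ways_pochhammer: "real (ways b s) * fact s = pochhammer (real b) s"
proof (cases "s = 0")
  case False
  have "real (ways b s) = real (s + b - 1) gchoose s" by (simp add: ways_def binomial_gbinomial)
  also have "\<dots> = pochhammer (real (s + b - 1) - real s + 1) s / fact s" by (rule gbinomial_pochhammer')
  also have "real (s + b - 1) - real s + 1 = real b" using False by (simp add: of_nat_diff)
  finally show ?thesis by simp
qed (simp add: ways_def)

lemma ways_int_eq: "ways_int (int b) (int s) = int (ways b s)"
proof -
  have "real_of_int (\<Prod>i<s. int b + int i) = real_of_int (int (ways b s) * fact s)"
    using ways_pochhammer[of b s] by (simp add: pochhammer_prod atLeast0LessThan)
  then have "(\<Prod>i<s. int b + int i) = int (ways b s) * fact s" by (simp only: of_int_eq_iff)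
  then show ?thesis by (simp add: ways_int_def prod_int_lessThan prod_Suc_fact)
qed

lemma ways_binomial: "k \<le> n \<Longrightarrow> ways (n - k + 1) k = n choose k"
  by (simp add: ways_def)

lemma digit_extraction:
  fixes X :: int
  assumes "\<And>i. i < N \<Longrightarrow> 0 \<le> a i \<and> a i < X" "j < N"
  shows "(\<Sum>i<N. a i * X ^ i) div X ^ j mod X = a j"
  using assms
proof (induction N arbitrary: a j)
  case (Suc N)
  define S where "S = (\<Sum>i<N. a (Suc i) * X ^ i)"
  have X: "0 < X" using Suc.prems by force
  have sum: "(\<Sum>i<Suc N. a i * X ^ i) = a 0 + X * S"
    by (simp only: sum.lessThan_Suc_shift S_def sum_distrib_left) (simp add: mult_ac)
  have a0: "0 \<le> a 0" "a 0 < X" using Suc.prems(1)[of 0] by auto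
  show ?case
  proof (cases j)
    case 0
    then show ?thesis using a0 unfolding sum by simp
  next
    case (Suc i)
    have "(a 0 + X * S) div X ^ j = (a 0 + X * S) div X div X ^ i"
      using X by (simp add: Suc zdiv_zmult2_eq)
    also have "(a 0 + X * S) div X = S" using a0 X by simp
    also have "S div X ^ i mod X = a (Suc i)"
      unfolding S_def using Suc.prems \<open>j = Suc i\<close> by (intro Suc.IH) auto
    finally show ?thesis unfolding sum by (simp only: Suc)
  qed
qed simp

text \<open>This is n! times the interpolation polynomial at the nodes 0, ..., n. The product of k -
  j over the other nodes j is (-1)^(n-k) k! (n-k)!, so the weights turn into signed binomial
  coefficients and the polynomial is integral.\<close>

definition lagrange_poly :: "nat \<Rightarrow> (int \<Rightarrow> int) \<Rightarrow> int poly"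
  where "lagrange_poly n E = (\<Sum>k\<le>n. smult (E (int k) * (-1) ^ (n - k) * int (n choose k)) (\<Prod>j\<in>{..n} - {k}. [:- int j, 1:]))"

lemma prod_nodes:
  assumes "k \<le> n"
  shows "(\<Prod>j\<in>{..n} - {k}. int k - int j) = (-1) ^ (n - k) * fact k * fact (n - k)"
proof -
  have "(\<Prod>j\<in>{..n} - {k}. int k - int j) = (\<Prod>j\<in>{..<k} \<union> {k<..n}. int k - int j)"
    using assms by (intro prod.cong) auto
  also have "\<dots> = (\<Prod>j<k. int k - int j) * (\<Prod>j\<in>{k<..n}. int k - int j)"
    by (intro prod.union_disjoint) auto
  also have "(\<Prod>j<k. int k - int j) = (\<Prod>i<k. 1 + int i)"
    by (rule prod.reindex_bij_witness[of _ "\<lambda>i. k - 1 - i" "\<lambda>j. k - 1 - j"]) (auto simp: of_nat_diff)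
  also have "(\<Prod>j\<in>{k<..n}. int k - int j) = (\<Prod>i<n - k. - 1 * (1 + int i))"
    by (rule prod.reindex_bij_witness[of _ "\<lambda>i. k + 1 + i" "\<lambda>j. j - k - 1"]) (auto simp: of_nat_diff)
  also have "\<dots> = (-1) ^ (n - k) * (\<Prod>i<n - k. 1 + int i)"
    by (simp only: prod.distrib prod_constant card_lessThan)
  finally show ?thesis by (simp add: prod_Suc_fact)
qed

lemma degree_node_poly: "k \<le> n \<Longrightarrow> degree (\<Prod>j\<in>{..n} - {k}. [:- int j, 1:]) \<le> n"
  using degree_prod_sum_le[of "{..n} - {k}" "\<lambda>j. [:- int j, 1:]"] by simp

lemma degree_lagrange_poly: "degree (lagrange_poly n E) \<le> n"
  unfolding lagrange_poly_def
  by (intro degree_sum_le) (auto intro: order_trans[OF degree_smult_le degree_node_poly] simp del: degree_smult_eq)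

lemma poly_lagrange_node:
  assumes "k \<le> n"
  shows "poly (lagrange_poly n E) (int k) = E (int k) * fact n"
proof -
  let ?t = "\<lambda>i. E (int i) * (-1) ^ (n - i) * int (n choose i) * (\<Prod>j\<in>{..n} - {i}. int k - int j)"
  have "poly (lagrange_poly n E) (int k) = (\<Sum>i\<le>n. ?t i)"
    by (simp add: lagrange_poly_def poly_sum poly_prod)
  also have "\<dots> = (\<Sum>i\<in>{k}. ?t i)"
    using assms by (intro sum.mono_neutral_right) (auto simp: prod_zero_iff)
  also have "\<dots> = E (int k) * ((-1) ^ (n - k) * (-1) ^ (n - k)) * (fact k * fact (n - k) * int (n choose k))"
    using prod_nodes[OF assms] by simp
  also have "fact k * fact (n - k) * int (n choose k) = fact n"
    using binomial_fact_lemma[OF assms] by (metis of_nat_fact of_nat_mult)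
  also have "(-1) ^ (n - k) * (-1) ^ (n - k) = (1::int)" by (simp flip: power_mult_distrib)
  finally show ?thesis by simp
qed

lemma poly_map_of_int: "poly (map_poly of_int q) (of_int x) = (of_int (poly q x) :: real)"
  by (induction q) (simp_all add: map_poly_pCons)

lemma lagrange_interpolation:
  assumes deg: "degree p \<le> n" and p: "\<And>k. k \<le> n \<Longrightarrow> poly p (real k) = of_int (E (int k))"
  shows "of_int (coeff (lagrange_poly n E) i) = fact n * coeff p i"
proof -
  have "map_poly of_int (lagrange_poly n E) = smult (fact n) p"
  proof (rule poly_eqI_degree[of "real ` {..n}"])
    fix x assume "x \<in> real ` {..n}"
    then obtain k where k: "k \<le> n" "x = real k" by auto
    then show "poly (map_poly of_int (lagrange_poly n E)) x = poly (smult (fact n) p) x"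
      using poly_map_of_int[of "lagrange_poly n E" "int k"] poly_lagrange_node[OF k(1), of E] p[OF k(1)] by simp
  next
    have card: "card (real ` {..n}) = Suc n" by (simp add: card_image)
    show "degree (map_poly of_int (lagrange_poly n E) :: real poly) < card (real ` {..n})"
      using degree_lagrange_poly[of n E] by (simp add: card degree_map_poly)
    show "degree (smult (fact n) p) < card (real ` {..n})" using deg by (simp add: card)
  qed
  then have "coeff (map_poly real_of_int (lagrange_poly n E)) i = coeff (smult (fact n) p) i" by simp
  then show ?thesis by (simp add: coeff_map_poly)
qed

text \<open>Replacing the roots j by - j makes all coefficients nonnegative and dominates the
  original ones; the value at 1 then bounds each of them.\<close>

lemma node_poly_coeff_le: "finite J \<Longrightarrow> \<bar>coeff (\<Prod>j\<in>J. [:- int j, 1:]) i\<bar> \<le> (\<Prod>j\<in>J. 1 + int j)"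
proof (induction J arbitrary: i rule: finite_induct)
  case empty
  then show ?case by (cases i) auto
next
  case (insert a J)
  let ?q = "\<Prod>j\<in>J. [:- int j, 1:]" and ?B = "\<Prod>j\<in>J. 1 + int j"
  have c: "\<bar>coeff (pCons 0 ?q) i\<bar> \<le> ?B"
    using insert.IH by (cases i) (auto intro: prod_nonneg)
  have "(\<Prod>j\<in>insert a J. [:- int j, 1:]) = smult (- int a) ?q + pCons 0 ?q"
    using insert by simp
  then have "\<bar>coeff (\<Prod>j\<in>insert a J. [:- int j, 1:]) i\<bar> \<le> \<bar>int a * coeff ?q i\<bar> + \<bar>coeff (pCons 0 ?q) i\<bar>"
    by simp
  also have "\<dots> \<le> int a * ?B + ?B"
    using insert.IH[of i] c by (intro add_mono) (auto simp: abs_mult intro: mult_left_mono)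
  finally show ?case using insert by (simp add: algebra_simps)
qed

definition coeff_bound :: "nat \<Rightarrow> (int \<Rightarrow> int) \<Rightarrow> int"
  where "coeff_bound n E = 1 + (\<Sum>k\<in>{0..<int n + 1}. E k * ways_int (int n - k + 1) k *
    (\<Prod>j\<in>{0..<int n + 1}. if j = k then 1 else 1 + j))"

definition lagrange_value :: "nat \<Rightarrow> (int \<Rightarrow> int) \<Rightarrow> int \<Rightarrow> int"
  where "lagrange_value n E X = (\<Sum>k\<in>{0..<int n + 1}. E k * (\<Prod>j\<in>{0..<int n - k}. -1) *
    ways_int (int n - k + 1) k * (\<Prod>j\<in>{0..<int n + 1}. if j = k then 1 else X - j))"

text \<open>Kronecker substitution. With B = \<open>coeff_bound\<close> all coefficients lie
  strictly between -B and B. Adding B to each makes them digits in base 2 B, so the value at 2 B,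
  shifted by the number with all digits B, contains them all. Powers are written as products because
  their exponents vary.\<close>

definition numerator :: "nat \<Rightarrow> (int \<Rightarrow> int) \<Rightarrow> int \<Rightarrow> int"
  where "numerator n E i =
    ((lagrange_value n E (2 * coeff_bound n E) +
      coeff_bound n E * (\<Sum>l\<in>{0..<int n + 1}. \<Prod>j\<in>{0..<l}. 2 * coeff_bound n E)) div
     (\<Prod>j\<in>{0..<i}. 2 * coeff_bound n E)) mod (2 * coeff_bound n E) - coeff_bound n E"

definition denominator :: "nat \<Rightarrow> int"
  where "denominator n = (\<Prod>j\<in>{0..<int n}. 1 + j)"

text \<open>Counts the i below the degree: those above which some nonzero coefficient
  occurs.\<close>

definition output_degree :: "nat \<Rightarrow> (int \<Rightarrow> int) \<Rightarrow> int"
  where "output_degree n E = (\<Sum>i\<in>{0..<int n}. of_bool (\<exists>j\<in>{0..<int n}. i \<le> j \<and> numerator n E (j + 1) \<noteq> 0))"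

lemma prod_skip:
  fixes g :: "int \<Rightarrow> int"
  assumes "k \<le> n"
  shows "(\<Prod>j\<in>{0..<int n + 1}. if j = int k then 1 else g j) = (\<Prod>j\<in>{..n} - {k}. g (int j))"
proof -
  have n: "nat (int n + 1) = Suc n" by simp
  have "(\<Prod>j\<in>{0..<int n + 1}. if j = int k then 1 else g j) = (\<Prod>j\<le>n. if j = k then 1 else g (int j))"
    unfolding prod_int_lessThan n lessThan_Suc_atMost by simp
  also have "\<dots> = (\<Prod>j\<in>{..n} - {k}. if j = k then 1 else g (int j))"
    using assms by (simp add: prod.remove[of "{..n}" k])
  also have "\<dots> = (\<Prod>j\<in>{..n} - {k}. g (int j))" by (intro prod.cong) auto
  finally show ?thesis .
qed

lemma sum_to_n: "(\<Sum>k\<in>{0..<int n + 1}. g k) = (\<Sum>k\<le>n. g (int k))" for g :: "int \<Rightarrow> int"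
proof -
  have n: "nat (int n + 1) = Suc n" by simp
  show ?thesis unfolding sum_int_lessThan n lessThan_Suc_atMost ..
qed

lemma ways_int_binomial: "k \<le> n \<Longrightarrow> ways_int (int n - int k + 1) (int k) = int (n choose k)"
  using ways_int_eq[of "n - k + 1" k] ways_binomial[of k n] by (simp add: of_nat_diff add.commute)

lemma coeff_lagrange_less_bound:
  assumes "\<And>k. k \<le> n \<Longrightarrow> 0 \<le> E (int k)"
  shows "\<bar>coeff (lagrange_poly n E) i\<bar> < coeff_bound n E"
proof -
  have "\<bar>coeff (lagrange_poly n E) i\<bar> \<le> (\<Sum>k\<le>n. \<bar>E (int k) * (-1) ^ (n - k) * int (n choose k) * coeff (\<Prod>j\<in>{..n} - {k}. [:- int j, 1:]) i\<bar>)"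
    unfolding lagrange_poly_def coeff_sum coeff_smult by (rule sum_abs)
  also have "\<dots> \<le> (\<Sum>k\<le>n. E (int k) * int (n choose k) * (\<Prod>j\<in>{..n} - {k}. 1 + int j))"
  proof (rule sum_mono)
    fix k assume "k \<in> {..n}"
    then have E: "0 \<le> E (int k)" using assms by simp
    have "\<bar>E (int k) * (-1) ^ (n - k) * int (n choose k) * coeff (\<Prod>j\<in>{..n} - {k}. [:- int j, 1:]) i\<bar> =
      E (int k) * int (n choose k) * \<bar>coeff (\<Prod>j\<in>{..n} - {k}. [:- int j, 1:]) i\<bar>"
      using E by (simp add: abs_mult power_abs)
    also have "\<dots> \<le> E (int k) * int (n choose k) * (\<Prod>j\<in>{..n} - {k}. 1 + int j)"
      using E by (intro mult_left_mono node_poly_coeff_le) auto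
    finally show "\<bar>E (int k) * (-1) ^ (n - k) * int (n choose k) * coeff (\<Prod>j\<in>{..n} - {k}. [:- int j, 1:]) i\<bar>
      \<le> E (int k) * int (n choose k) * (\<Prod>j\<in>{..n} - {k}. 1 + int j)" .
  qed
  also have "\<dots> = coeff_bound n E - 1"
    unfolding coeff_bound_def sum_to_n by (auto simp: prod_skip ways_int_binomial intro!: sum.cong)
  finally show ?thesis by simp
qed

lemma lagrange_value_eq: "lagrange_value n E X = poly (lagrange_poly n E) X"
  unfolding lagrange_value_def lagrange_poly_def sum_to_n
  by (auto simp: prod_skip ways_int_binomial poly_sum poly_prod nat_diff_distrib intro!: sum.cong)

lemma numerator_eq:
  assumes E: "\<And>k. k \<le> n \<Longrightarrow> 0 \<le> E (int k)" and i: "i \<le> n"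
  shows "numerator n E (int i) = coeff (lagrange_poly n E) i"
proof -
  let ?B = "coeff_bound n E" and ?c = "coeff (lagrange_poly n E)"
  have "lagrange_value n E (2 * ?B) = (\<Sum>l<Suc n. ?c l * (2 * ?B) ^ l)"
    unfolding lagrange_value_eq lessThan_Suc_atMost poly_altdef
    using degree_lagrange_poly[of n E] by (intro sum.mono_neutral_left) (auto simp: coeff_eq_0)
  moreover have "(\<Sum>l\<in>{0..<int n + 1}. \<Prod>j\<in>{0..<l}. 2 * ?B) = (\<Sum>l<Suc n. (2 * ?B) ^ l)"
    unfolding sum_to_n lessThan_Suc_atMost by simp
  ultimately have "lagrange_value n E (2 * ?B) + ?B * (\<Sum>l\<in>{0..<int n + 1}. \<Prod>j\<in>{0..<l}. 2 * ?B) =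
    (\<Sum>l<Suc n. (?c l + ?B) * (2 * ?B) ^ l)"
    by (simp only: sum_distrib_left distrib_right sum.distrib)
  moreover have "(\<Sum>l<Suc n. (?c l + ?B) * (2 * ?B) ^ l) div (2 * ?B) ^ i mod (2 * ?B) = ?c i + ?B"
  proof (rule digit_extraction)
    fix l show "0 \<le> ?c l + ?B \<and> ?c l + ?B < 2 * ?B"
      using coeff_lagrange_less_bound[of n E, OF E, of l] by linarith
  qed (use i in simp)
  ultimately show ?thesis unfolding numerator_def by simp
qed

theorem interpolation_output:
  assumes deg: "degree p \<le> n" and p: "\<And>k. k \<le> n \<Longrightarrow> poly p (real k) = of_int (E (int k))"
    and E: "\<And>k. k \<le> n \<Longrightarrow> 0 \<le> E (int k)"
  shows "0 < denominator n" "i \<le> n \<Longrightarrow> coeff p i = of_int (numerator n E (int i)) / of_int (denominator n)"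
    "output_degree n E = int (degree p)"
proof -
  have den: "denominator n = fact n" by (simp add: denominator_def prod_int_lessThan prod_Suc_fact)
  then show "0 < denominator n" by simp
  have num: "coeff p i = of_int (numerator n E (int i)) / of_int (denominator n)" if "i \<le> n" for i
    using numerator_eq[of n E i] E that lagrange_interpolation[OF deg p, of i] by (simp add: den)
  then show "i \<le> n \<Longrightarrow> coeff p i = of_int (numerator n E (int i)) / of_int (denominator n)" .
  have nz: "numerator n E (int j + 1) \<noteq> 0 \<longleftrightarrow> coeff p (Suc j) \<noteq> 0" if "j < n" for j
    using num[of "Suc j"] that by (simp add: den add.commute)
  have "(\<exists>j\<in>{0..<int n}. int i \<le> j \<and> numerator n E (j + 1) \<noteq> 0) \<longleftrightarrow> i < degree p" (is "?L \<longleftrightarrow> _") for i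
  proof
    assume ?L
    then obtain j where j: "0 \<le> j" "j < int n" "int i \<le> j" "numerator n E (j + 1) \<noteq> 0" by auto
    then obtain j' where j': "j = int j'" using nonneg_int_cases by blast
    then have "coeff p (Suc j') \<noteq> 0" using j nz[of j'] by simp
    then have "Suc j' \<le> degree p" by (rule le_degree)
    then show "i < degree p" using j j' by simp
  next
    assume i: "i < degree p"
    then have "coeff p (Suc (degree p - 1)) \<noteq> 0" by (auto simp: leading_coeff_0_iff)
    then have "numerator n E (int (degree p - 1) + 1) \<noteq> 0" using i deg nz[of "degree p - 1"] by simp
    then show ?L using i deg by (intro bexI[of _ "int (degree p - 1)"]) auto
  qed
  then have "output_degree n E = (\<Sum>i<n. of_bool (i < degree p))"
    by (simp add: output_degree_def sum_int_lessThan)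
  also have "\<dots> = int (card {i \<in> {..<n}. i < degree p})" by (simp add: Int_def)
  also have "{i \<in> {..<n}. i < degree p} = {..<degree p}" using deg by auto
  finally show "output_degree n E = int (degree p)" by simp
qed

section \<open>Encoding flats by integers\<close>

text \<open>
  A flat is encoded by the base n + 2 digits of an integer below (n + 2) ^ r, which list a
  generating set (digits 0 and n + 1 are ignored); the whole ground set also has the code -1.
\<close>

definition in_code :: "nat \<Rightarrow> nat \<Rightarrow> int \<Rightarrow> int \<Rightarrow> bool"
  where "in_code n r t i \<longleftrightarrow> (\<exists>j\<in>{0..<int r}. t div (\<Prod>l\<in>{0..<j}. int n + 2) mod (int n + 2) = i)"

definition coded_set :: "nat \<Rightarrow> nat \<Rightarrow> int \<Rightarrow> nat set"
  where "coded_set n r t = {i \<in> {1..n}. in_code n r t (int i)}"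

definition in_flat :: "nat \<Rightarrow> (nat set \<Rightarrow> int) \<Rightarrow> nat \<Rightarrow> int \<Rightarrow> int \<Rightarrow> bool"
  where "in_flat n f r t i \<longleftrightarrow> t < 0 \<or>
    f {j \<in> {1..n}. int j = i \<or> in_code n r t (int j)} = f {j \<in> {1..n}. in_code n r t (int j)}"

definition coded_flat :: "nat \<Rightarrow> (nat set \<Rightarrow> int) \<Rightarrow> nat \<Rightarrow> int \<Rightarrow> nat set"
  where "coded_flat n f r t = {i \<in> {1..n}. in_flat n f r t (int i)}"

definition code_card :: "nat \<Rightarrow> (nat set \<Rightarrow> int) \<Rightarrow> nat \<Rightarrow> int \<Rightarrow> int"
  where "code_card n f r t = (\<Sum>i\<in>{0..<int n}. of_bool (in_flat n f r t (i + 1)))"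

definition code_less :: "nat \<Rightarrow> (nat set \<Rightarrow> int) \<Rightarrow> nat \<Rightarrow> int \<Rightarrow> int \<Rightarrow> bool"
  where "code_less n f r u t \<longleftrightarrow>
    (\<forall>i\<in>{0..<int n}. in_flat n f r u (i + 1) \<longrightarrow> in_flat n f r t (i + 1)) \<and> code_card n f r u < code_card n f r t"

text \<open>A flat has many codes; the least nonnegative one represents it, so that a sum over codes
  counts each flat once.\<close>

definition canonical :: "nat \<Rightarrow> (nat set \<Rightarrow> int) \<Rightarrow> nat \<Rightarrow> int \<Rightarrow> bool"
  where "canonical n f r t \<longleftrightarrow>
    (\<forall>u\<in>{0..<t}. \<not> (\<forall>i\<in>{0..<int n}. in_flat n f r u (i + 1) \<longleftrightarrow> in_flat n f r t (i + 1)))"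

text \<open>The integer form of \<open>signed_count\<close>, with codes in place of flats and all
  sums over intervals starting at 0. As u is nonnegative, f of the listed elements is f of the flat
  they generate.\<close>

fun code_count :: "nat \<Rightarrow> (nat set \<Rightarrow> int) \<Rightarrow> nat \<Rightarrow> nat \<Rightarrow> int \<Rightarrow> int \<Rightarrow> int \<Rightarrow> int \<Rightarrow> int" where
  "code_count n f r 0 k t b s = - ways_int b s"
| "code_count n f r (Suc l) k t b s = - (ways_int b s + (\<Sum>u\<in>{0..<(int n + 2) ^ r}.
     if canonical n f r u \<and> code_less n f r u t
     then \<Sum>s'\<in>{0..<s + 1}. if k * f {j \<in> {1..n}. in_code n r u (int j)} < s'
       then code_count n f r l k u (code_card n f r u) s' * ways_int (b - code_card n f r u) (s - s') else 0
     else 0))"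

lemma ball_shift_int: "(\<forall>i\<in>{0..<int n}. Q (i + 1)) \<longleftrightarrow> (\<forall>i\<in>{1..n}. Q (int i))"
proof (intro iffI ballI)
  fix i assume *: "\<forall>i\<in>{0..<int n}. Q (i + 1)" and "i \<in> {1..n}"
  then have "int i - 1 \<in> {0..<int n}" by auto
  with * have "Q (int i - 1 + 1)" by blast
  then show "Q (int i)" by simp
next
  fix i assume *: "\<forall>i\<in>{1..n}. Q (int i)" and i: "i \<in> {0..<int n}"
  then have "nat (i + 1) \<in> {1..n}" by auto
  with * have "Q (int (nat (i + 1)))" by blast
  then show "Q (i + 1)" using i by simp
qed

lemma code_card_eq: "code_card n f r t = int (card (coded_flat n f r t))"
proof -
  have "code_card n f r t = (\<Sum>i\<in>{1..n}. of_bool (in_flat n f r t (int i)))"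
    unfolding code_card_def
    by (rule sum.reindex_bij_witness[of _ "\<lambda>i. int i - 1" "\<lambda>i. nat (i + 1)"]) auto
  then show ?thesis by (simp add: coded_flat_def Int_def)
qed

lemma code_less_iff: "code_less n f r u t \<longleftrightarrow> coded_flat n f r u \<subset> coded_flat n f r t"
proof -
  have fin: "finite (coded_flat n f r t)" for t by (simp add: coded_flat_def)
  have "(\<forall>i\<in>{0..<int n}. in_flat n f r u (i + 1) \<longrightarrow> in_flat n f r t (i + 1)) \<longleftrightarrow> coded_flat n f r u \<subseteq> coded_flat n f r t"
    unfolding ball_shift_int[of n "\<lambda>i. in_flat n f r u i \<longrightarrow> in_flat n f r t i"] by (auto simp: coded_flat_def)
  then show ?thesis unfolding code_less_def code_card_eq
    using psubset_card_mono[OF fin, of "coded_flat n f r u" t] by auto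
qed

lemma canonical_iff: "canonical n f r t \<longleftrightarrow> (\<forall>u\<in>{0..<t}. coded_flat n f r u \<noteq> coded_flat n f r t)"
proof -
  have "(\<forall>i\<in>{0..<int n}. in_flat n f r u (i + 1) \<longleftrightarrow> in_flat n f r t (i + 1)) \<longleftrightarrow> coded_flat n f r u = coded_flat n f r t" for u
    unfolding ball_shift_int[of n "\<lambda>i. in_flat n f r u i \<longleftrightarrow> in_flat n f r t i"] coded_flat_def by blast
  then show ?thesis unfolding canonical_def by simp
qed

lemma digit_sum_less:
  fixes X :: int
  assumes "\<And>i. i < N \<Longrightarrow> 0 \<le> a i \<and> a i < X" "0 < X"
  shows "0 \<le> (\<Sum>i<N. a i * X ^ i) \<and> (\<Sum>i<N. a i * X ^ i) < X ^ N"
  using assms(1)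
proof (induction N)
  case (Suc N)
  have "a N * X ^ N \<le> (X - 1) * X ^ N" using Suc.prems[of N] assms(2) by (intro mult_right_mono) auto
  moreover have "0 \<le> a N * X ^ N" using Suc.prems[of N] assms(2) by simp
  ultimately show ?case using Suc by (auto simp: algebra_simps)
qed simp

text \<open>The digits enumerate A and are padded with 0, which is no element of the ground
  set.\<close>

lemma coded_set_surj:
  assumes A: "A \<subseteq> {1..n}" "card A \<le> r"
  obtains t where "t \<in> {0..<(int n + 2) ^ r}" "coded_set n r t = A"
proof -
  have fin: "finite A" using A finite_subset by blast
  obtain h where h: "bij_betw h {0..<card A} A" using ex_bij_betw_nat_finite[OF fin] by blast
  define a where "a i = (if i < card A then int (h i) else 0)" for i
  let ?X = "int n + 2"
  have a: "0 \<le> a i \<and> a i < ?X" for i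
  proof (cases "i < card A")
    case True
    then have "h i \<in> A" using bij_betwE[OF h] by simp
    then have "h i \<in> {1..n}" using A by blast
    then show ?thesis using True by (simp add: a_def)
  qed (simp add: a_def)
  define t where "t = (\<Sum>i<r. a i * ?X ^ i)"
  have digit: "t div (\<Prod>l\<in>{0..<int j}. ?X) mod ?X = a j" if "j < r" for j
    unfolding t_def using digit_extraction[of r a ?X j] a that by simp
  have "in_code n r t i \<longleftrightarrow> (\<exists>j<r. a j = i)" for i
  proof
    assume "in_code n r t i"
    then obtain j where j: "0 \<le> j" "j < int r" "t div (\<Prod>l\<in>{0..<j}. ?X) mod ?X = i" by (auto simp: in_code_def)
    then obtain j' where "j = int j'" using nonneg_int_cases by blast
    then show "\<exists>j<r. a j = i" using j digit[of j'] by auto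
  next
    assume "\<exists>j<r. a j = i"
    then obtain j where "j < r" "a j = i" by blast
    then show "in_code n r t i" unfolding in_code_def using digit[of j] by (intro bexI[of _ "int j"]) auto
  qed
  then have "coded_set n r t = {i \<in> {1..n}. \<exists>j<r. a j = int i}" by (simp add: coded_set_def)
  also have "\<dots> = A"
  proof (intro equalityI subsetI)
    fix i assume "i \<in> {i \<in> {1..n}. \<exists>j<r. a j = int i}"
    then obtain j where "i \<in> {1..n}" "a j = int i" by blast
    then have "j < card A" "h j = i" by (auto simp: a_def split: if_splits)
    then show "i \<in> A" using h by (auto simp: bij_betw_def)
  next
    fix i assume i: "i \<in> A"
    then have "i \<in> h ` {0..<card A}" using h by (simp add: bij_betw_def)
    then obtain j where "j < card A" "h j = i" by auto
    then show "i \<in> {i \<in> {1..n}. \<exists>j<r. a j = int i}" using A i by (auto simp: a_def intro!: exI[of _ j])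
  qed
  finally have "coded_set n r t = A" .
  moreover have "t \<in> {0..<?X ^ r}" unfolding t_def using digit_sum_less[of r a ?X] a by simp
  ultimately show thesis using that by blast
qed

section \<open>Generating sets and canonical codes of flats\<close>

context integer_polymatroid
begin

text \<open>Greedy choice: an element is kept only if it increases f, which by integrality is an
  increase by at least 1. Diminishing gains carry the increase over from F to the chosen
  set.\<close>

lemma small_generating_set:
  assumes "F \<subseteq> {1..n}"
  shows "\<exists>A\<subseteq>F. f A = f F \<and> int (card A) \<le> f F"
proof -
  note f_empty = empty
  have "finite F" using assms finite_subset by blast
  then show ?thesis using assms
  proof (induction F rule: finite_induct)
    case empty
    then show ?case by (simp add: f_empty)
  next
    case (insert i F)
    then obtain A where A: "A \<subseteq> F" "f A = f F" "int (card A) \<le> f F" by auto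
    have sub: "F \<subseteq> {1..n}" "i \<in> {1..n}" using insert by auto
    show ?case
    proof (cases "f (insert i F) = f F")
      case True
      then show ?thesis using A by auto
    next
      case False
      have "f F \<le> f (insert i F)" using insert by (intro mono) auto
      then have lt: "f F + 1 \<le> f (insert i F)" using False by linarith
      have "f (insert i F) - f F \<le> f (insert i A) - f A" using diminishing[OF A(1) sub] .
      moreover have "f (insert i A) \<le> f (insert i F)" using A insert by (intro mono) auto
      ultimately have "f (insert i A) = f (insert i F)" using A by linarith
      moreover have "int (card (insert i A)) \<le> f (insert i F)"
        using A lt card_insert_if[OF finite_subset[OF A(1) insert.hyps(1)], of i] by auto
      ultimately show ?thesis using A by (intro exI[of _ "insert i A"]) auto
    qed
  qed
qed

lemma flat_closure_generating_set:
  assumes "F \<in> flats" "A \<subseteq> F" "f A = f F"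
  shows "flat_closure A = F"
proof (intro equalityI subsetI)
  have F: "F \<subseteq> {1..n}" using assms flat_subset by blast
  fix i assume i: "i \<in> flat_closure A"
  show "i \<in> F"
  proof (rule ccontr)
    assume "i \<notin> F"
    then have "f F < f (insert i F)" using i assms by (auto simp: flats_def flat_closure_def)
    moreover have "f (insert i F) - f F \<le> f (insert i A) - f A"
      using i assms F by (intro diminishing) (auto simp: flat_closure_def)
    ultimately show False using i by (auto simp: flat_closure_def)
  qed
next
  have F: "F \<subseteq> {1..n}" using assms flat_subset by blast
  fix i assume i: "i \<in> F"
  have "f (insert i A) \<le> f F" "f A \<le> f (insert i A)" using i assms F by (intro mono; blast)+
  then show "i \<in> flat_closure A" using assms i F by (auto simp: flat_closure_def)
qed

lemma coded_set_subset: "coded_set n r t \<subseteq> {1..n}"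
  by (auto simp: coded_set_def)

lemma coded_flat_eq: "0 \<le> t \<Longrightarrow> coded_flat n f r t = flat_closure (coded_set n r t)"
proof -
  assume t: "0 \<le> t"
  have "{j \<in> {1..n}. int j = int i \<or> in_code n r t (int j)} = insert i (coded_set n r t)" if "i \<in> {1..n}" for i
    using that by (auto simp: coded_set_def)
  then show ?thesis using t unfolding coded_flat_def flat_closure_def in_flat_def by (auto simp: coded_set_def)
qed

lemma coded_flat_minus_one: "coded_flat n f r (-1) = {1..n}"
  by (auto simp: coded_flat_def in_flat_def)

text \<open>Every flat has a generating set of at most f [n] <= r elements, so r digits are enough
  for some code, and a least code exists.\<close>

lemma canonical_codes:
  assumes r: "f {1..n} \<le> int r"
  shows "bij_betw (coded_flat n f r) {u \<in> {0..<(int n + 2) ^ r}. canonical n f r u} flats"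
  unfolding bij_betw_def
proof
  show "inj_on (coded_flat n f r) {u \<in> {0..<(int n + 2) ^ r}. canonical n f r u}"
  proof (rule inj_onI)
    fix u v assume u: "u \<in> {u \<in> {0..<(int n + 2) ^ r}. canonical n f r u}"
      and v: "v \<in> {u \<in> {0..<(int n + 2) ^ r}. canonical n f r u}" and eq: "coded_flat n f r u = coded_flat n f r v"
    show "u = v"
    proof (rule linorder_cases[of u v])
      assume "u < v" then show ?thesis using u v eq unfolding canonical_iff by auto
    next
      assume "v < u" then show ?thesis using u v eq[symmetric] unfolding canonical_iff by auto
    qed
  qed
  show "coded_flat n f r ` {u \<in> {0..<(int n + 2) ^ r}. canonical n f r u} = flats"
  proof (intro equalityI subsetI)
    fix G assume "G \<in> coded_flat n f r ` {u \<in> {0..<(int n + 2) ^ r}. canonical n f r u}"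
    then obtain u where "0 \<le> u" "G = coded_flat n f r u" by auto
    then show "G \<in> flats" using coded_flat_eq flat_closure_flat[OF coded_set_subset] by simp
  next
    fix G assume G: "G \<in> flats"
    have Gn: "G \<subseteq> {1..n}" using G flat_subset by blast
    obtain A where A: "A \<subseteq> G" "f A = f G" "int (card A) \<le> f G" using small_generating_set[OF Gn] by blast
    have "f G \<le> f {1..n}" using Gn by (intro mono) auto
    then have "card A \<le> r" using A r by linarith
    then obtain t where t: "t \<in> {0..<(int n + 2) ^ r}" "coded_set n r t = A"
      using coded_set_surj[of A n r] A Gn by blast
    then have tG: "coded_flat n f r t = G" using coded_flat_eq[of t r] flat_closure_generating_set[OF G A(1,2)] by simp
    define Q where "Q m \<longleftrightarrow> coded_flat n f r (int m) = G" for m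
    have "Q (nat t)" using t tG by (simp add: Q_def)
    define m where "m = (LEAST m. Q m)"
    have "Q m" unfolding m_def using \<open>Q (nat t)\<close> by (rule LeastI)
    have "m \<le> nat t" unfolding m_def using \<open>Q (nat t)\<close> by (rule Least_le)
    have "canonical n f r (int m)" unfolding canonical_iff
    proof
      fix u assume u: "u \<in> {0..<int m}"
      then have "\<not> Q (nat u)" unfolding m_def by (intro not_less_Least) auto
      then show "coded_flat n f r u \<noteq> coded_flat n f r (int m)" using u \<open>Q m\<close> by (simp add: Q_def)
    qed
    then show "G \<in> coded_flat n f r ` {u \<in> {0..<(int n + 2) ^ r}. canonical n f r u}"
      using \<open>Q m\<close> \<open>m \<le> nat t\<close> t by (intro image_eqI[of _ _ "int m"]) (auto simp: Q_def)
  qed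
qed

lemma code_count_eq:
  assumes r: "f {1..n} \<le> int r" and b: "card (coded_flat n f r t) \<le> b"
  shows "code_count n f r l (int k) t (int b) (int s) = signed_count k l (coded_flat n f r t) b s"
  using b
proof (induction l arbitrary: t b s)
  case 0
  then show ?case by (simp add: ways_int_eq)
next
  case (Suc l)
  let ?D = "coded_flat n f r"
  let ?U = "{u \<in> {0..<(int n + 2) ^ r}. canonical n f r u}"
  have finD: "finite (?D t)" for t by (simp add: coded_flat_def)
  define T where "T G = (\<Sum>s' | s' \<le> s \<and> int k * f G < int s'. signed_count k l G (card G) s' * int (ways (b - card G) (s - s')))" for G
  have inner: "(\<Sum>s'\<in>{0..<int s + 1}. if int k * f {j \<in> {1..n}. in_code n r u (int j)} < s'
       then code_count n f r l (int k) u (code_card n f r u) s' * ways_int (int b - code_card n f r u) (int s - s') else 0) = T (?D u)"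
    if u: "u \<in> ?U" and less: "?D u \<subset> ?D t" for u
  proof -
    \<comment> \<open>Ensures that truncated subtraction in \<open>signed_count\<close> agrees with
      integer subtraction in \<open>code_count\<close>.\<close>
    have cu: "card (?D u) \<le> b" using psubset_card_mono[OF finD less] Suc.prems by linarith
    have rank: "f {j \<in> {1..n}. in_code n r u (int j)} = f (?D u)"
      unfolding coded_set_def[symmetric] using u coded_flat_eq[of u r] rank_flat_closure[OF coded_set_subset] by simp
    have "T (?D u) = (\<Sum>s'\<le>s. if int k * f (?D u) < int s'
        then signed_count k l (?D u) (card (?D u)) s' * int (ways (b - card (?D u)) (s - s')) else 0)"
      unfolding T_def by (subst sum.inter_filter[symmetric]) auto
    moreover have "code_count n f r l (int k) u (code_card n f r u) (int s') * ways_int (int b - code_card n f r u) (int s - int s') =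
       signed_count k l (?D u) (card (?D u)) s' * int (ways (b - card (?D u)) (s - s'))" if "s' \<le> s" for s'
      using Suc.IH[of u "card (?D u)" s'] ways_int_eq[of "b - card (?D u)" "s - s'"] cu that
      by (simp add: code_card_eq of_nat_diff)
    ultimately show ?thesis unfolding sum_to_n rank by (auto intro!: sum.cong)
  qed
  have "(\<Sum>u\<in>{0..<(int n + 2) ^ r}. if canonical n f r u \<and> code_less n f r u t
     then \<Sum>s'\<in>{0..<int s + 1}. if int k * f {j \<in> {1..n}. in_code n r u (int j)} < s'
       then code_count n f r l (int k) u (code_card n f r u) s' * ways_int (int b - code_card n f r u) (int s - s') else 0
     else 0) = (\<Sum>u\<in>{0..<(int n + 2) ^ r}. if canonical n f r u \<and> ?D u \<subset> ?D t then T (?D u) else 0)"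
  proof (rule sum.cong[OF refl])
    fix u assume u: "u \<in> {0..<(int n + 2) ^ r}"
    show "(if canonical n f r u \<and> code_less n f r u t
     then \<Sum>s'\<in>{0..<int s + 1}. if int k * f {j \<in> {1..n}. in_code n r u (int j)} < s'
       then code_count n f r l (int k) u (code_card n f r u) s' * ways_int (int b - code_card n f r u) (int s - s') else 0
     else 0) = (if canonical n f r u \<and> ?D u \<subset> ?D t then T (?D u) else 0)"
    proof (cases "canonical n f r u \<and> ?D u \<subset> ?D t")
      case True
      then show ?thesis using inner[of u] u by (simp only: code_less_iff mem_Collect_eq simp_thms if_True)
    qed (simp only: code_less_iff if_False)
  qed
  also have "\<dots> = (\<Sum>u\<in>?U. if ?D u \<subset> ?D t then T (?D u) else 0)"
    by (subst sum.inter_filter) (auto intro!: sum.cong)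
  also have "\<dots> = (\<Sum>G\<in>flats. if G \<subset> ?D t then T G else 0)"
    by (rule sum.reindex_bij_betw[OF canonical_codes[OF r], of "\<lambda>G. if G \<subset> ?D t then T G else 0"])
  also have "\<dots> = (\<Sum>G | G \<in> flats \<and> G \<subset> ?D t. T G)"
    by (rule sum.inter_filter[symmetric]) (rule finite_flats)
  finally show ?case unfolding code_count.simps signed_count.simps T_def ways_int_eq by (simp only:)
qed

section \<open>The Ehrhart polynomial of a polymatroid\<close>

text \<open>Element 0 serves as a slack variable unless the total is prescribed.\<close>

definition ground :: "bool \<Rightarrow> nat set"
  where "ground b = (if b then {1..n} else {0..n})"

lemma card_ground: "card (ground b) = (if b then n else n + 1)"
  by (simp add: ground_def)

text \<open>Coordinate 0, if present, is bound only by the total k f [n]. Since the sum over {1..n}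
  never exceeds this total, it is determined by the others and never negative. For k = 0 the zero
  vector is the only composition, matching the convention for the count.\<close>

lemma ehrhart_count_face:
  assumes s: "int s = int k * f {1..n}"
  shows "ehrhart_count (face b) k = card {x \<in> compositions (ground b) s. \<forall>A\<subseteq>{1..n}. int (sum x A) \<le> int k * f A}"
    (is "_ = card ?X")
proof (cases "k = 0")
  case True
  have "?X = {\<lambda>_. 0}"
  proof (intro equalityI subsetI)
    fix x assume "x \<in> ?X"
    then have "sum x (ground b) = 0" "\<forall>i. i \<notin> ground b \<longrightarrow> x i = 0" using s True by (auto simp: compositions_def)
    then show "x \<in> {\<lambda>_. 0}" by (auto simp: ground_def fun_eq_iff split: if_splits)
  qed (use s True in \<open>auto simp: compositions_def\<close>)
  then show ?thesis using True by (simp add: ehrhart_count_def)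
next
  case False
  then have k: "0 < real k" by simp
  define \<phi> :: "(nat \<Rightarrow> nat) \<Rightarrow> nat \<Rightarrow> real" where "\<phi> x = (\<lambda>i. if i \<in> {1..n} then real (x i) else 0)" for x
  have sum\<phi>: "sum (\<phi> x) A = real (sum x A)" if "A \<subseteq> {1..n}" for x A
    unfolding of_nat_sum by (intro sum.cong) (use that in \<open>auto simp: \<phi>_def\<close>)
  have split0: "sum x (ground b) = (if b then 0 else x 0) + sum x {1..n}" for x :: "nat \<Rightarrow> nat"
    by (simp add: ground_def sum.atLeast_Suc_atMost[of 0 n])
  have dil: "y \<in> (\<lambda>x. real k *\<^sub>R x) ` face b \<longleftrightarrow> (\<forall>i. i \<notin> {1..n} \<longrightarrow> y i = 0) \<and> (\<forall>i. 0 \<le> y i) \<and>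
     (\<forall>A\<subseteq>{1..n}. sum y A \<le> of_int (int k * f A)) \<and> (b \<longrightarrow> sum y {1..n} = of_int (int k * f {1..n}))" (is "_ \<longleftrightarrow> ?R y") for y
  proof
    assume "y \<in> (\<lambda>x. real k *\<^sub>R x) ` face b"
    then obtain x where x: "x \<in> face b" "y = real k *\<^sub>R x" by blast
    have "sum y A = real k * sum x A" for A by (simp add: x(2) scaleR_fun_def sum_distrib_left)
    then show "?R y" using faceD[OF x(1)] k by (simp add: x(2) scaleR_fun_def mult_left_mono)
  next
    assume R: "?R y"
    define x where "x = (\<lambda>i. y i / real k)"
    have "sum x A = sum y A / real k" for A by (simp add: x_def sum_divide_distrib)
    then have sx: "sum x A \<le> of_int z \<longleftrightarrow> sum y A \<le> of_int (int k * z)" "sum x A = of_int z \<longleftrightarrow> sum y A = of_int (int k * z)" for A z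
      using k by (simp_all add: pos_divide_le_eq divide_eq_eq mult.commute)
    have "x \<in> face b"
    proof (rule faceI)
      fix i show "0 \<le> x i" using R k by (simp add: x_def)
    next
      fix A assume "A \<subseteq> {1..n}" then show "sum x A \<le> of_int (f A)" unfolding sx using R by blast
    next
      assume b then show "sum x {1..n} = of_int (f {1..n})" unfolding sx using R by blast
    next
      fix i assume "i \<notin> {1..n}" then show "x i = 0" using R by (simp add: x_def)
    qed
    moreover have "y = real k *\<^sub>R x" using k by (simp add: fun_eq_iff x_def scaleR_fun_def)
    ultimately show "y \<in> (\<lambda>x. real k *\<^sub>R x) ` face b" by blast
  qed
  have "bij_betw \<phi> ?X ((\<lambda>x. real k *\<^sub>R x) ` face b \<inter> integer_points)"
    unfolding bij_betw_def
  proof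
    show "inj_on \<phi> ?X"
    proof (rule inj_onI)
      fix x x' assume x: "x \<in> ?X" "x' \<in> ?X" and eq: "\<phi> x = \<phi> x'"
      have e: "x i = x' i" if "i \<in> {1..n}" for i using fun_cong[OF eq, of i] that by (simp add: \<phi>_def)
      then have "sum x {1..n} = sum x' {1..n}" by (intro sum.cong) auto
      moreover have "sum x (ground b) = sum x' (ground b)" using x by (simp add: compositions_def)
      ultimately have "b \<or> x 0 = x' 0" using split0[of x] split0[of x'] by (cases b) simp_all
      moreover have "x i = 0 \<and> x' i = 0" if "i \<notin> ground b" for i using x that by (auto simp: compositions_def)
      moreover have "i \<in> {1..n} \<or> (\<not> b \<and> i = 0) \<or> i \<notin> ground b" for i by (auto simp: ground_def)
      ultimately have "x i = x' i" for i using e[of i] by metis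
      then show "x = x'" by blast
    qed
    show "\<phi> ` ?X = (\<lambda>x. real k *\<^sub>R x) ` face b \<inter> integer_points"
    proof (intro equalityI subsetI)
      fix y assume "y \<in> \<phi> ` ?X"
      then obtain x where x: "x \<in> ?X" and y: "y = \<phi> x" by blast
      have "sum y A \<le> of_int (int k * f A)" if A: "A \<subseteq> {1..n}" for A
      proof -
        have "int (sum x A) \<le> int k * f A" using x A by blast
        then have "real_of_int (int (sum x A)) \<le> of_int (int k * f A)" by (simp only: of_int_le_iff)
        then show ?thesis using sum\<phi>[OF A] y by simp
      qed
      moreover have "sum y {1..n} = of_int (int k * f {1..n})" if b
      proof -
        have "sum x {1..n} = s" using x split0[of x] that by (simp add: compositions_def)
        then have "real (sum x {1..n}) = of_int (int k * f {1..n})" using s by (metis of_int_of_nat_eq)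
        then show ?thesis using sum\<phi>[of "{1..n}" x] y by simp
      qed
      ultimately have "y \<in> (\<lambda>x. real k *\<^sub>R x) ` face b" unfolding dil by (auto simp: y \<phi>_def)
      then show "y \<in> (\<lambda>x. real k *\<^sub>R x) ` face b \<inter> integer_points" by (auto simp: y \<phi>_def integer_points_def)
    next
      fix y assume y: "y \<in> (\<lambda>x. real k *\<^sub>R x) ` face b \<inter> integer_points"
      then have R: "?R y" unfolding dil[symmetric] by blast
      have fl: "real (nat \<lfloor>y i\<rfloor>) = y i" for i
      proof -
        have "of_int \<lfloor>y i\<rfloor> = y i" "0 \<le> \<lfloor>y i\<rfloor>" using y R by (auto simp: integer_points_def)
        then show ?thesis by simp
      qed
      define x0 where "x0 i = (if i \<in> {1..n} then nat \<lfloor>y i\<rfloor> else 0)" for i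
      \<comment> \<open>The slack coordinate fills up the total; truncation does no harm, as the sum
        is shown below to be at most s.\<close>
      define x where "x = (if b then x0 else x0(0 := s - sum x0 {1..n}))"
      have xE: "x i = x0 i" if "i \<in> {1..n}" for i using that by (simp add: x_def)
      have sx: "sum x A = sum x0 A" if "A \<subseteq> {1..n}" for A by (intro sum.cong) (use that xE in auto)
      have \<phi>x: "\<phi> x = y" using R by (auto simp: \<phi>_def fun_eq_iff xE x0_def fl)
      have le: "int (sum x A) \<le> int k * f A" if A: "A \<subseteq> {1..n}" for A
      proof -
        have "real_of_int (int (sum x A)) \<le> of_int (int k * f A)"
        proof -
          have "sum y A \<le> of_int (int k * f A)" using R A by blast
          then show ?thesis using sum\<phi>[OF A, of x] by (simp add: \<phi>x)
        qed
        then show ?thesis by (simp only: of_int_le_iff)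
      qed
      have "int (sum x0 {1..n}) \<le> int s" unfolding s using le[OF order_refl] sx[OF order_refl] by simp
      then have "sum x0 {1..n} \<le> s" unfolding of_nat_le_iff .
      moreover have "sum x0 {1..n} = s" if b
      proof -
        have "real (sum x {1..n}) = of_int (int k * f {1..n})" using R that sum\<phi>[of "{1..n}" x] by (simp add: \<phi>x)
        then have "real (sum x {1..n}) = real s" using s by (metis of_int_of_nat_eq)
        then have "sum x {1..n} = s" unfolding of_nat_eq_iff .
        then show ?thesis using sx[OF order_refl] by simp
      qed
      ultimately have "sum x (ground b) = s" unfolding split0 sx[OF order_refl] by (auto simp: x_def)
      then have "x \<in> ?X" using le by (auto simp: compositions_def x_def x0_def ground_def)
      then show "y \<in> \<phi> ` ?X" using \<phi>x by blast
    qed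
  qed
  then show ?thesis using False bij_betw_same_card by (fastforce simp: ehrhart_count_def)
qed

lemma ehrhart_count_signed_count:
  assumes "f {1..n} \<le> int l"
  shows "int (ehrhart_count (face b) k) = - signed_count k l {1..n} (card (ground b)) (k * nat (f {1..n}))"
proof -
  have s: "int (k * nat (f {1..n})) = int k * f {1..n}" using nonneg[of "{1..n}"] by simp
  have "finite (ground b)" "{1..n} \<subseteq> ground b" by (auto simp: ground_def)
  then show ?thesis using card_compositions_polymatroid[OF _ _ s assms] ehrhart_count_face[OF s] by simp
qed

text \<open>The two-variable polynomial of the ground set is restricted to the line s = k f [n].
  Without any coordinate, that is for the base face with n = 0, the count is constantly 1.\<close>

lemma ehrhart_polynomial_exists: "\<exists>p. is_ehrhart_poly (face b) p"
proof -
  define l where "l = nat (f {1..n})"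
  have l: "f {1..n} \<le> int l" by (simp add: l_def)
  have count: "real (ehrhart_count (face b) k) = - real_of_int (signed_count k l {1..n} (card (ground b)) (k * l))" for k
    using arg_cong[OF ehrhart_count_signed_count[OF l, of b k], of real_of_int] by (simp add: l_def)
  show ?thesis
  proof (cases "card (ground b) = 0")
    case True
    then have "n = 0" by (auto simp: card_ground split: if_splits)
    then have "l = 0" by (simp add: l_def empty)
    then have "real (ehrhart_count (face b) k) = 1" for k using count[of k] True by (simp add: ways_def)
    then have "is_ehrhart_poly (face b) [:1:]" by (simp add: is_ehrhart_poly_def)
    then show ?thesis by blast
  next
    case False
    have "card {1..n} \<le> card (ground b)" by (simp add: card_ground)
    then obtain \<psi> where \<psi>: "bivariate \<psi>" "\<And>k s. int k * f {1..n} \<le> int s \<Longrightarrow>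
        real_of_int (signed_count k l {1..n} (card (ground b)) s) = \<psi> (real k) (real s)"
      using signed_count_bivariate[of "{1..n}" "card (ground b)" l] False by auto
    obtain p where p: "\<And>x. \<psi> x (x * real l) = poly p x" using bivariate_line[OF \<psi>(1)] by blast
    have "real (ehrhart_count (face b) k) = poly (- p) (real k)" for k
    proof -
      have "int k * f {1..n} \<le> int (k * l)" using l by (simp add: mult_left_mono)
      then show ?thesis using count[of k] \<psi>(2)[of k "k * l"] p[of "real k"] by simp
    qed
    then show ?thesis unfolding is_ehrhart_poly_def by metis
  qed
qed

text \<open>The greedy vector: coordinate i is the gain of f from {1..i-1} to {1..i}. Diminishing
  gains bound its sum over A by f A, and its total is f [n], so it lies in the face for both values
  of the flag.\<close>

lemma face_nonempty: "face b \<inter> integer_points \<noteq> {}"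
proof -
  define x :: "nat \<Rightarrow> real" where "x i = (if i \<in> {1..n} then of_int (f {1..i} - f {1..i - 1}) else 0)" for i
  have part: "{1..i} \<subseteq> {1..n}" "insert i {1..i - 1} = {1..i}" if "i \<in> {1..n}" for i using that by auto
  have le: "sum x (A \<inter> {1..m}) \<le> of_int (f (A \<inter> {1..m}))" if "A \<subseteq> {1..n}" "m \<le> n" for A m
    using that(2)
  proof (induction m)
    case 0
    then show ?case by (simp add: empty)
  next
    case (Suc m)
    show ?case
    proof (cases "Suc m \<in> A")
      case True
      then have e: "A \<inter> {1..Suc m} = insert (Suc m) (A \<inter> {1..m})" by auto
      have "f (insert (Suc m) {1..m}) - f {1..m} \<le> f (insert (Suc m) (A \<inter> {1..m})) - f (A \<inter> {1..m})"
        using Suc.prems by (intro diminishing) auto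
      moreover have "insert (Suc m) {1..m} = {1..Suc m}" by auto
      ultimately have "f {1..Suc m} - f {1..m} \<le> f (A \<inter> {1..Suc m}) - f (A \<inter> {1..m})" by (simp only: e)
      then have "real_of_int (f {1..Suc m} - f {1..m}) \<le> of_int (f (A \<inter> {1..Suc m}) - f (A \<inter> {1..m}))"
        unfolding of_int_le_iff .
      moreover have "x (Suc m) = of_int (f {1..Suc m} - f {1..m})" using Suc.prems by (simp add: x_def)
      ultimately have "x (Suc m) \<le> of_int (f (A \<inter> {1..Suc m})) - of_int (f (A \<inter> {1..m}))" by simp
      moreover have "sum x (A \<inter> {1..Suc m}) = x (Suc m) + sum x (A \<inter> {1..m})"
        unfolding e by (subst sum.insert) auto
      ultimately show ?thesis using Suc by simp
    next
      case False
      then have "A \<inter> {1..Suc m} = A \<inter> {1..m}" by (auto simp: le_Suc_eq)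
      then show ?thesis using Suc by simp
    qed
  qed
  have total: "sum x {1..m} = of_int (f {1..m})" if "m \<le> n" for m
    using that
  proof (induction m)
    case (Suc m)
    then show ?case by (simp add: x_def)
  qed (simp add: empty)
  have "x \<in> face b"
  proof (rule faceI)
    fix i show "0 \<le> x i" using mono[of "{1..i - 1}" "{1..i}"] part(1)[of i] by (auto simp: x_def)
  next
    fix A assume A: "A \<subseteq> {1..n}"
    then have "A \<inter> {1..n} = A" by auto
    then show "sum x A \<le> of_int (f A)" using le[OF A, of n] by simp
  next
    show "sum x {1..n} = of_int (f {1..n})" by (rule total) simp
  qed (auto simp: x_def)
  moreover have "x \<in> integer_points" by (auto simp: x_def integer_points_def)
  ultimately show ?thesis by blast
qed

lemma measurable_face:
  fixes d :: nat
  shows "{t \<in> {..<d} \<rightarrow>\<^sub>E UNIV. a + (\<Sum>j<d. t j *\<^sub>R c j) \<in> face b} \<in> sets (Pi\<^sub>M {..<d} (\<lambda>_. lborel))"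
proof -
  let ?M = "Pi\<^sub>M {..<d} (\<lambda>_. lborel) :: (nat \<Rightarrow> real) measure"
  define g where "g i t = a i + (\<Sum>j<d. t j * c j i)" for i and t :: "nat \<Rightarrow> real"
  have app: "(a + (\<Sum>j<d. t j *\<^sub>R c j)) i = g i t" for t i
    by (simp add: g_def sum_fun_apply scaleR_fun_def)
  have [measurable]: "g i \<in> borel_measurable ?M" for i
    unfolding g_def by measurable
  have "{t \<in> {..<d} \<rightarrow>\<^sub>E UNIV. a + (\<Sum>j<d. t j *\<^sub>R c j) \<in> face b} =
    {t \<in> space ?M. (\<forall>i. i \<notin> {1..n} \<longrightarrow> g i t = 0) \<and> (\<forall>i. 0 \<le> g i t) \<and>
      (\<forall>A\<in>Pow {1..n}. (\<Sum>i\<in>A. g i t) \<le> of_int (f A)) \<and> (b \<longrightarrow> (\<Sum>i\<in>{1..n}. g i t) = of_int (f {1..n}))}"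
  proof (rule Collect_cong)
    fix t
    have sp: "t \<in> space ?M \<longleftrightarrow> t \<in> {..<d} \<rightarrow>\<^sub>E UNIV" by (simp add: space_PiM)
    have "a + (\<Sum>j<d. t j *\<^sub>R c j) = (\<lambda>i. g i t)" by (rule ext) (rule app)
    then show "t \<in> {..<d} \<rightarrow>\<^sub>E UNIV \<and> a + (\<Sum>j<d. t j *\<^sub>R c j) \<in> face b \<longleftrightarrow>
      t \<in> space ?M \<and> (\<forall>i. i \<notin> {1..n} \<longrightarrow> g i t = 0) \<and> (\<forall>i. 0 \<le> g i t) \<and>
      (\<forall>A\<in>Pow {1..n}. (\<Sum>i\<in>A. g i t) \<le> of_int (f A)) \<and> (b \<longrightarrow> (\<Sum>i\<in>{1..n}. g i t) = of_int (f {1..n}))"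
      unfolding sp by (simp only: face_def polymatroid_def mem_Collect_eq Ball_def Pow_iff conj_assoc)
  qed
  also have "\<dots> \<in> sets ?M" by measurable
  finally show ?thesis .
qed

lemma ehrhart_face:
  obtains p where "is_ehrhart_poly (face b) p" "degree p \<le> n" "has_normalized_volume (face b) (lead_coeff p)"
proof -
  obtain p where p: "is_ehrhart_poly (face b) p" using ehrhart_polynomial_exists by blast
  have supp: "x i = 0" if "x \<in> face b \<inter> integer_points" "i \<notin> {1..n}" for x i
    using that faceD(1) by blast
  have "degree p \<le> n" "has_normalized_volume (face b) (lead_coeff p)"
    by (rule ehrhart_leading_coefficient[where S = "face b \<inter> integer_points" and P = "face b" and n = n and p = p];
        (rule finite_face_integer_points face_nonempty Int_lower2 face_eq_convex_hull measurable_face p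
          | erule (1) supp))+
  then show thesis using that[OF p] by blast
qed

end

section \<open>Computability of the Ehrhart coefficients\<close>

lemmas computable_intros =
  computable_const computable_size computable_var computable_add computable_diff computable_mult
  computable_div computable_mod computable_power computable_less decidable_not decidable_conj decidable_disj decidable_imp
  decidable_le decidable_eq computable_if computable_sum computable_prod decidable_ball decidable_bex
  computable_oracle_set

lemmas poly_bounded_intros =
  poly_bounded_const poly_bounded_size poly_bounded_var poly_bounded_add poly_bounded_diff
  poly_bounded_mult poly_bounded_power

lemma decidable_iff: "decidable \<rho> P \<Longrightarrow> decidable \<rho> Q \<Longrightarrow> decidable \<rho> (\<lambda>n f e. P n f e = Q n f e)"
  using decidable_conj[OF decidable_imp decidable_imp, of \<rho> P Q Q P] by (simp only: iff_conv_conj_imp)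

lemma computable_uminus: "computable \<rho> F \<Longrightarrow> computable \<rho> (\<lambda>n f e. - F n f e)"
  using computable_diff[OF computable_const[of \<rho> 0]] by simp

lemma computable_oracle_ground: "computable \<rho> (\<lambda>n f e. f {1..n})"
  using computable_oracle[OF computable_const[of \<rho> 1]] by (simp only: one_neq_zero simp_thms Collect_mem_eq)

lemma poly_bounded_oracle_ground: "poly_bounded \<rho> (\<lambda>n f e. f {1..n})"
  by (rule poly_bounded_oracle) simp

lemma computable_ways_int:
  assumes "computable \<rho> \<beta>" "computable \<rho> \<sigma>" "poly_bounded \<rho> \<sigma>"
  shows "computable \<rho> (\<lambda>n f e. ways_int (\<beta> n f e) (\<sigma> n f e))"
  unfolding ways_int_def
  by (intro computable_intros assms computable_weaken[OF assms(1)])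

lemma decidable_in_code:
  assumes "computable \<rho> \<tau>" "computable \<rho> \<iota>"
  shows "decidable \<rho> (\<lambda>n f e. in_code n r (\<tau> n f e) (\<iota> n f e))"
  unfolding in_code_def
  by (intro computable_intros poly_bounded_intros computable_weaken[OF assms(1)] computable_weaken[OF assms(2)])

lemma decidable_in_flat:
  assumes "computable \<rho> \<tau>" "computable \<rho> \<iota>"
  shows "decidable \<rho> (\<lambda>n f e. in_flat n f r (\<tau> n f e) (\<iota> n f e))"
  unfolding in_flat_def
  by (intro computable_intros decidable_in_code assms computable_weaken[OF assms(1)] computable_weaken[OF assms(2)])

lemma computable_code_card:
  assumes "computable \<rho> \<tau>"
  shows "computable \<rho> (\<lambda>n f e. code_card n f r (\<tau> n f e))"
  unfolding code_card_def
  by (intro computable_intros poly_bounded_intros decidable_in_flat computable_weaken[OF assms])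

lemma decidable_code_less:
  assumes "computable \<rho> \<tau>" "computable \<rho> \<upsilon>"
  shows "decidable \<rho> (\<lambda>n f e. code_less n f r (\<upsilon> n f e) (\<tau> n f e))"
  unfolding code_less_def
  by (intro computable_intros poly_bounded_intros decidable_in_flat computable_code_card assms
      computable_weaken[OF assms(1)] computable_weaken[OF assms(2)])

lemma decidable_canonical:
  assumes "computable \<rho> \<tau>" "poly_bounded \<rho> \<tau>"
  shows "decidable \<rho> (\<lambda>n f e. canonical n f r (\<tau> n f e))"
  unfolding canonical_def
  by (intro computable_intros poly_bounded_intros decidable_in_flat decidable_iff assms
      computable_weaken[OF assms(1), of "\<lambda>i. Suc (Suc i)"])

text \<open>The depth l is a constant of the program: each level of the recursion becomes two more
  nested loops. Their limits (n + 2) ^ r and s + 1 must be polynomially bounded; the remaining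
  arguments need only be computable.\<close>

lemma computable_code_count:
  assumes "computable \<rho> \<kappa>" "computable \<rho> \<tau>" "computable \<rho> \<beta>" "computable \<rho> \<sigma>" "poly_bounded \<rho> \<sigma>"
  shows "computable \<rho> (\<lambda>n f e. code_count n f r l (\<kappa> n f e) (\<tau> n f e) (\<beta> n f e) (\<sigma> n f e))"
  using assms
proof (induction l arbitrary: \<kappa> \<tau> \<beta> \<sigma>)
  case 0
  then show ?case unfolding code_count.simps by (intro computable_uminus computable_ways_int)
next
  case (Suc l)
  \<comment> \<open>Inside the sum over codes all arguments are renamed by one binder, inside the
    sum over s' by two.\<close>
  note w1 = computable_weaken[where \<tau> = Suc] and w2 = computable_weaken[where \<tau> = "\<lambda>i. Suc (Suc i)"]
  note p1 = poly_bounded_weaken[OF Suc.prems(5), where \<tau> = Suc] and p2 = poly_bounded_weaken[OF Suc.prems(5), where \<tau> = "\<lambda>i. Suc (Suc i)"]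
  show ?case unfolding code_count.simps
    by (intro computable_uminus computable_intros poly_bounded_intros computable_ways_int decidable_canonical
        decidable_code_less decidable_in_code computable_code_card Suc.IH Suc.prems p1 p2
        w1[OF Suc.prems(1)] w1[OF Suc.prems(2)] w1[OF Suc.prems(3)] w1[OF Suc.prems(4)]
        w2[OF Suc.prems(1)] w2[OF Suc.prems(2)] w2[OF Suc.prems(3)] w2[OF Suc.prems(4)])
qed

text \<open>Code -1 is the ground set as top element, r is the depth that covers all chains, and the
  third argument counts the coordinates, including the slack one if the total is not
  prescribed.\<close>

definition count_values :: "bool \<Rightarrow> nat \<Rightarrow> nat \<Rightarrow> (nat set \<Rightarrow> int) \<Rightarrow> int \<Rightarrow> int"
  where "count_values b r n f k = - code_count n f r r k (-1) (int n + of_bool (\<not> b)) (k * f {1..n})"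

lemma computable_count_values: "computable \<rho> (\<lambda>n f e. count_values b r n f (e i))"
  unfolding count_values_def
  by (intro computable_uminus computable_code_count computable_intros computable_oracle_ground
      poly_bounded_intros poly_bounded_oracle_ground)

lemma computable_coeff_bound: "computable \<rho> (\<lambda>n f e. coeff_bound n (count_values b r n f))"
  unfolding coeff_bound_def
  by (intro computable_intros poly_bounded_intros computable_ways_int computable_count_values)

lemma computable_lagrange_value:
  "computable \<rho> \<xi> \<Longrightarrow> computable \<rho> (\<lambda>n f e. lagrange_value n (count_values b r n f) (\<xi> n f e))"
  unfolding lagrange_value_def
  by (intro computable_intros poly_bounded_intros computable_ways_int computable_count_values
      computable_weaken[where F = \<xi> and \<tau> = "\<lambda>i. Suc (Suc i)"])

lemma computable_numerator:
  assumes "computable \<rho> \<iota>" "poly_bounded \<rho> \<iota>"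
  shows "computable \<rho> (\<lambda>n f e. numerator n (count_values b r n f) (\<iota> n f e))"
  unfolding numerator_def
  by (intro computable_intros poly_bounded_intros computable_lagrange_value computable_coeff_bound assms)

lemma computable_denominator: "computable \<rho> (\<lambda>n f e. denominator n)"
  unfolding denominator_def by (intro computable_intros poly_bounded_intros)

lemma computable_output_degree: "computable \<rho> (\<lambda>n f e. output_degree n (count_values b r n f))"
  unfolding output_degree_def
  by (intro computable_intros poly_bounded_intros computable_numerator)

context integer_polymatroid
begin

lemma count_values_eq:
  assumes "f {1..n} \<le> int r"
  shows "count_values b r n f (int k) = int (ehrhart_count (face b) k)"
proof -
  have s: "int k * f {1..n} = int (k * nat (f {1..n}))" using nonneg[of "{1..n}"] by simp
  have c: "int n + of_bool (\<not> b) = int (card (ground b))" by (simp add: card_ground)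
  have "card (coded_flat n f r (-1)) \<le> card (ground b)" by (simp add: coded_flat_minus_one card_ground)
  from code_count_eq[OF assms this, of r k "k * nat (f {1..n})"]
  have "count_values b r n f (int k) = - signed_count k r {1..n} (card (ground b)) (k * nat (f {1..n}))"
    unfolding count_values_def s c coded_flat_minus_one by simp
  then show ?thesis using ehrhart_count_signed_count[OF assms] by simp
qed

end

theorem ehrhart_of_face_computable:
  "\<exists>c q. \<forall>n f. integer_polymatroid n f \<longrightarrow> f {1..n} \<le> r \<longrightarrow>
    computes_ehrhart_within c n f (integer_polymatroid.face n f b) (poly q n)"
proof -
  \<comment> \<open>For negative r no f satisfies the bound, as f is nonnegative, so
    \<open>nat r\<close> is harmless.\<close>
  let ?E = "count_values b (nat r)"
  obtain c q where cq: "\<And>n f. (\<forall>A\<subseteq>{1..n}. \<bar>f A\<bar> \<le> r) \<Longrightarrow> \<exists>t s. exec n f c (initial_memory n) t s \<and> t \<le> poly q n \<and>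
    s ''deg'' 0 = output_degree n (?E n f) \<and>
    (\<forall>i\<le>n. s ''num'' (int i) = numerator n (?E n f) (int i) \<and> s ''den'' (int i) = denominator n)"
    using exec_output_program[of r "\<lambda>n f. numerator n (?E n f)" "\<lambda>n f. denominator n" "\<lambda>n f. output_degree n (?E n f)",
        OF computable_numerator[OF computable_var poly_bounded_var] computable_denominator computable_output_degree] by blast
  have "computes_ehrhart_within c n f (integer_polymatroid.face n f b) (poly q n)"
    if f: "integer_polymatroid n f" and r: "f {1..n} \<le> r" for n f
  proof -
    interpret integer_polymatroid n f by (rule f)
    have "\<bar>f A\<bar> \<le> r" if "A \<subseteq> {1..n}" for A
      using nonneg[OF that] mono[OF that order_refl] r by linarith
    then obtain t s where s: "exec n f c (initial_memory n) t s" "t \<le> poly q n"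
      "s ''deg'' 0 = output_degree n (?E n f)"
      "\<And>i. i \<le> n \<Longrightarrow> s ''num'' (int i) = numerator n (?E n f) (int i) \<and> s ''den'' (int i) = denominator n"
      using cq[of n f] by blast
    obtain p where p: "is_ehrhart_poly (face b) p" "degree p \<le> n" "has_normalized_volume (face b) (lead_coeff p)"
      using ehrhart_face[of b] by blast
    have "f {1..n} \<le> int (nat r)" using r by simp
    from count_values_eq[OF this] have E: "?E n f (int k) = int (ehrhart_count (face b) k)" for k .
    have vals: "poly p (real k) = of_int (?E n f (int k))" for k
      using p(1) by (simp add: E is_ehrhart_poly_def)
    note out = interpolation_output[of p n "?E n f", OF p(2) vals]
    have "output_poly s p"
      unfolding output_poly_def
      using s(3,4) p(2) out by (auto simp: E)
    then show ?thesis unfolding computes_ehrhart_within_def using s p by blast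
  qed
  then show ?thesis by blast
qed

section \<open>Matroid polytopes as faces of polymatroids\<close>

context matroid
begin

lemma rank_polymatroid: "integer_polymatroid n (\<lambda>A. int (matroid_rank \<B> A))"
proof
  fix X Y
  show "int (matroid_rank \<B> (X \<inter> Y)) + int (matroid_rank \<B> (X \<union> Y)) \<le> int (matroid_rank \<B> X) + int (matroid_rank \<B> Y)"
    using rank_submodular[of X Y] by linarith
  show "X \<subseteq> Y \<Longrightarrow> int (matroid_rank \<B> X) \<le> int (matroid_rank \<B> Y)" using rank_mono[of X Y] by simp
qed (simp add: rank_empty)

interpretation rank: integer_polymatroid n "\<lambda>A. int (matroid_rank \<B> A)"
  by (rule rank_polymatroid)

text \<open>Singletons have rank at most 1, so integer points are 0-1 vectors. The inequality for
  the support I says card I <= rank I, which is independence, and the full total makes I a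
  base.\<close>

lemma rank_face_integer_points:
  "rank.face b \<inter> integer_points = indicat_real ` (if b then \<B> else indep_sets \<B>)"
proof (intro equalityI subsetI)
  fix x assume x: "x \<in> rank.face b \<inter> integer_points"
  then have xf: "x \<in> rank.face b" by blast
  define I where "I = {i. x i \<noteq> 0}"
  have I: "I \<subseteq> {1..n}" using rank.faceD(1)[OF xf] unfolding I_def by blast
  then have fin: "finite I" using finite_subset by blast
  have "x i = indicat_real I i" for i
  proof (cases "i \<in> {1..n}")
    case True
    have "x i \<le> real (matroid_rank \<B> {i})" using rank.faceD(3)[OF xf, of "{i}"] True by simp
    also have "\<dots> \<le> 1" using rank_le_card[of "{i}"] by simp
    finally have "x i \<le> 1" .
    moreover have "0 \<le> x i" using rank.faceD(2)[OF xf] .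
    moreover obtain z where "x i = of_int z" using x by (auto simp: integer_points_def elim: Ints_cases)
    ultimately have "x i = 0 \<or> x i = 1" by auto
    then show ?thesis by (auto simp: I_def)
  qed (use I rank.faceD(1)[OF xf] in \<open>auto simp: indicator_def\<close>)
  then have xI: "x = indicat_real I" by blast
  have sum: "sum x A = real (card (A \<inter> I))" if "finite A" for A
  proof -
    have "sum x A = (\<Sum>i\<in>A. of_bool (i \<in> I))" by (intro sum.cong) (simp_all add: xI indicator_def)
    then show ?thesis using that by simp
  qed
  have "real (card I) \<le> real (matroid_rank \<B> I)" using rank.faceD(3)[OF xf I] sum[OF fin] by simp
  then have ind: "I \<in> indep_sets \<B>" using indep_iff_rank[OF I] by simp
  moreover have "I \<in> \<B>" if b
  proof -
    have "real (card ({1..n} \<inter> I)) = real (matroid_rank \<B> {1..n})" using rank.faceD(4)[OF xf that] sum[of "{1..n}"] by simp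
    moreover have "{1..n} \<inter> I = I" using I by blast
    ultimately show ?thesis using ind base_iff by simp
  qed
  ultimately show "x \<in> indicat_real ` (if b then \<B> else indep_sets \<B>)" using xI by auto
next
  fix x assume "x \<in> indicat_real ` (if b then \<B> else indep_sets \<B>)"
  then obtain I where xI: "x = indicat_real I" and I: "I \<in> (if b then \<B> else indep_sets \<B>)" by blast
  then have ind: "I \<in> indep_sets \<B>" using base_iff by (auto split: if_splits)
  have In: "I \<subseteq> {1..n}" by (rule indep_subset[OF ind])
  have sum: "sum x A = real (card (A \<inter> I))" if "finite A" for A
  proof -
    have "sum x A = (\<Sum>i\<in>A. of_bool (i \<in> I))" by (intro sum.cong) (simp_all add: xI indicator_def)
    then show ?thesis using that by simp
  qed
  have "x \<in> rank.face b"
  proof (rule rank.faceI)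
    fix A assume "A \<subseteq> {1..n}"
    then have "finite A" using finite_subset by blast
    moreover have "card (A \<inter> I) \<le> matroid_rank \<B> A" using indep_mono[OF ind] by (intro rank_ge) auto
    ultimately show "sum x A \<le> of_int (int (matroid_rank \<B> A))" using sum by simp
  next
    assume b
    then have "card I = matroid_rank \<B> {1..n}" using I base_card by simp
    moreover have "{1..n} \<inter> I = I" using In by blast
    ultimately show "sum x {1..n} = of_int (int (matroid_rank \<B> {1..n}))" using sum[of "{1..n}"] by simp
  qed (use In in \<open>auto simp: xI indicator_def\<close>)
  then show "x \<in> rank.face b \<inter> integer_points" by (auto simp: xI integer_points_def indicator_def)
qed

lemma face_rank:
  "integer_polymatroid.face n (\<lambda>A. int (matroid_rank \<B> A)) True = matroid_polytope \<B>"
  "integer_polymatroid.face n (\<lambda>A. int (matroid_rank \<B> A)) False = independence_polytope \<B>"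
  using rank.face_eq_convex_hull[of True] rank.face_eq_convex_hull[of False]
  unfolding rank_face_integer_points by (simp_all add: matroid_polytope_def independence_polytope_def)

end

text \<open>Oracle answers are integers, whereas \<psi> is real-valued; on subsets of the ground set
  the floor changes nothing.\<close>

lemma floor_polymatroid:
  assumes \<psi>: "polymatroid_rank n \<psi>" "integral_rank n \<psi>"
  shows "integer_polymatroid n (\<lambda>A. \<lfloor>\<psi> A\<rfloor>)" "integer_polymatroid.face n (\<lambda>A. \<lfloor>\<psi> A\<rfloor>) False = polymatroid n \<psi>"
proof -
  have fl: "of_int \<lfloor>\<psi> A\<rfloor> = \<psi> A" if "A \<subseteq> {1..n}" for A using \<psi>(2) that by (simp add: integral_rank_def)
  show ip: "integer_polymatroid n (\<lambda>A. \<lfloor>\<psi> A\<rfloor>)"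
  proof
    fix X Y assume XY: "X \<subseteq> {1..n}" "Y \<subseteq> {1..n}"
    have "\<psi> (X \<inter> Y) + \<psi> (X \<union> Y) \<le> \<psi> X + \<psi> Y" using \<psi>(1) XY unfolding polymatroid_rank_def by blast
    then have "real_of_int (\<lfloor>\<psi> (X \<inter> Y)\<rfloor> + \<lfloor>\<psi> (X \<union> Y)\<rfloor>) \<le> real_of_int (\<lfloor>\<psi> X\<rfloor> + \<lfloor>\<psi> Y\<rfloor>)"
      unfolding of_int_add fl[OF XY(1)] fl[OF XY(2)] fl[OF le_infI1[OF XY(1)]] fl[OF Un_least[OF XY]] .
    then show "\<lfloor>\<psi> (X \<inter> Y)\<rfloor> + \<lfloor>\<psi> (X \<union> Y)\<rfloor> \<le> \<lfloor>\<psi> X\<rfloor> + \<lfloor>\<psi> Y\<rfloor>" by (simp only: of_int_le_iff)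
  next
    fix X Y assume XY: "X \<subseteq> Y" "Y \<subseteq> {1..n}"
    then have "\<psi> X \<le> \<psi> Y" using \<psi>(1) unfolding polymatroid_rank_def by (meson order_trans)
    then show "\<lfloor>\<psi> X\<rfloor> \<le> \<lfloor>\<psi> Y\<rfloor>" by (rule floor_mono)
  next
    show "\<lfloor>\<psi> {}\<rfloor> = 0" using \<psi>(1) by (simp add: polymatroid_rank_def)
  qed
  have "(\<forall>A\<subseteq>{1..n}. sum x A \<le> of_int \<lfloor>\<psi> A\<rfloor>) \<longleftrightarrow> (\<forall>A\<subseteq>{1..n}. sum x A \<le> \<psi> A)" for x
    by (intro all_cong1 imp_cong refl) (simp only: fl)
  then show "integer_polymatroid.face n (\<lambda>A. \<lfloor>\<psi> A\<rfloor>) False = polymatroid n \<psi>"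
    unfolding integer_polymatroid.face_def[OF ip] polymatroid_def by (simp only: simp_thms mem_Collect_eq)
qed

text \<open>Two programs suffice: one for the base face, which is the matroid polytope, and one for
  the whole polymatroid, which serves both independence polytopes and integral polymatroids.\<close>

theorem theorem1p1:
  fixes r :: int
  shows
    "(\<exists>(c :: com) (q :: nat poly). \<forall>n \<B>.
        matroid_bases n \<B> \<longrightarrow> (\<forall>A\<subseteq>{1..n}. int (matroid_rank \<B> A) \<le> r) \<longrightarrow>
        computes_ehrhart_within c n (\<lambda>A. int (matroid_rank \<B> A)) (matroid_polytope \<B>) (poly q n)) \<and>
     (\<exists>(c :: com) (q :: nat poly). \<forall>n \<B>.
        matroid_bases n \<B> \<longrightarrow> (\<forall>A\<subseteq>{1..n}. int (matroid_rank \<B> A) \<le> r) \<longrightarrow>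
        computes_ehrhart_within c n (\<lambda>A. int (matroid_rank \<B> A)) (independence_polytope \<B>) (poly q n)) \<and>
     (\<exists>(c :: com) (q :: nat poly). \<forall>n \<psi>.
        polymatroid_rank n \<psi> \<longrightarrow> integral_rank n \<psi> \<longrightarrow> (\<forall>A\<subseteq>{1..n}. \<psi> A \<le> real_of_int r) \<longrightarrow>
        computes_ehrhart_within c n (\<lambda>A. \<lfloor>\<psi> A\<rfloor>) (polymatroid n \<psi>) (poly q n))"
proof -
  obtain c q where base: "\<And>n f. integer_polymatroid n f \<Longrightarrow> f {1..n} \<le> r \<Longrightarrow>
    computes_ehrhart_within c n f (integer_polymatroid.face n f True) (poly q n)"
    using ehrhart_of_face_computable[of r True] by blast
  obtain c' q' where full: "\<And>n f. integer_polymatroid n f \<Longrightarrow> f {1..n} \<le> r \<Longrightarrow>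
    computes_ehrhart_within c' n f (integer_polymatroid.face n f False) (poly q' n)"
    using ehrhart_of_face_computable[of r False] by blast
  have "computes_ehrhart_within c n (\<lambda>A. int (matroid_rank \<B> A)) (matroid_polytope \<B>) (poly q n) \<and>
    computes_ehrhart_within c' n (\<lambda>A. int (matroid_rank \<B> A)) (independence_polytope \<B>) (poly q' n)"
    if \<B>: "matroid_bases n \<B>" and r: "\<forall>A\<subseteq>{1..n}. int (matroid_rank \<B> A) \<le> r" for n \<B>
  proof -
    interpret matroid n \<B> by standard (rule \<B>)
    have "int (matroid_rank \<B> {1..n}) \<le> r" using r by blast
    then show ?thesis using base[OF rank_polymatroid] full[OF rank_polymatroid] unfolding face_rank by blast
  qed
  moreover have "computes_ehrhart_within c' n (\<lambda>A. \<lfloor>\<psi> A\<rfloor>) (polymatroid n \<psi>) (poly q' n)"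
    if \<psi>: "polymatroid_rank n \<psi>" "integral_rank n \<psi>" and r: "\<forall>A\<subseteq>{1..n}. \<psi> A \<le> real_of_int r" for n \<psi>
  proof -
    have "\<psi> {1..n} \<le> real_of_int r" using r by blast
    then have "\<lfloor>\<psi> {1..n}\<rfloor> \<le> r" by linarith
    then show ?thesis using full[OF floor_polymatroid(1)[OF \<psi>]] unfolding floor_polymatroid(2)[OF \<psi>] by blast
  qed
  ultimately show ?thesis by blast
qed

end
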